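(* Let $\gamma>0$ be a fixed constant. There is $q_4(\gamma)$ such that the following holds. Let $q\ge q_4(\gamma)$ be a prime, let $a,b$ be integers with $(a,q)=1$, let $f$ be any multiplicative function with $|f(n)|\le 1$ for all $n$, and let $x$ satisfy \[ \sqrt{q}\,(\log q)\,e^{(\log\log\log q)^{1+\gamma}}\le x\le q. \] Then \[ \Bigl|\sum_{\substack{n\le x\\ (n,q)=1}} f(n)\,e_q(an^{*}+bn)\Bigr|\;\le\; \frac{562\,x}{(\log\log\log q)^{\gamma}}. \]
   Context: $e_q(v)=e^{2\pi i v/q}$. For $(n,q)=1$, $n^{*}$ denotes an integer with $nn^{*}\equiv 1\pmod q$. The sum runs over positive integers $n\le x$ coprime to $q$. *)

theory Defs
  imports "HOL-Analysis.Analysis" "HOL-Number_Theory.Number_Theory"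
begin

definition e_q :: "int \<Rightarrow> int \<Rightarrow> complex" where
  "e_q q v = exp (2 * of_real pi * \<i> * of_int v / of_int q)"

definition multiplicative :: "(nat \<Rightarrow> complex) \<Rightarrow> bool" where
  "multiplicative f \<longleftrightarrow> f 1 = 1 \<and> (\<forall>m n. coprime m n \<longrightarrow> f (m * n) = f m * f n)"

end

theory Submission
  imports Defs "HOL-Real_Asymp.Real_Asymp"
begin

hide_const (open) up_ring.coeff up_ring.monom module.smult

text \<open>
  Split the integers \<open>n \<le> x\<close> by their prime factors in a set of primes between \<open>2 ^ J0\<close> and
  \<open>2 ^ J1\<close>, where \<open>2 ^ J0\<close> is a power of \<open>L = ln (ln (ln q))\<close> and \<open>2 ^ J1 \<le> exp (L powr (1 + \<gamma>) / 2)\<close>.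
  Integers without such a factor are rare by Legendre's sieve, which is affordable because
  \<open>2 ^ (2 ^ J1)\<close> is below \<open>sqrt q\<close>. On the others Ramare's identity replaces \<open>f(n)\<close> by a sum of
  \<open>f(p) f(m) w(m)\<close> over \<open>n = p m\<close>, and Cauchy--Schwarz on dyadic blocks of \<open>p\<close> removes \<open>f\<close> and
  leaves incomplete Kloosterman sums with phase \<open>c m* + d m\<close>, \<open>c\<close> prime to \<open>q\<close>.

  These are completed and estimated by Weil's bound \<open>2 sqrt q\<close>, which is proved as follows. The
  character \<open>F \<mapsto> e(s(F))\<close> of monic polynomials over \<open>F_p\<close>, where \<open>s(F)\<close> is the sum of \<open>r + D / r\<close>
  over the roots \<open>r\<close> of \<open>F\<close>, has the L-function \<open>1 + K T + p T^2 = (1 - \<alpha> T) (1 - \<beta> T)\<close> with the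
  Kloosterman sum \<open>K\<close> as coefficient. Its logarithmic derivative expresses \<open>\<alpha>^n + \<beta>^n\<close> by the
  numbers of points of \<open>y^p - y = x + D / x\<close> and of its twists over the field with \<open>p^n\<close> elements.
  For even \<open>n\<close> Bombieri's version of Stepanov's method bounds each of them from above by
  \<open>p^n + O(p^(n/2))\<close>. As they add up to about \<open>p^n\<close> times their number, they are bounded from below
  as well. Hence \<open>\<alpha>^n + \<beta>^n = O(p^(n/2))\<close> for all even \<open>n \<ge> 8\<close>, which with \<open>\<alpha> \<beta> = p\<close> forces
  \<open>|\<alpha>| = |\<beta>| = sqrt p\<close>.
\<close>

section \<open>Congruences modulo an ideal containing a prime\<close>

text \<open>No finite field is constructed. The elements of the field with \<open>p ^ n\<close>
  elements are grouped into Frobenius orbits, one for each prime polynomial \<open>P\<close> of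
  degree dividing \<open>n\<close>, and an equation at the points of an orbit becomes membership in
  the ideal generated by \<open>p\<close> and \<open>P\<close>. Stepanov's method needs
  \<open>p ^ n = Q * Q\<close>: the auxiliary function is built so that its \<open>Q\<close>-th
  power collapses, at the points to be counted, to a function of much smaller pole order. This is
  why only even \<open>n\<close> occur. The sizes in the sieve are forced by \<gamma>. Sieving
  leaves a proportion of about \<open>J0 ^ 4 / J1\<close>, so \<open>J1\<close> must have order
  \<open>L powr (1 + \<gamma>)\<close>. The diagonal terms cost \<open>J1 / sqrt (2 ^ J0)\<close>,
  so \<open>2 ^ J0\<close> has to reach \<open>L powr (2 + 4 * \<gamma>)\<close>. The off-diagonal
  terms cost \<open>J1 * sqrt (2 ^ J1 * B / x)\<close>, where \<open>x\<close> exceeds the bound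
  \<open>B\<close> for incomplete Kloosterman sums by about
  \<open>exp (L powr (1 + \<gamma>))\<close>, so \<open>2 ^ J1\<close> is kept below the square root
  of that.\<close>

lemma fermat_int:
  assumes "prime p" "\<not> int p dvd c"
  shows "[c ^ (p - 1) = 1] (mod int p)"
proof -
  have "p > 0" using assms(1) by (rule prime_gt_0_nat)
  define r where "r = nat (c mod int p)"
  have r: "[c = int r] (mod int p)" using \<open>p > 0\<close> by (simp add: r_def cong_def)
  have "\<not> p dvd r" using assms(2) r by (metis cong_dvd_iff int_dvd_int_iff)
  then have "[r ^ (p - 1) = 1] (mod p)" by (rule fermat_theorem[OF assms(1)])
  then have "[int r ^ (p - 1) = 1] (mod int p)" by (metis cong_int_iff of_nat_1 of_nat_power)
  then show ?thesis using r by (meson cong_pow cong_trans)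
qed

text \<open>The quotient rings needed later depend on a polynomial, so they cannot be types;
  congruence modulo a set of ring elements takes their place.\<close>

locale cring_ideal =
  fixes I :: "'a::comm_ring_1 set"
  assumes zero_mem: "0 \<in> I"
    and add_mem: "a \<in> I \<Longrightarrow> b \<in> I \<Longrightarrow> a + b \<in> I"
    and mult_mem: "a \<in> I \<Longrightarrow> r * a \<in> I"
begin

definition cg :: "'a \<Rightarrow> 'a \<Rightarrow> bool" (infix "\<asymp>" 50) where
  "a \<asymp> b \<longleftrightarrow> a - b \<in> I"

lemma mult_mem': "a \<in> I \<Longrightarrow> a * r \<in> I"
  using mult_mem[of a r] by (simp add: mult.commute)

lemma uminus_mem: "a \<in> I \<Longrightarrow> - a \<in> I"
  using mult_mem[of a "-1"] by simp

lemma diff_mem: "a \<in> I \<Longrightarrow> b \<in> I \<Longrightarrow> a - b \<in> I"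
  using add_mem[of a "- b"] uminus_mem[of b] by simp

lemma sum_mem: "(\<And>i. i \<in> A \<Longrightarrow> f i \<in> I) \<Longrightarrow> sum f A \<in> I"
  by (induction A rule: infinite_finite_induct) (auto simp: zero_mem add_mem)

lemma cg_refl [simp]: "a \<asymp> a"
  by (simp add: cg_def zero_mem)

lemma cg_sym: "a \<asymp> b \<Longrightarrow> b \<asymp> a"
  using uminus_mem[of "a - b"] by (simp add: cg_def)

lemma cg_trans [trans]: "a \<asymp> b \<Longrightarrow> b \<asymp> c \<Longrightarrow> a \<asymp> c"
  using add_mem[of "a - b" "b - c"] by (simp add: cg_def)

lemma cg_add: "a \<asymp> b \<Longrightarrow> c \<asymp> d \<Longrightarrow> a + c \<asymp> b + d"
  using add_mem[of "a - b" "c - d"] by (simp add: cg_def algebra_simps)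

lemma cg_diff: "a \<asymp> b \<Longrightarrow> c \<asymp> d \<Longrightarrow> a - c \<asymp> b - d"
  using diff_mem[of "a - b" "c - d"] by (simp add: cg_def algebra_simps)

lemma cg_uminus: "a \<asymp> b \<Longrightarrow> - a \<asymp> - b"
  using cg_diff[of 0 0 a b] by simp

lemma cg_mult: "a \<asymp> b \<Longrightarrow> c \<asymp> d \<Longrightarrow> a * c \<asymp> b * d"
proof -
  assume "a \<asymp> b" "c \<asymp> d"
  then have "c * (a - b) + b * (c - d) \<in> I"
    unfolding cg_def by (intro add_mem mult_mem)
  then show ?thesis by (simp add: cg_def algebra_simps)
qed

lemma cg_power: "a \<asymp> b \<Longrightarrow> a ^ n \<asymp> b ^ n"
  by (induction n) (auto intro: cg_mult)

lemma cg_sum: "(\<And>i. i \<in> A \<Longrightarrow> f i \<asymp> g i) \<Longrightarrow> sum f A \<asymp> sum g A"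
  unfolding cg_def by (subst sum_subtractf [symmetric]) (rule sum_mem)

lemma cg_mem: "a \<asymp> b \<Longrightarrow> a \<in> I \<longleftrightarrow> b \<in> I"
  using diff_mem[of a "a - b"] add_mem[of "a - b" b] by (auto simp: cg_def)

lemma cg_0_iff: "a \<asymp> 0 \<longleftrightarrow> a \<in> I"
  by (simp add: cg_def)

end

locale cring_ideal_char = cring_ideal I for I :: "'a::comm_ring_1 set" +
  fixes p :: nat
  assumes prime_p: "prime p" and p_mem: "of_nat p \<in> I"
begin

lemma p_gt_1: "p > 1" and p_ge_2: "p \<ge> 2" and p_pos: "p > 0"
  using prime_gt_1_nat[OF prime_p] by auto

lemma of_int_mem: "int p dvd k \<Longrightarrow> of_int k \<in> I"
  using mult_mem[OF p_mem] by (auto simp: dvd_def mult.commute)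

lemma of_int_cg: "[k = l] (mod int p) \<Longrightarrow> of_int k \<asymp> of_int l"
  using of_int_mem[of "k - l"] by (simp add: cg_def cong_iff_dvd_diff)

lemma frobenius_add: "(a + b) ^ p \<asymp> a ^ p + b ^ p"
proof -
  have *: "{..p} = insert 0 (insert p {0<..<p})"
    using p_pos by auto
  have "(a + b) ^ p = (\<Sum>k\<in>{0<..<p}. of_nat (p choose k) * a ^ k * b ^ (p - k)) + (a ^ p + b ^ p)"
    unfolding binomial_ring * using p_pos by (simp add: add.assoc add.commute)
  also have "\<dots> \<asymp> 0 + (a ^ p + b ^ p)"
  proof (intro cg_add cg_refl)
    have "of_nat (p choose k) * a ^ k * b ^ (p - k) \<in> I" if "k \<in> {0<..<p}" for k
    proof -
      have "p dvd p choose k"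
        by (rule dvd_choose_prime) (use that prime_p in auto)
      then have "of_nat (p choose k) \<in> I"
        using mult_mem[OF p_mem] by (auto simp: dvd_def mult.commute)
      then show ?thesis by (simp add: mult_mem' mult.assoc)
    qed
    then show "(\<Sum>k\<in>{0<..<p}. of_nat (p choose k) * a ^ k * b ^ (p - k)) \<asymp> 0"
      unfolding cg_0_iff by (rule sum_mem)
  qed
  finally show ?thesis by simp
qed

lemma frobenius_pow_add: "(a + b) ^ (p ^ k) \<asymp> a ^ (p ^ k) + b ^ (p ^ k)"
proof (induction k)
  case (Suc k)
  have "(a + b) ^ (p ^ Suc k) = ((a + b) ^ (p ^ k)) ^ p"
    by (simp add: power_mult [symmetric] mult.commute)
  also have "\<dots> \<asymp> (a ^ (p ^ k) + b ^ (p ^ k)) ^ p"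
    by (rule cg_power) (rule Suc)
  also have "\<dots> \<asymp> (a ^ (p ^ k)) ^ p + (b ^ (p ^ k)) ^ p"
    by (rule frobenius_add)
  finally show ?case by (simp add: power_mult [symmetric] mult.commute)
qed simp

lemma frobenius_sum: "(\<Sum>i\<in>A. f i) ^ (p ^ k) \<asymp> (\<Sum>i\<in>A. f i ^ (p ^ k))"
proof (induction A rule: infinite_finite_induct)
  case (insert x A)
  have "(f x + sum f A) ^ (p ^ k) \<asymp> f x ^ (p ^ k) + sum f A ^ (p ^ k)"
    by (rule frobenius_pow_add)
  also have "\<dots> \<asymp> f x ^ (p ^ k) + (\<Sum>i\<in>A. f i ^ (p ^ k))"
    by (intro cg_add cg_refl insert)
  finally show ?case using insert by simp
qed (use p_pos in \<open>auto simp: power_0_left\<close>)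

lemma frobenius_uminus: "(- a) ^ (p ^ k) \<asymp> - (a ^ (p ^ k))"
proof -
  have "0 = (a + - a) ^ (p ^ k)" using p_pos by (simp add: power_0_left)
  also have "\<dots> \<asymp> a ^ (p ^ k) + (- a) ^ (p ^ k)" by (rule frobenius_pow_add)
  finally have "a ^ (p ^ k) + (- a) ^ (p ^ k) \<asymp> 0" by (rule cg_sym)
  then show ?thesis by (simp add: cg_def add.commute)
qed

lemma frobenius_diff: "(a - b) ^ (p ^ k) \<asymp> a ^ (p ^ k) - b ^ (p ^ k)"
  using cg_trans[OF frobenius_pow_add[of a "- b" k] cg_add[OF cg_refl frobenius_uminus]] by simp

lemma of_int_power_p: "of_int c ^ (p ^ k) \<asymp> of_int c"
proof -
  have "[c ^ p = c] (mod int p)" for c :: int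
  proof (cases "int p dvd c")
    case True
    then show ?thesis using p_pos
      by (metis cong_0_iff cong_sym_eq cong_trans dvd_power dvd_trans)
  next
    case False
    have "[c ^ (p - 1) = 1] (mod int p)" by (rule fermat_int[OF prime_p False])
    then have "[c ^ (p - 1) * c = 1 * c] (mod int p)" by (rule cong_scalar_right)
    then show ?thesis using power_minus_mult[OF p_pos, of c] by simp
  qed
  then have "of_int (c ^ p) \<asymp> of_int c" for c by (rule of_int_cg)
  then have base: "of_int c ^ p \<asymp> of_int c" for c by simp
  show ?thesis
  proof (induction k)
    case (Suc k)
    have "of_int c ^ (p ^ Suc k) = (of_int c ^ (p ^ k)) ^ p"
      by (simp add: power_mult [symmetric] mult.commute)
    also have "\<dots> \<asymp> of_int c ^ p" by (rule cg_power[OF Suc])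
    also have "\<dots> \<asymp> of_int c" by (rule base)
    finally show ?case .
  qed simp
qed

end

locale prime_ideal_char = cring_ideal_char +
  assumes one_notin: "1 \<notin> I"
    and prime_mem: "a * b \<in> I \<Longrightarrow> a \<in> I \<or> b \<in> I"
begin

lemma power_mem: "a ^ n \<in> I \<Longrightarrow> a \<in> I"
  by (induction n) (use one_notin prime_mem in auto)

text \<open>The difference of the powers is congruent to \<open>(a - b) ^ (p ^ k)\<close>, and a
  prime ideal containing a power contains its base.\<close>

lemma frobenius_inj: "a ^ (p ^ k) \<asymp> b ^ (p ^ k) \<Longrightarrow> a \<asymp> b"
  using cg_trans[OF frobenius_diff[of a b k]] power_mem[of "a - b" "p ^ k"]
  by (metis cg_0_iff cg_def frobenius_diff cg_mem)

lemma cg_cancel: "c * a \<asymp> c * b \<Longrightarrow> c \<notin> I \<Longrightarrow> a \<asymp> b"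
  using prime_mem[of c "a - b"] by (auto simp: cg_def algebra_simps)

text \<open>The bound of the number of roots by the degree, over the domain of residues modulo
  \<open>I\<close>. Splitting off the linear factor of one root keeps the others as roots of the
  quotient, since the elements of \<open>R\<close> are pairwise incongruent.\<close>

lemma poly_coeffs_mem_if_many_roots:
  fixes f :: "'a poly"
  assumes "finite R" "card R > degree f"
    and "\<And>u. u \<in> R \<Longrightarrow> poly f u \<in> I"
    and "\<And>u w. u \<in> R \<Longrightarrow> w \<in> R \<Longrightarrow> u \<asymp> w \<Longrightarrow> u = w"
  shows "coeff f i \<in> I"
  using assms
proof (induction "degree f" arbitrary: f R i)
  case 0
  then obtain c where c: "f = [:c:]" by (metis degree_0_id)
  from 0 obtain u where "u \<in> R" by fastforce
  with 0 c have "c \<in> I" by auto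
  then show ?case by (cases i) (auto simp: c zero_mem)
next
  case (Suc n)
  obtain u where u: "u \<in> R" using Suc by fastforce
  define g where "g = synthetic_div f u"
  have dg: "degree g = n" using Suc(2) by (simp add: g_def degree_synthetic_div)
  have f: "f + smult u g = pCons (poly f u) g"
    unfolding g_def by (rule synthetic_div_correct)
  have fe: "poly f w = poly f u + (w - u) * poly g w" for w
  proof -
    have "poly (f + smult u g) w = poly (pCons (poly f u) g) w" by (simp only: f)
    then show ?thesis by (simp add: algebra_simps)
  qed
  have g_mem: "coeff g j \<in> I" for j
  proof (rule Suc(1))
    show "n = degree g" by (simp add: dg)
    show "finite (R - {u})" using Suc by simp
    show "card (R - {u}) > degree g" using Suc u dg by simp
    show "poly g w \<in> I" if w: "w \<in> R - {u}" for w
    proof -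
      have "(w - u) * poly g w \<in> I"
        using diff_mem[OF Suc(5)[of w] Suc(5)[OF u]] w fe[of w] by simp
      moreover have "w - u \<notin> I" using Suc(6)[of w u] u w by (auto simp: cg_def)
      ultimately show ?thesis using prime_mem by blast
    qed
    show "w = w'" if "w \<in> R - {u}" "w' \<in> R - {u}" "w \<asymp> w'" for w w'
      using Suc(6) that by auto
  qed
  have "coeff (f + smult u g) i \<in> I"
    unfolding f by (cases i) (use Suc(5)[OF u] g_mem in auto)
  then show ?case using diff_mem[of _ "u * coeff g i"] g_mem[of i] mult_mem by fastforce
qed

end

section \<open>The ring \<open>F_p[x]\<close> and unique factorization\<close>

lemma cring_ideal_dvd: "cring_ideal {k :: int. m dvd k}"
  by unfold_locales auto

section \<open>Ideals of polynomials: extension of an ideal and adjunction of a monic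
  polynomial\<close>

definition coeffs_in :: "'a::comm_ring_1 set \<Rightarrow> 'a poly set" where
  "coeffs_in I = {f. \<forall>i. coeff f i \<in> I}"

text \<open>The ideal generated by \<open>\<Phi>\<close> and the extension of \<open>I\<close>, so
  that congruence modulo it is equality in \<open>(R/I)[T]/(\<Phi>)\<close>. It is applied twice,
  first to a polynomial over \<open>F_p\<close> and then, in a second variable, to the equation of
  the curve.\<close>

definition adjoin :: "'a::comm_ring_1 set \<Rightarrow> 'a poly \<Rightarrow> 'a poly set" where
  "adjoin I \<Phi> = {\<Phi> * B + g | B g. g \<in> coeffs_in I}"

context cring_ideal
begin

lemma cring_ideal_coeffs: "cring_ideal (coeffs_in I)"
proof
  fix a r assume "a \<in> coeffs_in I"
  then show "r * a \<in> coeffs_in I"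
    by (auto simp: coeffs_in_def coeff_mult intro!: sum_mem mult_mem)
qed (auto simp: coeffs_in_def zero_mem add_mem)

interpretation coeffs: cring_ideal "coeffs_in I"
  by (rule cring_ideal_coeffs)

lemma cring_ideal_adjoin: "cring_ideal (adjoin I \<Phi>)"
proof
  show "0 \<in> adjoin I \<Phi>"
    unfolding adjoin_def using coeffs.zero_mem by (intro CollectI exI[of _ 0]) auto
next
  fix a b assume "a \<in> adjoin I \<Phi>" "b \<in> adjoin I \<Phi>"
  then obtain B g B' g' where "a = \<Phi> * B + g" "g \<in> coeffs_in I" "b = \<Phi> * B' + g'" "g' \<in> coeffs_in I"
    unfolding adjoin_def by blast
  then have "a + b = \<Phi> * (B + B') + (g + g')" "g + g' \<in> coeffs_in I"
    using coeffs.add_mem by (auto simp: algebra_simps)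
  then show "a + b \<in> adjoin I \<Phi>" unfolding adjoin_def by blast
next
  fix a r assume "a \<in> adjoin I \<Phi>"
  then obtain B g where "a = \<Phi> * B + g" "g \<in> coeffs_in I"
    unfolding adjoin_def by blast
  then have "r * a = \<Phi> * (r * B) + r * g" "r * g \<in> coeffs_in I"
    using coeffs.mult_mem by (auto simp: algebra_simps)
  then show "r * a \<in> adjoin I \<Phi>" unfolding adjoin_def by blast
qed

lemma adjoin_self: "\<Phi> \<in> adjoin I \<Phi>"
  unfolding adjoin_def using coeffs.zero_mem by (intro CollectI exI[of _ 1] exI[of _ 0]) auto

lemma coeffs_subset_adjoin: "coeffs_in I \<subseteq> adjoin I \<Phi>"
  unfolding adjoin_def by (auto intro: exI[of _ 0])

text \<open>The coefficient of the product at \<open>degree \<Phi> + k\<close> is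
  \<open>coeff B k\<close> plus multiples of higher coefficients of \<open>B\<close>. Only these
  high coefficients of the product matter, which is what makes remainders unique.\<close>

lemma coeffs_mem_of_monic_mult:
  assumes "lead_coeff \<Phi> = 1" and "\<And>i. i \<ge> degree \<Phi> \<Longrightarrow> coeff (\<Phi> * B) i \<in> I"
  shows "B \<in> coeffs_in I"
proof -
  \<comment> \<open>Downward induction on \<open>k\<close>: \<open>n\<close> bounds the distance
    from \<open>k\<close> to the first index above the degree of \<open>B\<close>.\<close>
  have "coeff B k \<in> I" if "degree B < k + n" for k n
    using that
  proof (induction n arbitrary: k)
    case 0
    then show ?case by (simp add: coeff_eq_0 zero_mem)
  next
    case (Suc n)
    define D where "D = degree \<Phi>"
    have "coeff (\<Phi> * B) (D + k) = (\<Sum>i\<le>D + k. coeff \<Phi> i * coeff B (D + k - i))"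
      by (rule coeff_mult)
    also have "\<dots> = (\<Sum>i\<le>D. coeff \<Phi> i * coeff B (D + k - i))"
      by (rule sum.mono_neutral_right) (auto simp: D_def coeff_eq_0)
    also have "\<dots> = (\<Sum>i<D. coeff \<Phi> i * coeff B (D + k - i)) + coeff B k"
      using assms(1) by (simp add: D_def lessThan_Suc_atMost [symmetric])
    finally have *: "coeff B k = coeff (\<Phi> * B) (D + k) - (\<Sum>i<D. coeff \<Phi> i * coeff B (D + k - i))"
      by simp
    have "coeff B (D + k - i) \<in> I" if "i < D" for i
      using Suc.IH[of "D + k - i"] Suc.prems that by simp
    then show ?case
      unfolding * using assms(2) by (intro diff_mem sum_mem mult_mem) (auto simp: D_def)
  qed
  from this[of _ "Suc (degree B)"] show ?thesis by (simp add: coeffs_in_def)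
qed

lemma monic_cancel: "lead_coeff \<Phi> = 1 \<Longrightarrow> \<Phi> * B \<in> coeffs_in I \<Longrightarrow> B \<in> coeffs_in I"
  by (rule coeffs_mem_of_monic_mult) (auto simp: coeffs_in_def)

text \<open>The product of \<open>\<Phi>\<close> with its cofactor has, modulo \<open>I\<close>, no
  coefficients from \<open>degree \<Phi>\<close> on, so the cofactor vanishes modulo
  \<open>I\<close>.\<close>

lemma adjoin_small_degree:
  assumes "lead_coeff \<Phi> = 1" "f \<in> adjoin I \<Phi>" "degree f < degree \<Phi>"
  shows "f \<in> coeffs_in I"
proof -
  obtain B g where f: "f = \<Phi> * B + g" and g: "g \<in> coeffs_in I"
    using assms(2) unfolding adjoin_def by blast
  have "B \<in> coeffs_in I"
  proof (rule coeffs_mem_of_monic_mult[OF assms(1)])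
    fix i assume i: "i \<ge> degree \<Phi>"
    have "coeff (\<Phi> * B) i = coeff f i - coeff g i" by (simp add: f)
    also have "\<dots> = - coeff g i" using i assms(3) by (simp add: coeff_eq_0)
    finally show "coeff (\<Phi> * B) i \<in> I" using g by (simp add: coeffs_in_def uminus_mem)
  qed
  then show ?thesis unfolding f using g by (intro coeffs.add_mem coeffs.mult_mem)
qed

end

context cring_ideal_char
begin

lemma cring_ideal_char_coeffs: "cring_ideal_char (coeffs_in I) p"
proof (rule cring_ideal_char.intro[OF cring_ideal_coeffs], unfold_locales)
  show "of_nat p \<in> coeffs_in I"
    unfolding coeffs_in_def of_nat_poly
    by (auto simp: coeff_pCons zero_mem p_mem split: nat.splits)
qed (rule prime_p)

interpretation coeffs: cring_ideal_char "coeffs_in I" p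
  by (rule cring_ideal_char_coeffs)

lemma cring_ideal_char_adjoin: "cring_ideal_char (adjoin I \<Phi>) p"
proof -
  interpret A: cring_ideal "adjoin I \<Phi>" by (rule cring_ideal_adjoin)
  show ?thesis
    by unfold_locales (use prime_p coeffs.p_mem coeffs_subset_adjoin in auto)
qed

end

text \<open>Polynomials over \<open>F_p\<close> are integer polynomials up to congruence coefficientwise: \<open>F \<in> gen_ideal P\<close>
means that \<open>P\<close> divides \<open>F\<close> over \<open>F_p\<close>, and \<open>monic_polys n\<close> has one representative per monic polynomial.\<close>
locale fp_poly =
  fixes p :: nat
  assumes prime_p: "prime p"
begin

lemma p_gt_1: "p > 1" and p_ge_2: "p \<ge> 2" and p_pos: "p > 0"
  using prime_gt_1_nat[OF prime_p] by auto

sublocale base: cring_ideal_char "{k :: int. int p dvd k}" p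
  by (rule cring_ideal_char.intro[OF cring_ideal_dvd]) (unfold_locales, auto simp: prime_p)

definition p_ideal :: "int poly set" where "p_ideal = coeffs_in {k. int p dvd k}"

lemma p_ideal_iff: "F \<in> p_ideal \<longleftrightarrow> (\<forall>i. int p dvd coeff F i)"
  by (simp add: p_ideal_def coeffs_in_def)

sublocale p_ideal: cring_ideal_char p_ideal p
  unfolding p_ideal_def by (rule base.cring_ideal_char_coeffs)

definition gen_ideal :: "int poly \<Rightarrow> int poly set" where "gen_ideal P = adjoin {k. int p dvd k} P"

lemma gen_ideal_iff: "F \<in> gen_ideal P \<longleftrightarrow> (\<exists>U. F - P * U \<in> p_ideal)"
proof
  assume "F \<in> gen_ideal P"
  then obtain B g where "F = P * B + g" "g \<in> p_ideal" unfolding gen_ideal_def adjoin_def p_ideal_def by blast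
  then have "F - P * B \<in> p_ideal" by simp
  then show "\<exists>U. F - P * U \<in> p_ideal" ..
next
  assume "\<exists>U. F - P * U \<in> p_ideal"
  then obtain U where U: "F - P * U \<in> p_ideal" by blast
  have "F = P * U + (F - P * U)" by simp
  then show "F \<in> gen_ideal P" using U unfolding gen_ideal_def adjoin_def p_ideal_def by blast
qed

lemma ideal_char_gen_ideal: "cring_ideal_char (gen_ideal P) p"
  unfolding gen_ideal_def by (rule base.cring_ideal_char_adjoin)

lemma gen_ideal_zero: "0 \<in> gen_ideal P"
  and gen_ideal_add: "a \<in> gen_ideal P \<Longrightarrow> b \<in> gen_ideal P \<Longrightarrow> a + b \<in> gen_ideal P"
  and gen_ideal_diff: "a \<in> gen_ideal P \<Longrightarrow> b \<in> gen_ideal P \<Longrightarrow> a - b \<in> gen_ideal P"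
  and gen_ideal_mult: "a \<in> gen_ideal P \<Longrightarrow> r * a \<in> gen_ideal P"
  and gen_ideal_mult': "a \<in> gen_ideal P \<Longrightarrow> a * r \<in> gen_ideal P"
proof -
  interpret cring_ideal_char "gen_ideal P" p by (rule ideal_char_gen_ideal)
  show "0 \<in> gen_ideal P" "a \<in> gen_ideal P \<Longrightarrow> b \<in> gen_ideal P \<Longrightarrow> a + b \<in> gen_ideal P"
    "a \<in> gen_ideal P \<Longrightarrow> b \<in> gen_ideal P \<Longrightarrow> a - b \<in> gen_ideal P"
    "a \<in> gen_ideal P \<Longrightarrow> r * a \<in> gen_ideal P" "a \<in> gen_ideal P \<Longrightarrow> a * r \<in> gen_ideal P"
    by (auto simp: zero_mem add_mem diff_mem mult_mem mult_mem')
qed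

lemma gen_ideal_self: "P \<in> gen_ideal P"
  unfolding gen_ideal_def by (rule base.adjoin_self)

lemma p_ideal_subset_gen_ideal: "F \<in> p_ideal \<Longrightarrow> F \<in> gen_ideal P"
  unfolding gen_ideal_def p_ideal_def using base.coeffs_subset_adjoin by blast

lemma gen_ideal_trans: "F \<in> gen_ideal P \<Longrightarrow> P \<in> gen_ideal H \<Longrightarrow> F \<in> gen_ideal H"
proof -
  assume "F \<in> gen_ideal P" and P: "P \<in> gen_ideal H"
  then obtain U where "F - P * U \<in> p_ideal" by (auto simp: gen_ideal_iff)
  then have "(F - P * U) + P * U \<in> gen_ideal H"
    using P by (intro gen_ideal_add gen_ideal_mult') (auto intro: p_ideal_subset_gen_ideal)
  then show ?thesis by simp
qed

lemma gen_ideal_cong: "F - G \<in> p_ideal \<Longrightarrow> F \<in> gen_ideal P \<longleftrightarrow> G \<in> gen_ideal P"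
  using gen_ideal_add[of "F - G" P G] gen_ideal_diff[of F P "F - G"] p_ideal_subset_gen_ideal[of "F - G" P] by auto

lemma gen_ideal_small_degree:
  "lead_coeff P = 1 \<Longrightarrow> F \<in> gen_ideal P \<Longrightarrow> degree F < degree P \<Longrightarrow> F \<in> p_ideal"
  unfolding gen_ideal_def p_ideal_def by (rule base.adjoin_small_degree)

lemma p_ideal_monic_cancel: "lead_coeff P = 1 \<Longrightarrow> P * F \<in> p_ideal \<Longrightarrow> F \<in> p_ideal"
  unfolding p_ideal_def by (rule base.monic_cancel)

lemma one_notin_p_ideal: "1 \<notin> p_ideal"
  using p_gt_1 by (auto simp: p_ideal_iff intro!: exI[of _ 0])

lemma one_notin_gen_ideal: "lead_coeff P = 1 \<Longrightarrow> degree P > 0 \<Longrightarrow> 1 \<notin> gen_ideal P"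
  using gen_ideal_small_degree[of P 1] one_notin_p_ideal by auto

lemma monic_division:
  assumes "lead_coeff (P :: int poly) = 1"
  obtains U R where "F = P * U + R" "R = 0 \<or> degree R < degree P"
proof -
  have "P \<noteq> 0" using assms by auto
  \<comment> \<open>Pseudo-division by a monic polynomial scales the dividend by a power of 1 only,
    so it is genuine division over the integers.\<close>
  obtain U R where UR: "pseudo_divmod F P = (U, R)" by force
  from pseudo_divmod[OF \<open>P \<noteq> 0\<close> UR] assms have "F = P * U + R" "R = 0 \<or> degree R < degree P"
    by auto
  then show thesis by (rule that)
qed

text \<open>\<open>degree\<close> is that of the integer polynomial, whose top coefficients may be
  divisible by \<open>p\<close>. They are dropped, and the highest remaining coefficient is inverted
  modulo \<open>p\<close>.\<close>

lemma monic_scaling: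
  assumes "R \<notin> p_ideal"
  obtains c R' where "lead_coeff R' = 1" "degree R' \<le> degree R" "R' - smult c R \<in> p_ideal"
proof -
  define S where "S = {i. \<not> int p dvd coeff R i}"
  have sub: "S \<subseteq> {..degree R}" by (auto simp: S_def intro: le_degree)
  then have fin: "finite S" by (rule finite_subset) auto
  have ne: "S \<noteq> {}" using assms by (auto simp: S_def p_ideal_iff)
  define e where "e = Max S"
  have e: "e \<in> S" unfolding e_def by (rule Max_in[OF fin ne])
  have max: "int p dvd coeff R i" if "i > e" for i
    using that Max_ge[OF fin, of i] by (auto simp: e_def S_def)
  have "coprime (coeff R e) (int p)"
    using e prime_p by (auto simp: S_def coprime_commute prime_imp_coprime)
  then obtain c where c: "[coeff R e * c = 1] (mod int p)"
    using cong_solve_coprime_int by blast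
  define R' where "R' = monom 1 e + (\<Sum>i<e. monom (c * coeff R i) i)"
  have co: "coeff R' i = (if i = e then 1 else if i < e then c * coeff R i else 0)" for i
    unfolding R'_def by (auto simp: coeff_sum)
  have deg: "degree R' = e"
    by (rule antisym) (auto intro!: degree_le le_degree simp: co)
  show thesis
  proof (rule that)
    show "lead_coeff R' = 1" by (simp add: deg co)
    show "degree R' \<le> degree R" using e sub deg by auto
    have "int p dvd coeff R' i - c * coeff R i" for i
    proof (cases "i = e")
      case True
      then show ?thesis using c by (simp add: co cong_iff_dvd_diff dvd_diff_commute mult.commute)
    next
      case False
      then show ?thesis using max[of i] by (auto simp: co)
    qed
    then show "R' - smult c R \<in> p_ideal" by (simp add: p_ideal_iff)
  qed
qed

section \<open>Monic representatives modulo \<open>p\<close> and their number\<close>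

definition monic_polys :: "nat \<Rightarrow> int poly set" where
  "monic_polys n = {F. degree F = n \<and> coeff F n = 1 \<and> (\<forall>i. coeff F i \<in> {0..<int p})}"

definition reduce :: "int poly \<Rightarrow> int poly" where
  "reduce F = map_poly (\<lambda>c. c mod int p) F"

lemma coeff_reduce: "coeff (reduce F) i = coeff F i mod int p"
  by (simp add: reduce_def coeff_map_poly)

lemma reduce_cong: "F - reduce F \<in> p_ideal"
  by (simp add: p_ideal_iff coeff_reduce)

lemma reduce_cong': "reduce F - F \<in> p_ideal"
  using p_ideal.uminus_mem[OF reduce_cong[of F]] by simp

lemma reduce_in_monic_polys: "lead_coeff F = 1 \<Longrightarrow> reduce F \<in> monic_polys (degree F)"
proof -
  assume F: "lead_coeff F = 1"
  have "degree (reduce F) = degree F"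
  proof (rule antisym)
    show "degree (reduce F) \<le> degree F" by (rule degree_le) (simp add: coeff_reduce coeff_eq_0)
    show "degree F \<le> degree (reduce F)" by (rule le_degree) (use F p_gt_1 in \<open>simp add: coeff_reduce\<close>)
  qed
  then show ?thesis using F p_gt_1 by (auto simp: monic_polys_def coeff_reduce)
qed

lemma monic_polys_eqI: "F \<in> monic_polys m \<Longrightarrow> G \<in> monic_polys n \<Longrightarrow> F - G \<in> p_ideal \<Longrightarrow> F = G"
proof (rule poly_eqI)
  fix i assume "F \<in> monic_polys m" "G \<in> monic_polys n" "F - G \<in> p_ideal"
  then have "[coeff F i = coeff G i] (mod int p)" "coeff F i \<in> {0..<int p}" "coeff G i \<in> {0..<int p}"
    by (auto simp: monic_polys_def p_ideal_iff cong_iff_dvd_diff)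
  then show "coeff F i = coeff G i" by (auto simp: cong_def)
qed

lemma monic_polys_monic: "F \<in> monic_polys n \<Longrightarrow> lead_coeff F = 1" "F \<in> monic_polys n \<Longrightarrow> degree F = n"
  by (auto simp: monic_polys_def)

lemma bij_monic_polys:
  "bij_betw (\<lambda>c. monom 1 n + (\<Sum>i<n. monom (c i) i)) ({..<n} \<rightarrow>\<^sub>E {0..<int p}) (monic_polys n)"
proof -
  define h where "h = (\<lambda>c::nat \<Rightarrow> int. monom 1 n + (\<Sum>i<n. monom (c i) i))"
  have co: "coeff (h c) i = (if i = n then 1 else if i < n then c i else 0)" for c i
    unfolding h_def by (auto simp: coeff_sum)
  have deg: "degree (h c) = n" for c
    by (rule antisym) (auto intro!: degree_le le_degree simp: co)
  have "bij_betw h ({..<n} \<rightarrow>\<^sub>E {0..<int p}) (monic_polys n)"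
  proof (rule bij_betw_imageI)
    show "inj_on h ({..<n} \<rightarrow>\<^sub>E {0..<int p})"
    proof (rule inj_onI)
      fix c c' assume cc: "c \<in> {..<n} \<rightarrow>\<^sub>E {0..<int p}" "c' \<in> {..<n} \<rightarrow>\<^sub>E {0..<int p}" "h c = h c'"
      have "c i = c' i" if "i < n" for i
        using arg_cong[OF cc(3), of "\<lambda>f. coeff f i"] that by (simp add: co)
      then show "c = c'" using cc(1,2) by (intro PiE_ext) auto
    qed
    show "h ` ({..<n} \<rightarrow>\<^sub>E {0..<int p}) = monic_polys n"
    proof (intro equalityI subsetI)
      fix F assume "F \<in> h ` ({..<n} \<rightarrow>\<^sub>E {0..<int p})"
      then show "F \<in> monic_polys n" using p_gt_1 by (auto simp: monic_polys_def deg co PiE_def Pi_def)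
    next
      fix F assume F: "F \<in> monic_polys n"
      have "F = h (restrict (coeff F) {..<n})"
        by (rule poly_eqI) (use F in \<open>auto simp: co monic_polys_def coeff_eq_0\<close>)
      moreover have "restrict (coeff F) {..<n} \<in> {..<n} \<rightarrow>\<^sub>E {0..<int p}"
        using F by (auto simp: monic_polys_def)
      ultimately show "F \<in> h ` ({..<n} \<rightarrow>\<^sub>E {0..<int p})" by blast
    qed
  qed
  then show ?thesis by (simp add: h_def)
qed

lemma card_monic_polys: "card (monic_polys n) = p ^ n"
  using bij_betw_same_card[OF bij_monic_polys[of n]] by (simp add: card_PiE)

lemma finite_monic_polys: "finite (monic_polys n)"
  using bij_betw_finite[OF bij_monic_polys[of n]] by (simp add: finite_PiE)

text \<open>Primality is demanded instead of irreducibility, so that \<open>gen_ideal P\<close> is a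
  prime ideal at once; that there are enough such polynomials is the content of
  \<open>exists_prime_factor\<close>.\<close>

definition prime_polys :: "int poly set" where
  "prime_polys = {P. P \<in> monic_polys (degree P) \<and> degree P > 0 \<and>
     (\<forall>A B. A * B \<in> gen_ideal P \<longrightarrow> A \<in> gen_ideal P \<or> B \<in> gen_ideal P)}"

lemma prime_polys_monic_polys: "P \<in> prime_polys \<Longrightarrow> P \<in> monic_polys (degree P)"
  and prime_polys_monic: "P \<in> prime_polys \<Longrightarrow> lead_coeff P = 1"
  and prime_polys_degree: "P \<in> prime_polys \<Longrightarrow> degree P > 0"
  and prime_polys_prime: "P \<in> prime_polys \<Longrightarrow> A * B \<in> gen_ideal P \<Longrightarrow> A \<in> gen_ideal P \<or> B \<in> gen_ideal P"
  by (auto simp: prime_polys_def monic_polys_def)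

lemma prime_ideal_gen_ideal: "P \<in> prime_polys \<Longrightarrow> prime_ideal_char (gen_ideal P) p"
  by (intro prime_ideal_char.intro prime_ideal_char_axioms.intro ideal_char_gen_ideal one_notin_gen_ideal
      prime_polys_monic prime_polys_degree prime_polys_prime)

text \<open>A monic divisor \<open>P\<close> of least positive degree is prime. If \<open>P\<close>
  does not divide \<open>A\<close>, then \<open>P\<close> and \<open>A\<close> have a monic greatest
  common divisor \<open>H\<close>. Either \<open>H = 1\<close> and Bezout's identity applies, or
  minimality forces \<open>H\<close> to have the degree of \<open>P\<close>, so that
  \<open>P\<close> would divide \<open>A\<close>.\<close>

lemma exists_prime_factor:
  assumes F: "lead_coeff F = 1" "degree F > 0"
  obtains P where "P \<in> prime_polys" "F \<in> gen_ideal P"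
proof -
  define good where "good P \<longleftrightarrow> lead_coeff P = 1 \<and> degree P > 0 \<and> F \<in> gen_ideal P" for P
  have "good F" using F gen_ideal_self by (simp add: good_def)
  then obtain P where P: "good P" and min: "\<And>H. good H \<Longrightarrow> degree P \<le> degree H"
    using ex_has_least_nat[of good F degree] by blast
  have Pm: "lead_coeff P = 1" "degree P > 0" "F \<in> gen_ideal P" using P by (auto simp: good_def)
  have prime: "B \<in> gen_ideal P" if AB: "A * B \<in> gen_ideal P" and A: "A \<notin> gen_ideal P" for A B
  proof -
    define J where "J = {U * P + V * A + W | U V W. W \<in> p_ideal}"
    have JI: "U * P + V * A + W \<in> J" if "W \<in> p_ideal" for U V W
      using that unfolding J_def by blast
    have J_ideal: "cring_ideal J"
    proof
      show "0 \<in> J" using JI[of 0 0 0] p_ideal.zero_mem by simp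
      show "a + b \<in> J" if ab: "a \<in> J" "b \<in> J" for a b
      proof -
        obtain U V W U' V' W' where "a = U * P + V * A + W" "b = U' * P + V' * A + W'" "W \<in> p_ideal" "W' \<in> p_ideal"
          using ab unfolding J_def by blast
        then show ?thesis using JI[of "W + W'" "U + U'" "V + V'"] p_ideal.add_mem by (simp add: algebra_simps)
      qed
      show "r * a \<in> J" if a: "a \<in> J" for r a
      proof -
        obtain U V W where "a = U * P + V * A + W" "W \<in> p_ideal" using a unfolding J_def by blast
        then show ?thesis using JI[of "r * W" "r * U" "r * V"] p_ideal.mult_mem by (simp add: algebra_simps)
      qed
    qed
    interpret J: cring_ideal J by (rule J_ideal)
    have pJ: "W \<in> p_ideal \<Longrightarrow> W \<in> J" for W using JI[of W 0 0] by simp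
    have PJ: "P \<in> J" and AJ: "A \<in> J" using JI[of 0 1 0] JI[of 0 0 1] p_ideal.zero_mem by auto
    \<comment> \<open>A monic element of least degree generates \<open>J\<close>: a remainder that
      is nonzero modulo \<open>p\<close> could be scaled to a monic element of smaller
      degree.\<close>
    obtain H where H: "H \<in> J" "lead_coeff H = 1"
      and Hmin: "\<And>H'. H' \<in> J \<Longrightarrow> lead_coeff H' = 1 \<Longrightarrow> degree H \<le> degree H'"
      using ex_has_least_nat[of "\<lambda>H. H \<in> J \<and> lead_coeff H = 1" P degree] PJ Pm by blast
    have sub: "Z \<in> gen_ideal H" if Z: "Z \<in> J" for Z
    proof -
      obtain U R where UR: "Z = H * U + R" "R = 0 \<or> degree R < degree H"
        using monic_division[OF H(2)] by blast
      have RJ: "R \<in> J" using J.diff_mem[OF Z J.mult_mem'[OF H(1), of U]] UR by simp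
      have "R \<in> p_ideal"
      proof (rule ccontr)
        assume nR: "R \<notin> p_ideal"
        then obtain c R' where R': "lead_coeff R' = 1" "degree R' \<le> degree R" "R' - smult c R \<in> p_ideal"
          by (rule monic_scaling)
        have "(R' - smult c R) + [:c:] * R \<in> J" by (intro J.add_mem pJ R' J.mult_mem RJ)
        then have "R' \<in> J" by simp
        from Hmin[OF this R'(1)] R'(2) UR(2) nR show False by (auto simp: p_ideal.zero_mem)
      qed
      then show ?thesis using UR(1) by (auto simp: gen_ideal_iff intro!: exI[of _ U])
    qed
    show ?thesis
    proof (cases "degree H = 0")
      case True
      then have "H = 1" using H(2) by (metis degree_0_id one_pCons)
      then obtain U V W where UVW: "1 = U * P + V * A + W" "W \<in> p_ideal"
        using H(1) unfolding J_def by auto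
      have "B = (U * B) * P + V * (A * B) + W * B"
        using arg_cong[OF UVW(1), of "\<lambda>z. z * B"] by (simp add: algebra_simps)
      also have "\<dots> \<in> gen_ideal P"
        by (intro gen_ideal_add gen_ideal_mult gen_ideal_mult' gen_ideal_self AB p_ideal_subset_gen_ideal UVW(2))
      finally show ?thesis .
    next
      case False
      have "F \<in> gen_ideal H" using gen_ideal_trans[OF Pm(3) sub[OF PJ]] .
      then have "degree P \<le> degree H" using min[of H] H(2) False by (simp add: good_def)
      moreover have "degree H \<le> degree P" using Hmin[OF PJ Pm(1)] .
      ultimately have deg: "degree H = degree P" by simp
      have "P - H \<in> gen_ideal H" by (intro gen_ideal_diff sub PJ gen_ideal_self)
      moreover have "degree (P - H) < degree H"
      proof -
        have "degree (P - H) \<le> degree H" using deg by (metis degree_diff_le order_refl)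
        moreover have "coeff (P - H) (degree H) = 0" using deg Pm(1) H(2) by simp
        ultimately show ?thesis using False
          by (metis degree_0 le_neq_implies_less leading_coeff_0_iff not_gr_zero)
      qed
      ultimately have "P - H \<in> p_ideal" by (intro gen_ideal_small_degree[OF H(2)])
      then have "H - P \<in> p_ideal" using p_ideal.uminus_mem[of "P - H"] by simp
      then have "H \<in> gen_ideal P" using gen_ideal_cong[of H P P] gen_ideal_self by simp
      then show ?thesis using A gen_ideal_trans[OF sub[OF AJ]] by blast
    qed
  qed
  have eq: "Z \<in> gen_ideal (reduce P) \<longleftrightarrow> Z \<in> gen_ideal P" for Z
  proof -
    have "P \<in> gen_ideal (reduce P)" using gen_ideal_cong[OF reduce_cong, of P "reduce P"] gen_ideal_self by simp
    moreover have "reduce P \<in> gen_ideal P" using gen_ideal_cong[OF reduce_cong', of P P] gen_ideal_self by simp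
    ultimately show ?thesis using gen_ideal_trans by blast
  qed
  have "reduce P \<in> prime_polys"
    using reduce_in_monic_polys[OF Pm(1)] Pm(2) prime by (auto simp: prime_polys_def monic_polys_monic eq)
  moreover have "F \<in> gen_ideal (reduce P)" by (simp add: eq Pm)
  ultimately show thesis by (rule that)
qed

text \<open>If \<open>P0\<close> is \<open>P * U\<close>, then \<open>P0\<close> divides
  \<open>P\<close> or \<open>U\<close>. In the first case both are monic of the same degree and
  coincide; in the second, cancelling \<open>P0\<close> makes \<open>P\<close> a unit.\<close>

lemma prime_polys_distinct:
  assumes P: "P \<in> prime_polys" and P0: "P0 \<in> prime_polys" and ne: "P \<noteq> P0"
  shows "P0 \<notin> gen_ideal P"
proof
  assume "P0 \<in> gen_ideal P"
  then obtain U where U: "P0 - P * U \<in> p_ideal" by (auto simp: gen_ideal_iff)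
  have deg_le: "degree A \<le> degree B" if "A \<in> prime_polys" "B \<in> prime_polys" "B \<in> gen_ideal A" for A B
  proof (rule ccontr)
    assume "\<not> ?thesis"
    then have "B \<in> p_ideal" using gen_ideal_small_degree[OF prime_polys_monic[OF that(1)] that(3)] by simp
    then show False using prime_polys_monic[OF that(2)] p_gt_1 by (auto simp: p_ideal_iff dest!: spec[of _ "degree B"])
  qed
  have "P * U \<in> gen_ideal P0"
    using gen_ideal_cong[OF U, of P0] gen_ideal_self by simp
  then consider "P \<in> gen_ideal P0" | "U \<in> gen_ideal P0" using prime_polys_prime[OF P0] by blast
  then show False
  proof cases
    case 1
    have deg: "degree P = degree P0"
      using deg_le[OF P P0 \<open>P0 \<in> gen_ideal P\<close>] deg_le[OF P0 P 1] by simp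
    have "degree (P0 - P) < degree P"
    proof -
      have "degree (P0 - P) \<le> degree P" using deg by (metis degree_diff_le order_refl)
      moreover have "coeff (P0 - P) (degree P) = 0"
        using deg prime_polys_monic[OF P] prime_polys_monic[OF P0] by simp
      ultimately show ?thesis using prime_polys_degree[OF P]
        by (metis degree_0 le_neq_implies_less leading_coeff_0_iff)
    qed
    then have "P0 - P \<in> p_ideal"
      by (intro gen_ideal_small_degree[OF prime_polys_monic[OF P]] gen_ideal_diff gen_ideal_self \<open>P0 \<in> gen_ideal P\<close>)
    then show False using monic_polys_eqI[OF prime_polys_monic_polys[OF P0] prime_polys_monic_polys[OF P]] ne by simp
  next
    case 2
    then obtain W where W: "U - P0 * W \<in> p_ideal" by (auto simp: gen_ideal_iff)
    have "P0 * (1 - P * W) = (P0 - P * U) + P * (U - P0 * W)" by (simp add: algebra_simps)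
    also have "\<dots> \<in> p_ideal" by (intro p_ideal.add_mem p_ideal.mult_mem U W)
    finally have "1 - P * W \<in> p_ideal" by (rule p_ideal_monic_cancel[OF prime_polys_monic[OF P0]])
    then have "1 \<in> gen_ideal P" by (auto simp: gen_ideal_iff)
    then show False using one_notin_gen_ideal[OF prime_polys_monic[OF P] prime_polys_degree[OF P]] by simp
  qed
qed

text \<open>One factor \<open>P\<close> is cancelled at a time, because \<open>P\<close> is prime
  and does not divide \<open>P0\<close>.\<close>

lemma gen_ideal_power_other:
  assumes P: "P \<in> prime_polys" and P0: "P0 \<in> prime_polys" and ne: "P \<noteq> P0"
  shows "P0 * F \<in> gen_ideal (P ^ j) \<Longrightarrow> F \<in> gen_ideal (P ^ j)"
proof (induction j arbitrary: F)
  case 0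
  then show ?case by (auto simp: gen_ideal_iff intro!: exI[of _ F] p_ideal.zero_mem)
next
  case (Suc j)
  then obtain U where U: "P0 * F - P ^ Suc j * U \<in> p_ideal" by (auto simp: gen_ideal_iff)
  have "P0 * F \<in> gen_ideal P"
    using gen_ideal_cong[OF U, of P] gen_ideal_mult'[OF gen_ideal_self, of P] by (simp add: mult.assoc)
  then have "F \<in> gen_ideal P" using prime_polys_prime[OF P] prime_polys_distinct[OF P P0 ne] by blast
  then obtain F' where F': "F - P * F' \<in> p_ideal" by (auto simp: gen_ideal_iff)
  have "P * (P0 * F' - P ^ j * U) = (P0 * F - P ^ Suc j * U) - P0 * (F - P * F')"
    by (simp add: algebra_simps)
  also have "\<dots> \<in> p_ideal" by (intro p_ideal.diff_mem p_ideal.mult_mem U F')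
  finally have "P0 * F' - P ^ j * U \<in> p_ideal" by (rule p_ideal_monic_cancel[OF prime_polys_monic[OF P]])
  then have "P0 * F' \<in> gen_ideal (P ^ j)" by (auto simp: gen_ideal_iff)
  then have "F' \<in> gen_ideal (P ^ j)" by (rule Suc.IH)
  then obtain W where W: "F' - P ^ j * W \<in> p_ideal" by (auto simp: gen_ideal_iff)
  have "F - P ^ Suc j * W = (F - P * F') + P * (F' - P ^ j * W)" by (simp add: algebra_simps)
  also have "\<dots> \<in> p_ideal" by (intro p_ideal.add_mem p_ideal.mult_mem F' W)
  finally show ?case by (auto simp: gen_ideal_iff)
qed

lemma gen_ideal_power_same:
  assumes P: "lead_coeff P = 1"
  shows "P * F \<in> gen_ideal (P ^ Suc j) \<longleftrightarrow> F \<in> gen_ideal (P ^ j)"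
proof
  assume "P * F \<in> gen_ideal (P ^ Suc j)"
  then obtain U where U: "P * F - P ^ Suc j * U \<in> p_ideal" by (auto simp: gen_ideal_iff)
  have "P * (F - P ^ j * U) = P * F - P ^ Suc j * U" by (simp add: algebra_simps)
  then have "P * (F - P ^ j * U) \<in> p_ideal" using U by simp
  then show "F \<in> gen_ideal (P ^ j)" using p_ideal_monic_cancel[OF P] by (auto simp: gen_ideal_iff)
next
  assume "F \<in> gen_ideal (P ^ j)"
  then obtain U where U: "F - P ^ j * U \<in> p_ideal" by (auto simp: gen_ideal_iff)
  have "P * F - P ^ Suc j * U = P * (F - P ^ j * U)" by (simp add: algebra_simps)
  then have "P * F - P ^ Suc j * U \<in> p_ideal" using p_ideal.mult_mem[OF U, of P] by simp
  then show "P * F \<in> gen_ideal (P ^ Suc j)" unfolding gen_ideal_iff ..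
qed

text \<open>A prime of multiplicity \<open>k\<close> in \<open>F\<close> contributes the pairs with
  exponents from 1 to \<open>k\<close>. Summing over this set is summing over the prime factors with
  multiplicity, without a factorization being chosen.\<close>

definition prime_power_divs :: "int poly \<Rightarrow> (int poly \<times> nat) set" where
  "prime_power_divs F = {(P, j). P \<in> prime_polys \<and> j > 0 \<and> F \<in> gen_ideal (P ^ j)}"

lemma prime_power_divs_cong: "F - G \<in> p_ideal \<Longrightarrow> prime_power_divs F = prime_power_divs G"
  unfolding prime_power_divs_def using gen_ideal_cong by blast

lemma prime_power_divs_mult:
  assumes P0: "P0 \<in> prime_polys"
  shows "prime_power_divs (P0 * F) = insert (P0, 1) ((\<lambda>(P, j). (P, if P = P0 then Suc j else j)) ` prime_power_divs F)"
proof (intro equalityI subsetI)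
  fix z assume "z \<in> prime_power_divs (P0 * F)"
  then obtain P j where z: "z = (P, j)" and P: "P \<in> prime_polys" and j: "j > 0" and d: "P0 * F \<in> gen_ideal (P ^ j)"
    by (auto simp: prime_power_divs_def)
  show "z \<in> insert (P0, 1) ((\<lambda>(P, j). (P, if P = P0 then Suc j else j)) ` prime_power_divs F)"
  proof (cases "P = P0")
    case False
    then have "(P, j) \<in> prime_power_divs F" using gen_ideal_power_other[OF P P0 False d] P j by (auto simp: prime_power_divs_def)
    then show ?thesis using z False by force
  next
    case True
    show ?thesis
    proof (cases "j = 1")
      case False
      then obtain i where i: "j = Suc i" "i > 0" using j by (cases j) auto
      have "(P0, i) \<in> prime_power_divs F" using d gen_ideal_power_same[OF prime_polys_monic[OF P0], of F i] True i P0
        by (simp add: prime_power_divs_def)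
      then show ?thesis using z True i by force
    qed (use z True in auto)
  qed
next
  fix z assume "z \<in> insert (P0, 1) ((\<lambda>(P, j). (P, if P = P0 then Suc j else j)) ` prime_power_divs F)"
  then consider "z = (P0, 1)" | P j where "(P, j) \<in> prime_power_divs F" "z = (P, if P = P0 then Suc j else j)"
    by auto
  then show "z \<in> prime_power_divs (P0 * F)"
  proof cases
    case 1
    then show ?thesis using P0 gen_ideal_mult'[OF gen_ideal_self, of P0 F] by (auto simp: prime_power_divs_def)
  next
    case 2
    then show ?thesis using P0 gen_ideal_power_same[OF prime_polys_monic[OF P0], of F j] gen_ideal_mult
      by (auto simp: prime_power_divs_def)
  qed
qed

text \<open>Unique factorization in the form needed for a logarithmic derivative. One prime factor
  is split off at a time; the remainder of that division lies in \<open>p_ideal\<close>, and so does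
  not affect the divisors.\<close>

lemma prime_power_divs_sum:
  "lead_coeff F = 1 \<Longrightarrow> finite (prime_power_divs F) \<and> (\<Sum>(P, j)\<in>prime_power_divs F. degree P) = degree F"
proof (induction "degree F" arbitrary: F rule: less_induct)
  case less
  show ?case
  proof (cases "degree F = 0")
    case True
    then have F: "F = 1" using less.prems by (metis degree_0_id one_pCons)
    have "1 \<notin> gen_ideal (P ^ j)" if "P \<in> prime_polys" "j > 0" for P j
    proof (rule one_notin_gen_ideal)
      show "lead_coeff (P ^ j) = 1" using prime_polys_monic[OF that(1)] by (simp add: lead_coeff_power)
      have "P \<noteq> 0" using prime_polys_degree[OF that(1)] by auto
      then show "degree (P ^ j) > 0"
        using that prime_polys_degree[OF that(1)] by (simp add: degree_power_eq)
    qed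
    then have "prime_power_divs F = {}" by (auto simp: prime_power_divs_def F)
    then show ?thesis using True by simp
  next
    case False
    then obtain P0 where P0: "P0 \<in> prime_polys" "F \<in> gen_ideal P0" using exists_prime_factor[of F] less.prems by blast
    have m0: "lead_coeff P0 = 1" using prime_polys_monic[OF P0(1)] .
    obtain F' R where F': "F = P0 * F' + R" "R = 0 \<or> degree R < degree P0"
      using monic_division[OF m0] by blast
    have "R = F - P0 * F'" using F' by simp
    also have "\<dots> \<in> gen_ideal P0" by (intro gen_ideal_diff P0 gen_ideal_mult' gen_ideal_self)
    finally have "R \<in> gen_ideal P0" .
    then have R: "R \<in> p_ideal" using F'(2) gen_ideal_small_degree[OF m0] p_ideal.zero_mem by blast
    have ne: "P0 \<noteq> 0" "degree P0 > 0" using prime_polys_degree[OF P0(1)] by auto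
    have "F' \<noteq> 0"
    proof
      assume "F' = 0"
      then have "F \<in> p_ideal" using F' R by simp
      then show False using less.prems p_gt_1 by (auto simp: p_ideal_iff dest!: spec[of _ "degree F"])
    qed
    have lt: "R = 0 \<or> degree R < degree (P0 * F')"
      using F'(2) ne \<open>F' \<noteq> 0\<close> by (auto simp: degree_mult_eq)
    have degF: "degree F = degree P0 + degree F'"
      using lt ne \<open>F' \<noteq> 0\<close> F'(1) by (auto simp: degree_add_eq_left degree_mult_eq)
    have "lead_coeff F = lead_coeff (P0 * F')"
      using lt F'(1) by (auto simp: lead_coeff_add_le degree_add_eq_left coeff_eq_0)
    then have m': "lead_coeff F' = 1" using less.prems m0 by (simp add: lead_coeff_mult)
    have IH: "finite (prime_power_divs F')" "(\<Sum>(P, j)\<in>prime_power_divs F'. degree P) = degree F'"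
      using less.hyps[of F'] degF ne m' by auto
    have eq: "prime_power_divs F = prime_power_divs (P0 * F')" using prime_power_divs_cong[of F "P0 * F'"] R F'(1) by simp
    define h where "h = (\<lambda>(P, j). (P, if P = P0 then Suc j else (j::nat)))"
    have inj: "inj_on h (prime_power_divs F')" by (auto simp: inj_on_def h_def split: if_splits)
    have notin: "(P0, 1) \<notin> h ` prime_power_divs F'" by (auto simp: h_def prime_power_divs_def split: if_splits)
    have pd: "prime_power_divs F = insert (P0, 1) (h ` prime_power_divs F')" using prime_power_divs_mult[OF P0(1)] eq by (simp add: h_def)
    have "(\<Sum>(P, j)\<in>prime_power_divs F. degree P) = degree P0 + (\<Sum>z\<in>h ` prime_power_divs F'. degree (fst z))"
      unfolding pd using notin IH(1) by (simp add: case_prod_unfold)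
    also have "(\<Sum>z\<in>h ` prime_power_divs F'. degree (fst z)) = (\<Sum>z\<in>prime_power_divs F'. degree (fst z))"
      by (subst sum.reindex[OF inj]) (auto simp: h_def case_prod_unfold)
    also have "\<dots> = degree F'" using IH(2) by (simp add: case_prod_unfold)
    finally show ?thesis using degF IH(1) pd by simp
  qed
qed

end

section \<open>The logarithmic derivative of a character sum generating function\<close>

context fp_poly
begin

lemma monic_not_in_p_ideal: "lead_coeff F = 1 \<Longrightarrow> F \<notin> p_ideal"
  using p_gt_1 by (auto simp: p_ideal_iff intro!: exI[of _ "degree F"])

lemma monic_quotient:
  assumes Q: "lead_coeff Q = 1" and F: "lead_coeff F = 1" "F \<in> gen_ideal Q"
  obtains H where "lead_coeff H = 1" "degree F = degree Q + degree H" "F - Q * H \<in> p_ideal"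
proof -
  obtain H R where HR: "F = Q * H + R" "R = 0 \<or> degree R < degree Q"
    using monic_division[OF Q] by blast
  have "R = F - Q * H" using HR by simp
  also have "\<dots> \<in> gen_ideal Q" by (intro gen_ideal_diff F gen_ideal_mult' gen_ideal_self)
  finally have R: "R \<in> p_ideal" using HR(2) gen_ideal_small_degree[OF Q] p_ideal.zero_mem by blast
  have "H \<noteq> 0" using HR(1) R monic_not_in_p_ideal[OF F(1)] by auto
  moreover have "Q \<noteq> 0" using Q by auto
  ultimately have lt: "R = 0 \<or> degree R < degree (Q * H)"
    using HR(2) by (auto simp: degree_mult_eq)
  then have "degree F = degree (Q * H)" "lead_coeff F = lead_coeff (Q * H)"
    using HR(1) by (auto simp: degree_add_eq_left coeff_eq_0)
  then show thesis
    using that[of H] Q F(1) \<open>H \<noteq> 0\<close> \<open>Q \<noteq> 0\<close> R HR(1) by (simp add: degree_mult_eq coeff_mult_degree_sum)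
qed

text \<open>Turns a sum over the multiples of \<open>Q\<close> into a sum over cofactors, out of
  which the value of a multiplicative function at \<open>Q\<close> can be taken.\<close>

lemma bij_monic_polys_mult:
  assumes Q: "lead_coeff Q = 1"
  shows "bij_betw (\<lambda>H. reduce (Q * H)) (monic_polys n) {F \<in> monic_polys (degree Q + n). F \<in> gen_ideal Q}"
proof (rule bij_betw_imageI)
  have Q0: "Q \<noteq> 0" using Q by auto
  have c: "Q * H - reduce (Q * H) \<in> p_ideal" for H by (rule reduce_cong)
  show "inj_on (\<lambda>H. reduce (Q * H)) (monic_polys n)"
  proof (rule inj_onI)
    fix H H' assume H: "H \<in> monic_polys n" "H' \<in> monic_polys n" "reduce (Q * H) = reduce (Q * H')"
    have "Q * (H - H') = (Q * H - reduce (Q * H)) - (Q * H' - reduce (Q * H'))"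
      using H(3) by (simp add: algebra_simps)
    also have "\<dots> \<in> p_ideal" by (intro p_ideal.diff_mem c)
    finally show "H = H'" using monic_polys_eqI[OF H(1,2)] p_ideal_monic_cancel[OF Q] by blast
  qed
  show "(\<lambda>H. reduce (Q * H)) ` monic_polys n = {F \<in> monic_polys (degree Q + n). F \<in> gen_ideal Q}"
  proof (intro equalityI subsetI)
    fix F assume "F \<in> (\<lambda>H. reduce (Q * H)) ` monic_polys n"
    then obtain H where H: "H \<in> monic_polys n" "F = reduce (Q * H)" by blast
    have "H \<noteq> 0" using monic_polys_monic(1)[OF H(1)] by auto
    then have "degree (Q * H) = degree Q + n" "lead_coeff (Q * H) = 1"
      using monic_polys_monic[OF H(1)] Q Q0 by (auto simp: degree_mult_eq coeff_mult_degree_sum)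
    then have "F \<in> monic_polys (degree Q + n)" using reduce_in_monic_polys[of "Q * H"] H(2) by simp
    moreover have "F \<in> gen_ideal Q"
      using gen_ideal_cong[OF c[of H], of Q] gen_ideal_mult'[OF gen_ideal_self, of Q H] H(2) by simp
    ultimately show "F \<in> {F \<in> monic_polys (degree Q + n). F \<in> gen_ideal Q}" by simp
  next
    fix F assume F: "F \<in> {F \<in> monic_polys (degree Q + n). F \<in> gen_ideal Q}"
    then obtain H where H: "lead_coeff H = 1" "degree F = degree Q + degree H" "F - Q * H \<in> p_ideal"
      using monic_quotient[OF Q, of F] monic_polys_monic(1)[of F] by blast
    have dH: "degree H = n" using H(2) F monic_polys_monic(2)[of F "degree Q + n"] by simp
    have rH: "reduce H \<in> monic_polys n" using reduce_in_monic_polys[OF H(1)] dH by simp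
    have "H \<noteq> 0" using H(1) by auto
    have "F - reduce (Q * reduce H) = (F - Q * H) + Q * (H - reduce H) + (Q * reduce H - reduce (Q * reduce H))"
      by (simp add: algebra_simps)
    also have "\<dots> \<in> p_ideal" by (intro p_ideal.add_mem p_ideal.mult_mem reduce_cong H)
    finally have *: "F - reduce (Q * reduce H) \<in> p_ideal" .
    have "lead_coeff (Q * reduce H) = 1" using Q monic_polys_monic[OF rH] by (simp add: lead_coeff_mult)
    from reduce_in_monic_polys[OF this] F * have "F = reduce (Q * reduce H)" using monic_polys_eqI by blast
    then show "F \<in> (\<lambda>H. reduce (Q * H)) ` monic_polys n" using rH by blast
  qed
qed

definition char_sum :: "(int poly \<Rightarrow> complex) \<Rightarrow> nat \<Rightarrow> complex" where
  "char_sum lam n = (\<Sum>F\<in>monic_polys n. lam F)"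

definition prime_polys_dvd :: "nat \<Rightarrow> int poly set" where
  "prime_polys_dvd n = {P \<in> prime_polys. degree P dvd n}"

text \<open>The coefficient of \<open>T ^ n\<close> in \<open>T * L' / L\<close>, where
  \<open>L\<close> is the Euler product with the factors
  \<open>1 / (1 - lam P * T ^ degree P)\<close>.\<close>

definition prime_power_sum :: "(int poly \<Rightarrow> complex) \<Rightarrow> nat \<Rightarrow> complex" where
  "prime_power_sum lam n = (\<Sum>P\<in>prime_polys_dvd n. of_nat (degree P) * lam P ^ (n div degree P))"

lemma finite_prime_polys_bounded: "finite {P \<in> prime_polys. degree P \<le> n}"
proof (rule finite_subset)
  show "{P \<in> prime_polys. degree P \<le> n} \<subseteq> (\<Union>d\<le>n. monic_polys d)" using prime_polys_monic_polys by blast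
qed (auto intro: finite_monic_polys)

lemma finite_prime_polys_dvd: "n > 0 \<Longrightarrow> finite (prime_polys_dvd n)"
  by (rule finite_subset[OF _ finite_prime_polys_bounded[of n]]) (auto simp: prime_polys_dvd_def dvd_imp_le)

lemma degree_power_prime_polys: "P \<in> prime_polys \<Longrightarrow> degree (P ^ j) = j * degree P"
  using prime_polys_degree[of P] by (subst degree_power_eq) auto

text \<open>Logarithmic derivative of \<open>\<Sum>n. char_sum lam n * T ^ n\<close>, obtained without generating functions by weighting each
\<open>F\<close> with its degree, that is, with the sum of \<open>degree P\<close> over the prime powers \<open>P ^ j\<close> dividing \<open>F\<close>.\<close>
lemma char_sum_recurrence:
  assumes mult: "\<And>F G. lead_coeff F = 1 \<Longrightarrow> lead_coeff G = 1 \<Longrightarrow> lam (F * G) = lam F * lam G"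
    and cong: "\<And>F G. lead_coeff F = 1 \<Longrightarrow> lead_coeff G = 1 \<Longrightarrow> F - G \<in> p_ideal \<Longrightarrow> lam F = lam G"
    and one: "lam 1 = 1"
  shows "of_nat n * char_sum lam n = (\<Sum>k=1..n. prime_power_sum lam k * char_sum lam (n - k))"
proof -
  define E where "E = {(P, j). P \<in> prime_polys \<and> j > 0 \<and> j * degree P \<le> n}"
  have le: "degree P \<le> n \<and> j \<le> n" if "P \<in> prime_polys" "j > 0" "j * degree P \<le> n" for P j
  proof -
    have "j \<le> j * degree P" "degree P \<le> j * degree P"
      using that(2) prime_polys_degree[OF that(1)] by auto
    then show ?thesis using that(3) by (meson le_trans)
  qed
  have "E \<subseteq> {P \<in> prime_polys. degree P \<le> n} \<times> {..n}" unfolding E_def using le by auto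
  then have finE: "finite E" by (rule finite_subset) (simp add: finite_prime_polys_bounded)
  have lam_pow: "lam (P ^ j) = lam P ^ j" if "lead_coeff P = 1" for P j
    by (induction j) (use that one mult[of P "P ^ _"] in \<open>auto simp: lead_coeff_power\<close>)
  have sub: "prime_power_divs F = {(P, j) \<in> E. F \<in> gen_ideal (P ^ j)}" if F: "F \<in> monic_polys n" for F
  proof -
    have "j * degree P \<le> n" if "P \<in> prime_polys" "j > 0" "F \<in> gen_ideal (P ^ j)" for P j
    proof (rule ccontr)
      assume "\<not> ?thesis"
      then have "degree F < degree (P ^ j)" using F that by (simp add: degree_power_prime_polys monic_polys_monic)
      then have "F \<in> p_ideal"
        using gen_ideal_small_degree[of "P ^ j" F] that prime_polys_monic[of P] by (simp add: lead_coeff_power)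
      then show False using monic_not_in_p_ideal monic_polys_monic[OF F] by blast
    qed
    then show ?thesis unfolding prime_power_divs_def E_def by auto
  qed
  have inner: "(\<Sum>F | F \<in> monic_polys n \<and> F \<in> gen_ideal (P ^ j). lam F) = lam P ^ j * char_sum lam (n - j * degree P)"
    if z: "(P, j) \<in> E" for P j
  proof -
    have P: "P \<in> prime_polys" "j * degree P \<le> n" using z by (auto simp: E_def)
    have Q: "lead_coeff (P ^ j) = 1" using prime_polys_monic[OF P(1)] by (simp add: lead_coeff_power)
    have n: "degree (P ^ j) + (n - j * degree P) = n" using P by (simp add: degree_power_prime_polys)
    have "(\<Sum>F | F \<in> monic_polys n \<and> F \<in> gen_ideal (P ^ j). lam F) =
      (\<Sum>H\<in>monic_polys (n - j * degree P). lam (reduce (P ^ j * H)))"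
      using sum.reindex_bij_betw[OF bij_monic_polys_mult[OF Q, of "n - j * degree P"], of lam] n by simp
    also have "\<dots> = (\<Sum>H\<in>monic_polys (n - j * degree P). lam P ^ j * lam H)"
    proof (rule sum.cong[OF refl])
      fix H assume H: "H \<in> monic_polys (n - j * degree P)"
      have m: "lead_coeff (P ^ j * H) = 1" using Q monic_polys_monic[OF H] by (simp add: lead_coeff_mult)
      have "lam (reduce (P ^ j * H)) = lam (P ^ j * H)"
        using cong[OF _ m reduce_cong'] reduce_in_monic_polys[OF m] monic_polys_monic by blast
      also have "\<dots> = lam P ^ j * lam H"
        using mult[OF Q, of H] monic_polys_monic[OF H] lam_pow[OF prime_polys_monic[OF P(1)]] by simp
      finally show "lam (reduce (P ^ j * H)) = lam P ^ j * lam H" .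
    qed
    finally show ?thesis by (simp add: char_sum_def sum_distrib_left)
  qed
  have "of_nat n * char_sum lam n = (\<Sum>F\<in>monic_polys n. lam F * of_nat n)"
    by (simp add: char_sum_def sum_distrib_left mult.commute)
  also have "\<dots> = (\<Sum>F\<in>monic_polys n. lam F * (\<Sum>z\<in>E. if F \<in> gen_ideal (fst z ^ snd z) then of_nat (degree (fst z)) else 0))"
  proof (rule sum.cong[OF refl])
    fix F assume F: "F \<in> monic_polys n"
    have "n = (\<Sum>(P, j)\<in>prime_power_divs F. degree P)" using prime_power_divs_sum[of F] monic_polys_monic[OF F] by simp
    also have "\<dots> = (\<Sum>z\<in>E. if F \<in> gen_ideal (fst z ^ snd z) then degree (fst z) else 0)"
      unfolding sub[OF F] using finE
      by (subst sum.inter_filter[symmetric]) (auto simp: case_prod_unfold)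
    finally have "(of_nat n :: complex) = of_nat (\<Sum>z\<in>E. if F \<in> gen_ideal (fst z ^ snd z) then degree (fst z) else 0)"
      by simp
    then show "lam F * of_nat n = lam F * (\<Sum>z\<in>E. if F \<in> gen_ideal (fst z ^ snd z) then of_nat (degree (fst z)) else 0)"
      by (simp add: if_distrib cong: if_cong)
  qed
  also have "\<dots> = (\<Sum>z\<in>E. \<Sum>F\<in>monic_polys n. if F \<in> gen_ideal (fst z ^ snd z) then lam F * of_nat (degree (fst z)) else 0)"
    by (subst sum.swap) (simp add: sum_distrib_left if_distrib cong: if_cong)
  also have "\<dots> = (\<Sum>z\<in>E. of_nat (degree (fst z)) * (lam (fst z) ^ snd z * char_sum lam (n - snd z * degree (fst z))))"
  proof (rule sum.cong[OF refl])
    fix z assume z: "z \<in> E"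
    have "(\<Sum>F\<in>monic_polys n. if F \<in> gen_ideal (fst z ^ snd z) then lam F * of_nat (degree (fst z)) else 0)
        = (\<Sum>F | F \<in> monic_polys n \<and> F \<in> gen_ideal (fst z ^ snd z). lam F * of_nat (degree (fst z)))"
      using finite_monic_polys by (subst sum.inter_filter[symmetric]) auto
    also have "\<dots> = (\<Sum>F | F \<in> monic_polys n \<and> F \<in> gen_ideal (fst z ^ snd z). lam F) * of_nat (degree (fst z))"
      by (rule sum_distrib_right[symmetric])
    also have "\<dots> = of_nat (degree (fst z)) * (lam (fst z) ^ snd z * char_sum lam (n - snd z * degree (fst z)))"
      using inner[of "fst z" "snd z"] z by simp
    finally show "(\<Sum>F\<in>monic_polys n. if F \<in> gen_ideal (fst z ^ snd z) then lam F * of_nat (degree (fst z)) else 0)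
        = of_nat (degree (fst z)) * (lam (fst z) ^ snd z * char_sum lam (n - snd z * degree (fst z)))" .
  qed
  \<comment> \<open>Grouping by the degree \<open>k\<close> of the prime power; for given
    \<open>k\<close> the exponent is determined by the prime.\<close>
  also have "\<dots> = (\<Sum>k\<in>{1..n}. \<Sum>z | z \<in> E \<and> snd z * degree (fst z) = k.
      of_nat (degree (fst z)) * (lam (fst z) ^ snd z * char_sum lam (n - snd z * degree (fst z))))"
  proof (rule sum.group[symmetric])
    show "(\<lambda>z. snd z * degree (fst z)) ` E \<subseteq> {1..n}"
      using prime_polys_degree by (force simp: E_def Suc_le_eq)
  qed (use finE in auto)
  also have "\<dots> = (\<Sum>k\<in>{1..n}. \<Sum>P\<in>prime_polys_dvd k. of_nat (degree P) * (lam P ^ (k div degree P) * char_sum lam (n - k)))"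
  proof (rule sum.cong[OF refl])
    fix k assume k: "k \<in> {1..n}"
    have "bij_betw (\<lambda>P. (P, k div degree P)) (prime_polys_dvd k) {z \<in> E. snd z * degree (fst z) = k}"
    proof (rule bij_betw_imageI)
      show "inj_on (\<lambda>P. (P, k div degree P)) (prime_polys_dvd k)" by (auto simp: inj_on_def)
      show "(\<lambda>P. (P, k div degree P)) ` prime_polys_dvd k = {z \<in> E. snd z * degree (fst z) = k}"
      proof (intro equalityI subsetI)
        fix z assume "z \<in> (\<lambda>P. (P, k div degree P)) ` prime_polys_dvd k"
        then obtain P where P: "P \<in> prime_polys" "degree P dvd k" "z = (P, k div degree P)"
          by (auto simp: prime_polys_dvd_def)
        then have "k div degree P * degree P = k" "k div degree P > 0"
          using k prime_polys_degree[OF P(1)] by (auto simp: div_greater_zero_iff dvd_imp_le)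
        then show "z \<in> {z \<in> E. snd z * degree (fst z) = k}" using P k by (auto simp: E_def)
      next
        fix z assume "z \<in> {z \<in> E. snd z * degree (fst z) = k}"
        then obtain P j where z: "z = (P, j)" "P \<in> prime_polys" "j * degree P = k" by (auto simp: E_def)
        then have "k div degree P = j" "degree P dvd k" using prime_polys_degree[OF z(2)] by auto
        then show "z \<in> (\<lambda>P. (P, k div degree P)) ` prime_polys_dvd k" using z by (auto simp: prime_polys_dvd_def)
      qed
    qed
    from sum.reindex_bij_betw[OF this, of "\<lambda>z. of_nat (degree (fst z)) * (lam (fst z) ^ snd z * char_sum lam (n - k))"]
    show "(\<Sum>z | z \<in> E \<and> snd z * degree (fst z) = k.
      of_nat (degree (fst z)) * (lam (fst z) ^ snd z * char_sum lam (n - snd z * degree (fst z))))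
      = (\<Sum>P\<in>prime_polys_dvd k. of_nat (degree P) * (lam P ^ (k div degree P) * char_sum lam (n - k)))"
      by (auto intro!: sum.cong)
  qed
  also have "\<dots> = (\<Sum>k=1..n. prime_power_sum lam k * char_sum lam (n - k))"
    by (simp add: prime_power_sum_def sum_distrib_right mult.assoc)
  finally show ?thesis .
qed

text \<open>Gauss's count: the trivial character has the zeta function
  \<open>1 / (1 - p * T)\<close>. In the recurrence each index below \<open>n\<close> contributes
  \<open>p ^ n\<close>, which leaves exactly one further \<open>p ^ n\<close> for the index
  \<open>n\<close>.\<close>

lemma prime_power_sum_one: "n > 0 \<Longrightarrow> prime_power_sum (\<lambda>_. 1) n = of_nat (p ^ n)"
proof (induction n rule: less_induct)
  case (less n)
  have A: "char_sum (\<lambda>_. 1) k = of_nat (p ^ k)" for k by (simp add: char_sum_def card_monic_polys)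
  have "of_nat n * char_sum (\<lambda>_. 1) n = (\<Sum>k=1..n. prime_power_sum (\<lambda>_. 1) k * char_sum (\<lambda>_. 1) (n - k))"
    by (rule char_sum_recurrence) auto
  also have "{1..n} = insert n {1..<n}" using less.prems by auto
  also have "(\<Sum>k\<in>insert n {1..<n}. prime_power_sum (\<lambda>_. 1) k * char_sum (\<lambda>_. 1) (n - k))
      = prime_power_sum (\<lambda>_. 1) n + (\<Sum>k=1..<n. of_nat (p ^ n))"
    by (auto simp: A less.IH simp flip: power_add of_nat_mult intro!: sum.cong)
  also have "(\<Sum>k=1..<n. of_nat (p ^ n)) = of_nat (n - 1) * (of_nat (p ^ n) :: complex)" by simp
  finally have "prime_power_sum (\<lambda>_. 1) n = (of_nat n - of_nat (n - 1)) * (of_nat (p ^ n) :: complex)"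
    by (simp add: A algebra_simps)
  also have "of_nat n - of_nat (n - 1) = (1 :: complex)"
    using less.prems by (simp add: of_nat_diff Suc_leI)
  finally show ?case by simp
qed

lemma sum_degree_prime_polys_dvd: "n > 0 \<Longrightarrow> (\<Sum>P\<in>prime_polys_dvd n. degree P) = p ^ n"
proof -
  assume "n > 0"
  from prime_power_sum_one[OF this] have "of_nat (\<Sum>P\<in>prime_polys_dvd n. degree P) = (of_nat (p ^ n) :: complex)"
    by (simp add: prime_power_sum_def)
  then show ?thesis by (simp only: of_nat_eq_iff)
qed

end

section \<open>Conjugates of a root of a prime polynomial\<close>

lemma coeff_prod_linear:
  fixes x :: "nat \<Rightarrow> 'a::comm_ring_1"
  shows "degree (\<Prod>i<n. [:- x i, 1:]) \<le> n" (is ?A)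
    and "coeff (\<Prod>i<n. [:- x i, 1:]) n = 1" (is ?B)
    and "n > 0 \<Longrightarrow> coeff (\<Prod>i<n. [:- x i, 1:]) (n - 1) = - (\<Sum>i<n. x i)" (is "_ \<Longrightarrow> ?C")
proof -
  have step: "(\<Prod>i<Suc n. [:- x i, 1:]) = smult (- x n) (\<Prod>i<n. [:- x i, 1:]) + pCons 0 (\<Prod>i<n. [:- x i, 1:])" for n
    by (simp add: mult.commute)
  have AB: "degree (\<Prod>i<n. [:- x i, 1:]) \<le> n \<and> coeff (\<Prod>i<n. [:- x i, 1:]) n = 1" for n
  proof (induction n)
    case (Suc n)
    have "coeff (\<Prod>i<Suc n. [:- x i, 1:]) (Suc n) = 1"
      unfolding step using Suc by (simp add: coeff_eq_0)
    moreover have "degree (\<Prod>i<Suc n. [:- x i, 1:]) \<le> Suc n"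
      unfolding step using Suc by (intro degree_add_le) (auto intro: order.trans[OF degree_smult_le] order.trans[OF degree_pCons_le])
    ultimately show ?case by blast
  qed simp
  then show ?A ?B by auto
  have "coeff (\<Prod>i<Suc n. [:- x i, 1:]) n = - (\<Sum>i<Suc n. x i)" for n
  proof (induction n)
    case (Suc n)
    have "coeff (\<Prod>i<Suc (Suc n). [:- x i, 1:]) (Suc n)
        = - x (Suc n) * coeff (\<Prod>i<Suc n. [:- x i, 1:]) (Suc n) + coeff (\<Prod>i<Suc n. [:- x i, 1:]) n"
      by (subst step) simp
    then show ?case using Suc AB[of "Suc n"] by simp
  qed simp
  from this[of "n - 1"] show "n > 0 \<Longrightarrow> ?C" by simp
qed

text \<open>Vieta's formula for the sum of the reciprocals of the roots, with \<open>y i\<close> as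
  inverse of \<open>x i\<close>. It will express the trace of \<open>1 / x\<close> by
  coefficients.\<close>

lemma (in cring_ideal) coeff_1_prod_linear:
  fixes n :: nat
  assumes "\<And>i. i < n \<Longrightarrow> x i * y i \<asymp> 1"
  shows "coeff (\<Prod>i<n. [:- x i, 1:]) 1 \<asymp> - coeff (\<Prod>i<n. [:- x i, 1:]) 0 * (\<Sum>i<n. y i)"
  using assms
proof (induction n)
  case (Suc n)
  let ?Q = "\<Prod>i<n. [:- x i, 1:]"
  have step: "(\<Prod>i<Suc n. [:- x i, 1:]) = smult (- x n) ?Q + pCons 0 ?Q"
    by (simp add: mult.commute)
  have "coeff (\<Prod>i<Suc n. [:- x i, 1:]) 1 = - x n * coeff ?Q 1 + coeff ?Q 0 * 1"
    by (subst step) simp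
  also have "\<dots> \<asymp> - x n * (- coeff ?Q 0 * (\<Sum>i<n. y i)) + coeff ?Q 0 * (x n * y n)"
    by (intro cg_add cg_mult cg_refl Suc.IH cg_sym[OF Suc.prems] Suc.prems) auto
  also have "\<dots> = - coeff (\<Prod>i<Suc n. [:- x i, 1:]) 0 * (\<Sum>i<Suc n. y i)"
    by (subst step) (simp add: algebra_simps)
  finally show ?case .
qed simp

text \<open>The coefficients become constants of \<open>int poly\<close>, so that \<open>U\<close>
  can be evaluated at residue classes modulo another polynomial.\<close>

definition lift_poly :: "int poly \<Rightarrow> int poly poly" where
  "lift_poly U = map_poly of_int U"

lemma coeff_lift_poly [simp]: "coeff (lift_poly U) i = of_int (coeff U i)"
  by (simp add: lift_poly_def coeff_map_poly)

lemma degree_lift_poly [simp]: "degree (lift_poly U) = degree U"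
proof (rule antisym)
  show "degree (lift_poly U) \<le> degree U" by (rule degree_le) (simp add: coeff_eq_0)
  show "degree U \<le> degree (lift_poly U)" by (rule degree_le) (metis coeff_lift_poly coeff_eq_0 of_int_eq_0_iff)
qed

lemma poly_lift_poly: "poly (lift_poly U) Y = (\<Sum>i\<le>degree U. of_int (coeff U i) * Y ^ i)"
  by (simp add: poly_altdef)

definition X :: "int poly" where "X = [:0, 1:]"

lemma poly_lift_poly_X: "poly (lift_poly U) X = U"
proof -
  have "U = (\<Sum>i\<le>degree U. monom (coeff U i) i)" by (rule poly_as_sum_of_monoms[symmetric])
  also have "\<dots> = (\<Sum>i\<le>degree U. of_int (coeff U i) * X ^ i)"
    by (intro sum.cong refl) (simp add: monom_altdef of_int_poly X_def)
  finally show ?thesis by (simp add: poly_lift_poly)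
qed


lemma sum_lessThan_add: "(\<Sum>i<a + b. f i) = (\<Sum>i<a. f i) + (\<Sum>i<b. f (i + a :: nat) :: 'a::comm_monoid_add)"
  by (induction b) (simp_all add: add_ac)

lemma (in cring_ideal) cg_sum_periodic:
  assumes "\<And>i. f (i + d) \<asymp> f i"
  shows "(\<Sum>i<m * d. f i) \<asymp> of_nat m * (\<Sum>i<d. f i)"
proof (induction m)
  case (Suc m)
  have per: "f (i + k * d) \<asymp> f i" for i k
  proof (induction k)
    case (Suc k)
    have "f (i + k * d + d) \<asymp> f (i + k * d)" by (rule assms)
    then show ?case using Suc cg_trans by (simp add: add_ac)
  qed simp
  have "(\<Sum>i<Suc m * d. f i) = (\<Sum>i<m * d. f i) + (\<Sum>i<d. f (i + m * d))"
    using sum_lessThan_add[of f "m * d" d] by (simp add: add.commute)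
  also have "\<dots> \<asymp> of_nat m * (\<Sum>i<d. f i) + (\<Sum>i<d. f i)"
    by (intro cg_add Suc cg_sum per)
  finally show ?case by (simp add: algebra_simps)
qed simp

section \<open>The Frobenius map on residues modulo a prime polynomial\<close>

context fp_poly
begin

text \<open>The Frobenius map is additive modulo \<open>p\<close> and, by Fermat's theorem, fixes
  the integer coefficients.\<close>

lemma frobenius_lift_poly:
  assumes "cring_ideal_char J p"
  shows "poly (lift_poly U) Y ^ (p ^ k) - poly (lift_poly U) (Y ^ (p ^ k)) \<in> J"
proof -
  interpret J: cring_ideal_char J p by fact
  have "poly (lift_poly U) Y ^ (p ^ k) = (\<Sum>i\<le>degree U. of_int (coeff U i) * Y ^ i) ^ (p ^ k)"
    by (simp add: poly_lift_poly)
  also have "J.cg \<dots> (\<Sum>i\<le>degree U. (of_int (coeff U i) * Y ^ i) ^ (p ^ k))"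
    by (rule J.frobenius_sum)
  also have "J.cg \<dots> (\<Sum>i\<le>degree U. of_int (coeff U i) * (Y ^ (p ^ k)) ^ i)"
  proof (rule J.cg_sum)
    fix i
    have "(of_int (coeff U i) * Y ^ i) ^ (p ^ k) = of_int (coeff U i) ^ (p ^ k) * (Y ^ (p ^ k)) ^ i"
      by (simp add: power_mult_distrib power_mult[symmetric] mult.commute)
    also have "J.cg \<dots> (of_int (coeff U i) * (Y ^ (p ^ k)) ^ i)"
      by (intro J.cg_mult J.of_int_power_p J.cg_refl)
    finally show "J.cg ((of_int (coeff U i) * Y ^ i) ^ (p ^ k)) (of_int (coeff U i) * (Y ^ (p ^ k)) ^ i)" .
  qed
  finally show ?thesis by (simp add: J.cg_def poly_lift_poly)
qed

text \<open>Adding \<open>X ^ degree P\<close> makes the remainders monic, so that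
  \<open>monic_polys\<close> with its known cardinality also serves as a system of residues modulo
  \<open>P\<close>.\<close>

lemma residue_rep:
  assumes P: "lead_coeff P = 1" "degree P > 0"
  shows "\<exists>F\<in>monic_polys (degree P). U + X ^ degree P - F \<in> gen_ideal P"
proof -
  obtain Q R where QR: "U = P * Q + R" "R = 0 \<or> degree R < degree P"
    using monic_division[OF P(1)] by blast
  let ?G = "R + X ^ degree P"
  have X: "X ^ degree P = monom 1 (degree P)" by (simp add: monom_altdef X_def)
  have d: "degree ?G = degree P" "coeff ?G (degree P) = 1"
    using QR(2) P(2) by (auto simp: X degree_add_eq_right degree_monom_eq coeff_eq_0)
  have "U + X ^ degree P - reduce ?G = P * Q + (?G - reduce ?G)" using QR(1) by simp
  also have "\<dots> \<in> gen_ideal P" by (intro gen_ideal_add gen_ideal_mult' gen_ideal_self p_ideal_subset_gen_ideal reduce_cong)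
  finally show ?thesis using reduce_in_monic_polys[of ?G] d by auto
qed

lemma residue_unique:
  assumes P: "lead_coeff P = 1" "degree P > 0"
    and F: "F \<in> monic_polys (degree P)" "G \<in> monic_polys (degree P)" "F - G \<in> gen_ideal P"
  shows "F = G"
proof -
  have "degree (F - G) \<le> degree P" using F monic_polys_monic by (metis degree_diff_le order_refl)
  moreover have "coeff (F - G) (degree P) = 0" using F by (simp add: monic_polys_def)
  ultimately have "degree (F - G) < degree P"
    using P(2) by (metis degree_0 le_neq_implies_less leading_coeff_0_iff)
  then show ?thesis using gen_ideal_small_degree[OF P(1) F(3)] monic_polys_eqI[OF F(1,2)] by blast
qed

lemma conjugate_root:
  assumes P: "P \<in> prime_polys"
  shows "poly (lift_poly P) (X ^ (p ^ i)) \<in> gen_ideal P"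
proof -
  interpret I: prime_ideal_char "gen_ideal P" p by (rule prime_ideal_gen_ideal[OF P])
  have "I.cg (poly (lift_poly P) X ^ (p ^ i)) (poly (lift_poly P) (X ^ (p ^ i)))"
    unfolding I.cg_def by (rule frobenius_lift_poly[OF I.cring_ideal_char_axioms])
  moreover have "poly (lift_poly P) X ^ (p ^ i) \<in> gen_ideal P"
  proof -
    obtain n where "p ^ i = Suc n" using p_pos by (metis Suc_pred zero_less_power)
    then show ?thesis unfolding poly_lift_poly_X by (simp only: power_Suc gen_ideal_mult' gen_ideal_self)
  qed
  ultimately show ?thesis using I.cg_mem by blast
qed

text \<open>The class of \<open>X\<close> has Frobenius period exactly \<open>degree P\<close>. A
  longer least period would give \<open>P\<close> too many roots. With a shorter period
  \<open>e\<close>, all \<open>p ^ degree P\<close> residues would be roots of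
  \<open>T ^ (p ^ e) - T\<close>.\<close>

lemma conjugates:
  assumes P: "P \<in> prime_polys"
  shows "X ^ (p ^ degree P) - X \<in> gen_ideal P"
    and "\<And>i j. i < j \<Longrightarrow> j < degree P \<Longrightarrow> X ^ (p ^ i) - X ^ (p ^ j) \<notin> gen_ideal P"
proof -
  interpret I: prime_ideal_char "gen_ideal P" p by (rule prime_ideal_gen_ideal[OF P])
  define d where "d = degree P"
  have d: "d > 0" and m: "lead_coeff P = 1" using prime_polys_degree[OF P] prime_polys_monic[OF P] by (auto simp: d_def)
  have period: "I.cg (X ^ (p ^ (j - i))) X" if "i < j" "I.cg (X ^ (p ^ i)) (X ^ (p ^ j))" for i j
  proof -
    have "X ^ (p ^ j) = (X ^ (p ^ (j - i))) ^ (p ^ i)"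
      using that(1) by (simp add: power_mult[symmetric] power_add[symmetric])
    then have "I.cg X (X ^ (p ^ (j - i)))" using that(2) I.frobenius_inj by metis
    then show ?thesis by (rule I.cg_sym)
  qed
  \<comment> \<open>A period exists by the pigeonhole principle, and it starts at \<open>X\<close>
    itself because the Frobenius map is injective.\<close>
  have ex: "\<exists>e>0. I.cg (X ^ (p ^ e)) X"
  proof -
    have "\<forall>i. \<exists>F. F \<in> monic_polys d \<and> X ^ (p ^ i) + X ^ d - F \<in> gen_ideal P"
      using residue_rep[OF m] d unfolding d_def by blast
    from choice[OF this] obtain h where h: "\<And>i. h i \<in> monic_polys d \<and> X ^ (p ^ i) + X ^ d - h i \<in> gen_ideal P"
      by blast
    have "\<not> inj_on h {..p ^ d}"
    proof
      assume "inj_on h {..p ^ d}"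
      then have "card {..p ^ d} \<le> card (monic_polys d)" using h finite_monic_polys by (intro card_inj_on_le) auto
      then show False by (simp add: card_monic_polys)
    qed
    then obtain i j where ij: "h i = h j" "i < j"
      unfolding inj_on_def by (metis linorder_neqE_nat)
    have "X ^ (p ^ i) - X ^ (p ^ j) = (X ^ (p ^ i) + X ^ d - h i) - (X ^ (p ^ j) + X ^ d - h j)"
      using ij by simp
    also have "\<dots> \<in> gen_ideal P" by (rule gen_ideal_diff) (use h in blast)+
    finally have "I.cg (X ^ (p ^ (j - i))) X" using period[OF ij(2)] by (simp add: I.cg_def)
    then show ?thesis using ij(2) by (intro exI[of _ "j - i"]) auto
  qed
  define e where "e = (LEAST e. e > 0 \<and> I.cg (X ^ (p ^ e)) X)"
  have e: "e > 0" "I.cg (X ^ (p ^ e)) X" using LeastI_ex[OF ex] unfolding e_def by auto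
  have emin: "e \<le> e'" if "e' > 0" "I.cg (X ^ (p ^ e')) X" for e'
    unfolding e_def by (rule Least_le) (use that in auto)
  have dist: "\<not> I.cg (X ^ (p ^ i)) (X ^ (p ^ j))" if "i < j" "j < e" for i j
  proof
    assume "I.cg (X ^ (p ^ i)) (X ^ (p ^ j))"
    from emin[OF _ period[OF that(1) this]] that show False by auto
  qed
  have dist': "i = j" if "i < e" "j < e" "I.cg (X ^ (p ^ i)) (X ^ (p ^ j))" for i j
    using dist[of i j] dist[of j i] that I.cg_sym by (metis linorder_neqE_nat)
  note root = conjugate_root[OF P]
  have "e \<le> d"
  proof (rule ccontr)
    assume "\<not> e \<le> d"
    have "coeff (lift_poly P) d \<in> gen_ideal P"
    proof (rule I.poly_coeffs_mem_if_many_roots)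
      show "degree (lift_poly P) < card ((\<lambda>i. X ^ (p ^ i)) ` {..<e})"
        using \<open>\<not> e \<le> d\<close> dist'
        by (subst card_image) (auto simp: d_def inj_on_def)
      show "u = w" if "u \<in> (\<lambda>i. X ^ (p ^ i)) ` {..<e}" "w \<in> (\<lambda>i. X ^ (p ^ i)) ` {..<e}" "I.cg u w" for u w
        using that dist' by blast
    qed (use root in auto)
    then show False using m I.one_notin by (simp add: d_def)
  qed
  moreover have "d \<le> e"
  proof (rule ccontr)
    assume "\<not> d \<le> e"
    define f :: "int poly poly" where "f = monom 1 (p ^ e) - monom 1 1"
    have p1: "p ^ e > 1" by (rule one_less_power[OF p_gt_1 e(1)])
    have df: "degree f = p ^ e"
      unfolding f_def using p1 by (subst diff_conv_add_uminus, subst degree_add_eq_left) (auto simp: degree_monom_eq)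
    have "coeff f (p ^ e) \<in> gen_ideal P"
    proof (rule I.poly_coeffs_mem_if_many_roots)
      have "p ^ e < p ^ d" using \<open>\<not> d \<le> e\<close> p_gt_1 by (intro power_strict_increasing) auto
      then show "degree f < card (monic_polys d)" by (simp add: df card_monic_polys)
      show "finite (monic_polys d)" by (rule finite_monic_polys)
      show "poly f F \<in> gen_ideal P" if "F \<in> monic_polys d" for F
      proof -
        have "I.cg (F ^ (p ^ e)) (poly (lift_poly F) (X ^ (p ^ e)))"
          using frobenius_lift_poly[OF I.cring_ideal_char_axioms, of F X e] by (simp add: I.cg_def poly_lift_poly_X)
        also have "I.cg \<dots> (poly (lift_poly F) X)"
          unfolding poly_lift_poly by (intro I.cg_sum I.cg_mult I.cg_power e(2) I.cg_refl)
        also have "\<dots> = F" by (rule poly_lift_poly_X)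
        finally show ?thesis by (simp add: f_def I.cg_def poly_monom)
      qed
      show "F = G" if "F \<in> monic_polys d" "G \<in> monic_polys d" "I.cg F G" for F G
        using residue_unique[OF m, of F G] d that by (simp add: d_def I.cg_def)
    qed
    then show False using p1 I.one_notin by (simp add: f_def)
  qed
  ultimately have "e = d" by simp
  then show "X ^ (p ^ degree P) - X \<in> gen_ideal P"
    "\<And>i j. i < j \<Longrightarrow> j < degree P \<Longrightarrow> X ^ (p ^ i) - X ^ (p ^ j) \<notin> gen_ideal P"
    using e(2) dist by (auto simp: d_def I.cg_def)
qed

text \<open>Both polynomials are monic and vanish at the conjugates of \<open>X\<close>, so their
  difference has more roots than its degree allows.\<close>

lemma conjugate_coeffs:
  assumes P: "P \<in> prime_polys"
  shows "of_int (coeff P i) - coeff (\<Prod>i<degree P. [:- (X ^ (p ^ i)), 1:]) i \<in> gen_ideal P"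
proof -
  interpret I: prime_ideal_char "gen_ideal P" p by (rule prime_ideal_gen_ideal[OF P])
  define d where "d = degree P"
  have d: "d > 0" and m: "lead_coeff P = 1" using prime_polys_degree[OF P] prime_polys_monic[OF P] by (auto simp: d_def)
  define Q where "Q = (\<Prod>i<d. [:- (X ^ (p ^ i)), 1:])"
  note root = conjugate_root[OF P]
  have inc: "i = j" if "i < d" "j < d" "I.cg (X ^ (p ^ i)) (X ^ (p ^ j))" for i j
    using conjugates(2)[OF P, of i j] conjugates(2)[OF P, of j i] that I.cg_sym
    by (metis I.cg_def d_def linorder_neqE_nat)
  have "degree (lift_poly P - Q) < d"
  proof -
    have "degree (lift_poly P - Q) \<le> d"
      unfolding Q_def by (intro degree_diff_le coeff_prod_linear) (simp add: d_def)
    moreover have "coeff (lift_poly P - Q) d = 0"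
      using m by (simp add: Q_def coeff_prod_linear(2) d_def)
    ultimately show ?thesis using d by (metis degree_0 le_neq_implies_less leading_coeff_0_iff)
  qed
  moreover have "poly Q (X ^ (p ^ i)) = 0" if "i < d" for i
    unfolding Q_def poly_prod using that by (intro prod_zero) auto
  ultimately have "coeff (lift_poly P - Q) i \<in> gen_ideal P"
    using root inc
    by (intro I.poly_coeffs_mem_if_many_roots[of "(\<lambda>i. X ^ (p ^ i)) ` {..<d}"])
      (auto simp: card_image inj_on_def)
  then show ?thesis by (simp add: Q_def d_def)
qed

text \<open>The sum of \<open>r + D / r\<close> over the roots \<open>r\<close> of \<open>P\<close>; \<open>coeff P 0 ^ (p - 2)\<close> is the inverse of \<open>coeff P 0\<close>
modulo \<open>p\<close>, except that it is \<open>0\<close> (or \<open>1\<close> for \<open>p = 2\<close>) if \<open>p\<close> divides \<open>coeff P 0\<close>.\<close>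
definition tau :: "int \<Rightarrow> int poly \<Rightarrow> int" where
  "tau D P = - (coeff P (degree P - 1) + D * (coeff P 1 * coeff P 0 ^ (p - 2)))"

lemma X_notin_gen_ideal:
  assumes P: "P \<in> prime_polys" and "\<not> int p dvd coeff P 0"
  shows "X \<notin> gen_ideal P"
proof
  assume X: "X \<in> gen_ideal P"
  obtain c P' where c: "P = pCons c P'" by (cases P) auto
  then have "[:c:] = P - X * P'" by (simp add: X_def)
  also have "\<dots> \<in> gen_ideal P" by (intro gen_ideal_diff gen_ideal_self gen_ideal_mult' X)
  finally have "[:c:] \<in> p_ideal"
    using gen_ideal_small_degree[OF prime_polys_monic[OF P], of "[:c:]"] prime_polys_degree[OF P] by simp
  then show False using assms(2) c by (auto simp: p_ideal_iff dest!: spec[of _ 0])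
qed

text \<open>The last claim is \<open>X\<close> times the trace of \<open>X + D / X\<close> to
  \<open>F_p\<close>. Since \<open>X ^ q\<close> is \<open>X\<close>, the power
  \<open>X ^ (q - p ^ i)\<close> stands for \<open>X / X ^ (p ^ i)\<close>. These exponents avoid
  inverses and are those produced by the curve equation in \<open>vv_power_pk\<close>.\<close>

lemma frobenius_trace:
  assumes P: "P \<in> prime_polys" and n: "degree P dvd n" "n > 0" and c0: "\<not> int p dvd coeff P 0"
    and q: "q = p ^ n"
  shows "X ^ q - X \<in> gen_ideal P" and "X ^ (q - 1) - 1 \<in> gen_ideal P"
    and "(\<Sum>i<n. X ^ (q + p ^ i) + of_int D * X ^ (q - p ^ i))
           - of_int (int (n div degree P) * tau D P) * X \<in> gen_ideal P"
proof -
  interpret I: prime_ideal_char "gen_ideal P" p by (rule prime_ideal_gen_ideal[OF P])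
  define d where "d = degree P"
  have d: "d > 0" and m: "lead_coeff P = 1" using prime_polys_degree[OF P] prime_polys_monic[OF P] by (auto simp: d_def)
  obtain k where k: "n = k * d" using n(1) by (auto simp: d_def dvd_def mult.commute)
  have X0: "X \<notin> gen_ideal P" by (rule X_notin_gen_ideal[OF P c0])
  have per: "I.cg (X ^ (p ^ (i + d))) (X ^ (p ^ i))" for i
  proof -
    have "X ^ (p ^ (i + d)) = (X ^ (p ^ d)) ^ (p ^ i)"
      by (simp add: power_mult[symmetric] power_add mult.commute)
    also have "I.cg \<dots> (X ^ (p ^ i))"
      using conjugates(1)[OF P] by (intro I.cg_power) (simp add: I.cg_def d_def)
    finally show ?thesis .
  qed
  have "I.cg (X ^ (p ^ (j * d))) X" for j
  proof (induction j)
    case (Suc j)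
    show ?case using I.cg_trans[OF per[of "j * d"] Suc] by (simp add: add.commute)
  qed simp
  then have Xq: "I.cg (X ^ q) X" by (simp add: q k)
  then show "X ^ q - X \<in> gen_ideal P" by (simp add: I.cg_def)
  have q2: "q \<ge> 2" using n(2) p_ge_2 unfolding q
    by (metis One_nat_def Suc_leI le_trans power_increasing power_one_right p_pos)
  have "I.cg (X * X ^ (q - 1)) (X * 1)"
    unfolding power_Suc[symmetric] using Xq q2 by simp
  then have Xq1: "I.cg (X ^ (q - 1)) 1" using I.cg_cancel X0 by blast
  then show "X ^ (q - 1) - 1 \<in> gen_ideal P" by (simp add: I.cg_def)
  \<comment> \<open>\<open>Y\<close> is an inverse of \<open>X\<close> modulo
    \<open>P\<close>.\<close>
  define Y where "Y = X ^ (q - 2)"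
  have "q - 1 = Suc (q - 2)" using q2 by simp
  then have XY: "I.cg (X * Y) 1" using Xq1 by (simp only: Y_def power_Suc[symmetric])
  have XYi: "I.cg (X ^ (p ^ i) * Y ^ (p ^ i)) 1" for i
    using I.cg_power[OF XY, of "p ^ i"] by (simp only: power_mult_distrib power_one)
  have Xi0: "X ^ (p ^ i) \<notin> gen_ideal P" for i using X0 I.power_mem by blast
  have perY: "I.cg (Y ^ (p ^ (i + d))) (Y ^ (p ^ i))" for i
  proof -
    have "I.cg (X ^ (p ^ i) * Y ^ (p ^ (i + d))) (X ^ (p ^ (i + d)) * Y ^ (p ^ (i + d)))"
      by (intro I.cg_mult I.cg_refl I.cg_sym[OF per])
    also have "I.cg \<dots> 1" by (rule XYi)
    also have "I.cg 1 (X ^ (p ^ i) * Y ^ (p ^ i))" by (rule I.cg_sym[OF XYi])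
    finally show ?thesis by (rule I.cg_cancel[OF _ Xi0])
  qed
  let ?Q = "\<Prod>i<d. [:- (X ^ (p ^ i)), 1:]"
  have co: "I.cg (of_int (coeff P i)) (coeff ?Q i)" for i
    using conjugate_coeffs[OF P, of i] by (simp add: I.cg_def d_def)
  have sX: "I.cg (\<Sum>i<d. X ^ (p ^ i)) (- of_int (coeff P (d - 1)))"
    using I.cg_uminus[OF I.cg_sym[OF co[of "d - 1"]]] coeff_prod_linear(3)[OF d, of "\<lambda>i. X ^ (p ^ i)"] by simp
  \<comment> \<open>Vieta gives this sum multiplied by \<open>- coeff P 0\<close>; Fermat's theorem
    makes \<open>coeff P 0 ^ (p - 2)\<close> the inverse needed to solve for it.\<close>
  have sY: "I.cg (\<Sum>i<d. Y ^ (p ^ i)) (- of_int (coeff P 1 * coeff P 0 ^ (p - 2)))"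
  proof -
    define S where "S = (\<Sum>i<d. Y ^ (p ^ i))"
    have "I.cg (of_int (coeff P 1)) (coeff ?Q 1)" by (rule co)
    also have "I.cg \<dots> (- coeff ?Q 0 * S)" unfolding S_def by (rule I.coeff_1_prod_linear) (rule XYi)
    also have "I.cg \<dots> (- of_int (coeff P 0) * S)"
      by (intro I.cg_mult I.cg_uminus I.cg_refl I.cg_sym[OF co])
    finally have 1: "I.cg (of_int (coeff P 1)) (- of_int (coeff P 0) * S)" .
    have "I.cg (of_int (coeff P 0 ^ (p - 2)) * of_int (coeff P 1)) (of_int (coeff P 0 ^ (p - 2)) * (- of_int (coeff P 0) * S))"
      by (intro I.cg_mult I.cg_refl 1)
    also have "\<dots> = - of_int (coeff P 0 ^ (p - 1)) * S"
    proof -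
      have "p - 1 = Suc (p - 2)" using p_ge_2 by simp
      then show ?thesis by (simp add: mult_ac)
    qed
    also have "I.cg \<dots> (- of_int 1 * S)"
      by (intro I.cg_mult I.cg_uminus I.cg_refl I.of_int_cg fermat_int prime_p c0)
    finally have "I.cg (- (of_int (coeff P 0 ^ (p - 2)) * of_int (coeff P 1))) (- (- of_int 1 * S))"
      by (rule I.cg_uminus)
    then have "I.cg S (- (of_int (coeff P 0 ^ (p - 2)) * of_int (coeff P 1)))" using I.cg_sym by simp
    then show ?thesis by (simp add: S_def mult.commute)
  qed
  have pi: "p ^ i \<le> q" if "i < n" for i
    using that p_gt_1 unfolding q by (intro power_increasing) auto
  have summand: "I.cg (X ^ (q + p ^ i) + of_int D * X ^ (q - p ^ i)) (X * X ^ (p ^ i) + of_int D * (X * Y ^ (p ^ i)))"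
    if "i < n" for i
  proof (intro I.cg_add I.cg_mult I.cg_refl)
    show "I.cg (X ^ (q + p ^ i)) (X * X ^ (p ^ i))"
      unfolding power_add by (intro I.cg_mult I.cg_refl Xq)
    have "I.cg (X ^ (p ^ i) * X ^ (q - p ^ i)) (X * (X ^ (p ^ i) * Y ^ (p ^ i)))"
    proof -
      have "X ^ (p ^ i) * X ^ (q - p ^ i) = X ^ q" using pi[OF that] by (simp only: power_add[symmetric]) simp
      also have "I.cg \<dots> (X * 1)" using Xq by simp
      also have "I.cg (X * 1) (X * (X ^ (p ^ i) * Y ^ (p ^ i)))"
        by (intro I.cg_mult I.cg_refl I.cg_sym[OF XYi])
      finally show ?thesis .
    qed
    also have "X * (X ^ (p ^ i) * Y ^ (p ^ i)) = X ^ (p ^ i) * (X * Y ^ (p ^ i))" by (simp only: mult_ac)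
    finally show "I.cg (X ^ (q - p ^ i)) (X * Y ^ (p ^ i))" by (rule I.cg_cancel[OF _ Xi0])
  qed
  have "I.cg (\<Sum>i<n. X ^ (q + p ^ i) + of_int D * X ^ (q - p ^ i))
      (\<Sum>i<n. X * X ^ (p ^ i) + of_int D * (X * Y ^ (p ^ i)))"
    by (intro I.cg_sum summand) simp
  also have "\<dots> = X * ((\<Sum>i<n. X ^ (p ^ i)) + of_int D * (\<Sum>i<n. Y ^ (p ^ i)))"
    by (simp only: sum.distrib sum_distrib_left distrib_left mult.left_commute)
  also have "I.cg \<dots> (X * (of_nat k * (\<Sum>i<d. X ^ (p ^ i)) + of_int D * (of_nat k * (\<Sum>i<d. Y ^ (p ^ i)))))"
    unfolding k by (intro I.cg_mult I.cg_add I.cg_refl I.cg_sum_periodic per perY)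
  also have "I.cg \<dots> (X * (of_nat k * (- of_int (coeff P (d - 1))) + of_int D * (of_nat k * (- of_int (coeff P 1 * coeff P 0 ^ (p - 2))))))"
    by (intro I.cg_mult I.cg_add I.cg_refl sX sY)
  also have "\<dots> = of_int (int k * tau D P) * X"
    unfolding tau_def d_def[symmetric] by (simp only: of_int_mult of_int_minus of_int_add of_int_of_nat_eq) (simp add: algebra_simps)
  also have "k = n div degree P" using k d by (simp add: d_def)
  finally show "(\<Sum>i<n. X ^ (q + p ^ i) + of_int D * X ^ (q - p ^ i))
      - of_int (int (n div degree P) * tau D P) * X \<in> gen_ideal P"
    by (simp only: I.cg_def)
qed

end

section \<open>The Artin--Schreier curve and its weight filtration\<close>

lemma (in cring_ideal) pcompose_coeffs_in:
  "f \<in> coeffs_in I \<Longrightarrow> pcompose f g \<in> coeffs_in I"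
proof (induction f)
  case 0
  then show ?case by simp
next
  case (pCons a f)
  interpret C: cring_ideal "coeffs_in I" by (rule cring_ideal_coeffs)
  have a: "[:a:] \<in> coeffs_in I" and f: "f \<in> coeffs_in I"
    using pCons.prems by (auto simp: coeffs_in_def coeff_pCons zero_mem split: nat.splits dest: spec[of _ 0] spec[of _ "Suc _"])
  show ?case unfolding pcompose_pCons
    by (intro C.add_mem C.mult_mem pCons.IH a f)
qed

lemma degree_diff_eq_left: "degree (q :: 'a::ab_group_add poly) < degree p \<Longrightarrow> degree (p - q) = degree p"
  using degree_add_eq_left[of "- q" p] by simp

lemma coeffs_in_const: "a \<in> I \<Longrightarrow> 0 \<in> I \<Longrightarrow> [:a:] \<in> coeffs_in I"
  by (auto simp: coeffs_in_def coeff_pCons split: nat.splits)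

lemma coeffs_in_mono: "I \<subseteq> I' \<Longrightarrow> coeffs_in I \<subseteq> coeffs_in I'"
  by (auto simp: coeffs_in_def)

lemma adjoin_mono: "I \<subseteq> I' \<Longrightarrow> adjoin I F \<subseteq> adjoin I' F"
  using coeffs_in_mono[of I I'] by (force simp: adjoin_def)

definition xx :: "int poly poly" where "xx = [:X:]"
definition vv :: "int poly poly" where "vv = [:0, 1:]"

lemma xx_vv_monom: "xx ^ i * vv ^ j = monom (X ^ i) j"
  by (simp add: xx_def vv_def monom_altdef poly_const_pow)

locale curve = fp_poly +
  fixes D :: int
begin

text \<open>The curve \<open>y ^ p - y = x + D / x\<close> in the coordinates \<open>x\<close> and \<open>v = x * y\<close>, which make it polynomial and
monic in \<open>v\<close>.\<close>
definition Phi :: "int poly poly" where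
  "Phi = vv ^ p - (xx ^ (p - 1) * vv + xx ^ (p + 1) + of_int D * xx ^ (p - 1))"

lemma Phi_degree: "degree Phi = p" and Phi_monic: "lead_coeff Phi = 1"
proof -
  define R where "R = xx ^ (p - 1) * vv + xx ^ (p + 1) + of_int D * xx ^ (p - 1)"
  have "R = pCons (X ^ (p + 1) + of_int D * X ^ (p - 1)) [:X ^ (p - 1):]"
    by (simp add: R_def xx_def vv_def poly_const_pow of_int_poly)
  then have "degree R \<le> 1" by simp
  then have lt: "degree R < degree (vv ^ p)" using p_ge_2 by (simp add: vv_def degree_power_eq)
  have P: "Phi = vv ^ p - R" by (simp add: Phi_def R_def)
  have "lead_coeff (vv ^ p) = 1" by (simp add: vv_def lead_coeff_power)
  moreover have d: "degree (vv ^ p) = p" by (simp add: vv_def degree_power_eq)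
  ultimately show "degree Phi = p" "lead_coeff Phi = 1"
    using lt unfolding P
    by (simp_all add: degree_diff_eq_left coeff_eq_0)
qed

text \<open>Congruence modulo \<open>J0\<close> is equality of functions on the affine curve over
  \<open>F_p\<close>.\<close>

definition J0 :: "int poly poly set" where "J0 = adjoin p_ideal Phi"

sublocale J0: cring_ideal_char J0 p
  unfolding J0_def by (rule p_ideal.cring_ideal_char_adjoin)

lemma vv_power_p: "J0.cg (vv ^ p) (xx ^ (p - 1) * vv + xx ^ (p + 1) + of_int D * xx ^ (p - 1))"
  unfolding J0.cg_def Phi_def[symmetric] unfolding J0_def by (rule p_ideal.adjoin_self)

text \<open>In terms of \<open>y = v / x\<close>, and multiplied by \<open>x ^ (p ^ k)\<close>, this
  says that \<open>y ^ (p ^ k)\<close> is \<open>y\<close> plus the sum of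
  \<open>(x + D / x) ^ (p ^ i)\<close> over \<open>i < k\<close>, the iterate of the Artin--Schreier
  equation.\<close>

lemma vv_power_pk:
  "J0.cg (vv ^ (p ^ k)) (xx ^ (p ^ k - 1) * vv + (\<Sum>i<k. xx ^ (p ^ k + p ^ i) + of_int D * xx ^ (p ^ k - p ^ i)))"
proof (induction k)
  case (Suc k)
  have pw: "(xx ^ j) ^ (p ^ 1) = xx ^ (j * p)" for j by (simp add: power_mult)
  have e1: "(p ^ Suc k - p) + (p - 1) = p ^ Suc k - 1"
    "(p ^ Suc k - p) + (p + 1) = p ^ Suc k + p ^ 0"
    using self_le_power[of p "Suc k"] p_ge_2 by (auto simp del: power_Suc)
  have "vv ^ (p ^ Suc k) = (vv ^ (p ^ k)) ^ (p ^ 1)"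
    by (simp add: power_mult[symmetric] mult.commute)
  also have "J0.cg \<dots> ((xx ^ (p ^ k - 1) * vv + (\<Sum>i<k. xx ^ (p ^ k + p ^ i) + of_int D * xx ^ (p ^ k - p ^ i))) ^ (p ^ 1))"
    by (rule J0.cg_power[OF Suc])
  also have "J0.cg \<dots> ((xx ^ (p ^ k - 1) * vv) ^ (p ^ 1) + (\<Sum>i<k. xx ^ (p ^ k + p ^ i) + of_int D * xx ^ (p ^ k - p ^ i)) ^ (p ^ 1))"
    by (rule J0.frobenius_pow_add)
  also have "J0.cg \<dots> (xx ^ (p ^ Suc k - p) * (xx ^ (p - 1) * vv + xx ^ (p + 1) + of_int D * xx ^ (p - 1))
      + (\<Sum>i<k. xx ^ (p ^ Suc k + p ^ Suc i) + of_int D * xx ^ (p ^ Suc k - p ^ Suc i)))"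
  proof (rule J0.cg_add)
    have "(xx ^ (p ^ k - 1) * vv) ^ (p ^ 1) = xx ^ (p ^ Suc k - p) * vv ^ p"
      by (simp only: power_mult_distrib pw) (simp add: diff_mult_distrib diff_mult_distrib2 mult.commute)
    then show "J0.cg ((xx ^ (p ^ k - 1) * vv) ^ (p ^ 1))
       (xx ^ (p ^ Suc k - p) * (xx ^ (p - 1) * vv + xx ^ (p + 1) + of_int D * xx ^ (p - 1)))"
      using J0.cg_mult[OF J0.cg_refl vv_power_p] by metis
    have "J0.cg ((\<Sum>i<k. xx ^ (p ^ k + p ^ i) + of_int D * xx ^ (p ^ k - p ^ i)) ^ (p ^ 1))
       (\<Sum>i<k. (xx ^ (p ^ k + p ^ i) + of_int D * xx ^ (p ^ k - p ^ i)) ^ (p ^ 1))"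
      by (rule J0.frobenius_sum)
    also have "J0.cg \<dots> (\<Sum>i<k. xx ^ (p ^ Suc k + p ^ Suc i) + of_int D * xx ^ (p ^ Suc k - p ^ Suc i))"
    proof (rule J0.cg_sum)
      fix i
      have "J0.cg ((xx ^ (p ^ k + p ^ i) + of_int D * xx ^ (p ^ k - p ^ i)) ^ (p ^ 1))
          ((xx ^ (p ^ k + p ^ i)) ^ (p ^ 1) + (of_int D * xx ^ (p ^ k - p ^ i)) ^ (p ^ 1))"
        by (rule J0.frobenius_pow_add)
      also have "\<dots> = xx ^ (p ^ Suc k + p ^ Suc i) + of_int D ^ (p ^ 1) * xx ^ (p ^ Suc k - p ^ Suc i)"
        by (simp only: power_mult_distrib pw) (simp add: algebra_simps)
      also have "J0.cg \<dots> (xx ^ (p ^ Suc k + p ^ Suc i) + of_int D * xx ^ (p ^ Suc k - p ^ Suc i))"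
        by (intro J0.cg_add J0.cg_mult J0.cg_refl J0.of_int_power_p)
      finally show "J0.cg ((xx ^ (p ^ k + p ^ i) + of_int D * xx ^ (p ^ k - p ^ i)) ^ (p ^ 1))
          (xx ^ (p ^ Suc k + p ^ Suc i) + of_int D * xx ^ (p ^ Suc k - p ^ Suc i))" .
    qed
    finally show "J0.cg ((\<Sum>i<k. xx ^ (p ^ k + p ^ i) + of_int D * xx ^ (p ^ k - p ^ i)) ^ (p ^ 1))
       (\<Sum>i<k. xx ^ (p ^ Suc k + p ^ Suc i) + of_int D * xx ^ (p ^ Suc k - p ^ Suc i))" .
  qed
  also have "\<dots> = xx ^ (p ^ Suc k - 1) * vv +
      (\<Sum>i<Suc k. xx ^ (p ^ Suc k + p ^ i) + of_int D * xx ^ (p ^ Suc k - p ^ i))"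
  proof -
    have "xx ^ (p ^ Suc k - p) * (xx ^ (p - 1) * vv + xx ^ (p + 1) + of_int D * xx ^ (p - 1))
      = xx ^ ((p ^ Suc k - p) + (p - 1)) * vv + (xx ^ ((p ^ Suc k - p) + (p + 1)) + of_int D * xx ^ ((p ^ Suc k - p) + (p - 1)))"
      unfolding power_add by (simp only: algebra_simps)
    then show ?thesis unfolding sum.lessThan_Suc_shift e1 by (simp add: add_ac)
  qed
  finally show ?case .
qed simp

text \<open>The pole order of \<open>x ^ i * v ^ j\<close> at infinity. Each pole order belongs to at most one monomial with \<open>j < p\<close>,
which is \<open>normal_mono\<close>; at the gaps \<open>normal_mono\<close> is \<open>0\<close>.\<close>
definition weight :: "nat \<Rightarrow> nat \<Rightarrow> nat" where "weight i j = p * i + (p + 1) * j"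

definition normal_mono :: "nat \<Rightarrow> int poly poly" where
  "normal_mono w = (if (p + 1) * (w mod p) \<le> w
     then xx ^ ((w - (p + 1) * (w mod p)) div p) * vv ^ (w mod p) else 0)"

text \<open>The functions with pole order below \<open>W\<close>. One candidate generator for each
  order (0 at a gap) builds the dimension bound \<open>W\<close> into the definition.\<close>

definition weight_span :: "nat \<Rightarrow> int poly poly set" where
  "weight_span W = {f. \<exists>c :: nat \<Rightarrow> int. f - (\<Sum>w<W. of_int (c w) * normal_mono w) \<in> J0}"

lemma weight_span_J0: "f \<in> J0 \<Longrightarrow> f \<in> weight_span W"
  unfolding weight_span_def by (intro CollectI exI[of _ "\<lambda>_. 0"]) simp

lemma weight_span_add: "f \<in> weight_span W \<Longrightarrow> g \<in> weight_span W \<Longrightarrow> f + g \<in> weight_span W"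
proof -
  assume "f \<in> weight_span W" "g \<in> weight_span W"
  then obtain c d where "f - (\<Sum>w<W. of_int (c w) * normal_mono w) \<in> J0" "g - (\<Sum>w<W. of_int (d w) * normal_mono w) \<in> J0"
    unfolding weight_span_def by blast
  from J0.add_mem[OF this] have "f + g - (\<Sum>w<W. of_int (c w + d w) * normal_mono w) \<in> J0"
    by (simp add: algebra_simps sum.distrib)
  then show ?thesis unfolding weight_span_def by (intro CollectI exI[of _ "\<lambda>w. c w + d w"])
qed

lemma weight_span_scale: "f \<in> weight_span W \<Longrightarrow> of_int k * f \<in> weight_span W"
proof -
  assume "f \<in> weight_span W"
  then obtain c where "f - (\<Sum>w<W. of_int (c w) * normal_mono w) \<in> J0"
    unfolding weight_span_def by blast
  from J0.mult_mem[OF this, of "of_int k"] have "of_int k * f - (\<Sum>w<W. of_int (k * c w) * normal_mono w) \<in> J0"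
    by (simp add: algebra_simps sum_distrib_left)
  then show ?thesis unfolding weight_span_def by (intro CollectI exI[of _ "\<lambda>w. k * c w"])
qed

lemma weight_span_sum: "(\<And>i. i \<in> A \<Longrightarrow> f i \<in> weight_span W) \<Longrightarrow> sum f A \<in> weight_span W"
  by (induction A rule: infinite_finite_induct) (auto intro: weight_span_add weight_span_J0 J0.zero_mem)

lemma weight_span_mono: "W \<le> W' \<Longrightarrow> f \<in> weight_span W \<Longrightarrow> f \<in> weight_span W'"
proof -
  assume W: "W \<le> W'" and "f \<in> weight_span W"
  then obtain c where c: "f - (\<Sum>w<W. of_int (c w) * normal_mono w) \<in> J0"
    unfolding weight_span_def by blast
  have "(\<Sum>w<W'. of_int (if w < W then c w else 0) * normal_mono w) = (\<Sum>w<W. of_int (c w) * normal_mono w)"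
    using W by (intro sum.mono_neutral_cong_right) auto
  then show ?thesis unfolding weight_span_def using c by (intro CollectI exI[of _ "\<lambda>w. if w < W then c w else 0"]) simp
qed

lemma weight_span_cg: "J0.cg f g \<Longrightarrow> g \<in> weight_span W \<Longrightarrow> f \<in> weight_span W"
  unfolding J0.cg_def by (drule weight_span_J0[of _ W], drule weight_span_add[of "f - g" W g]) simp_all

lemma normal_mono_weight_span: "w < W \<Longrightarrow> normal_mono w \<in> weight_span W"
proof -
  assume w: "w < W"
  have "(\<Sum>w'<W. of_int (if w' = w then 1 else 0) * normal_mono w') = (\<Sum>w'\<in>{w}. normal_mono w')"
    using w by (intro sum.mono_neutral_cong_right) auto
  then show ?thesis unfolding weight_span_def
    by (intro CollectI exI[of _ "\<lambda>w'. if w' = w then 1 else 0"]) (simp add: J0.zero_mem)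
qed

lemma weight_mod: "weight i j mod p = j mod p"
proof -
  have "weight i j = j + p * (i + j)" by (simp add: weight_def algebra_simps)
  then show ?thesis by simp
qed

lemma normal_mono_weight: "j < p \<Longrightarrow> normal_mono (weight i j) = xx ^ i * vv ^ j"
  using weight_mod[of i j] p_pos by (simp add: normal_mono_def) (simp add: weight_def)

text \<open>Replacing \<open>v ^ p\<close> by the curve equation keeps the weight in the term
  \<open>x ^ (p + 1)\<close> and lowers it in the other two, so every monomial reduces to the normal
  one of its weight plus terms of smaller weight.\<close>

lemma mono_lead: "xx ^ i * vv ^ j - normal_mono (weight i j) \<in> weight_span (weight i j)"
proof (induction j arbitrary: i rule: less_induct)
  case (less j)
  have full: "xx ^ i * vv ^ j' \<in> weight_span W" if "j' < j" "weight i j' < W" for i j' W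
  proof -
    have "(xx ^ i * vv ^ j' - normal_mono (weight i j')) + normal_mono (weight i j') \<in> weight_span W"
      using that by (intro weight_span_add normal_mono_weight_span weight_span_mono[OF _ less.IH[OF that(1)]]) auto
    then show ?thesis by simp
  qed
  show ?case
  proof (cases "j < p")
    case True
    then show ?thesis by (simp add: normal_mono_weight weight_span_J0 J0.zero_mem)
  next
    case False
    define j' where "j' = j - p"
    have j: "j = j' + p" using False by (simp add: j'_def)
    \<comment> \<open>\<open>v ^ p\<close> and \<open>x ^ (p + 1)\<close> both have weight
      \<open>p * p + p\<close>, whereas \<open>x ^ (p - 1) * v\<close> has weight
      \<open>p * p + 1\<close>.\<close>
    have w: "weight i j = weight (i + (p + 1)) j'"
      "weight (i + (p - 1)) (Suc j') < weight i j" "weight (i + (p - 1)) j' < weight i j"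
    proof -
      obtain r where "p = Suc (Suc r)" using p_ge_2 by (metis add_2_eq_Suc le_Suc_ex)
      then show "weight i j = weight (i + (p + 1)) j'"
        "weight (i + (p - 1)) (Suc j') < weight i j" "weight (i + (p - 1)) j' < weight i j"
        unfolding weight_def j by (simp_all add: algebra_simps)
    qed
    have lt: "Suc j' < j" "j' < j" using j p_ge_2 by auto
    have "xx ^ i * vv ^ j = xx ^ i * vv ^ j' * vv ^ p" by (simp add: j power_add mult.assoc)
    also have "J0.cg \<dots> (xx ^ i * vv ^ j' * (xx ^ (p - 1) * vv + xx ^ (p + 1) + of_int D * xx ^ (p - 1)))"
      by (intro J0.cg_mult J0.cg_refl vv_power_p)
    also have "\<dots> = xx ^ (i + (p - 1)) * vv ^ Suc j' + xx ^ (i + (p + 1)) * vv ^ j'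
        + of_int D * (xx ^ (i + (p - 1)) * vv ^ j')"
      unfolding power_add by (simp only: algebra_simps power_Suc)
    finally have "J0.cg (xx ^ i * vv ^ j) \<dots>" .
    then have "J0.cg (xx ^ i * vv ^ j - normal_mono (weight i j)) (xx ^ (i + (p - 1)) * vv ^ Suc j' + xx ^ (i + (p + 1)) * vv ^ j'
        + of_int D * (xx ^ (i + (p - 1)) * vv ^ j') - normal_mono (weight i j))"
      by (intro J0.cg_diff J0.cg_refl)
    also have "\<dots> = xx ^ (i + (p - 1)) * vv ^ Suc j' + (xx ^ (i + (p + 1)) * vv ^ j' - normal_mono (weight (i + (p + 1)) j'))
        + of_int D * (xx ^ (i + (p - 1)) * vv ^ j')"
      by (simp add: w(1))
    finally have cg: "J0.cg (xx ^ i * vv ^ j - normal_mono (weight i j)) (xx ^ (i + (p - 1)) * vv ^ Suc j'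
        + (xx ^ (i + (p + 1)) * vv ^ j' - normal_mono (weight (i + (p + 1)) j')) + of_int D * (xx ^ (i + (p - 1)) * vv ^ j'))" .
    show ?thesis
    proof (rule weight_span_cg[OF cg])
    show "xx ^ (i + (p - 1)) * vv ^ Suc j'
        + (xx ^ (i + (p + 1)) * vv ^ j' - normal_mono (weight (i + (p + 1)) j')) + of_int D * (xx ^ (i + (p - 1)) * vv ^ j') \<in> weight_span (weight i j)"
      using less.IH[OF lt(2), of "i + (p + 1)"] unfolding w(1)[symmetric]
      by (intro weight_span_add weight_span_scale full lt w)
    qed
  qed
qed

lemma mono_weight_span: "weight i j < W \<Longrightarrow> xx ^ i * vv ^ j \<in> weight_span W"
proof -
  assume w: "weight i j < W"
  have "(xx ^ i * vv ^ j - normal_mono (weight i j)) + normal_mono (weight i j) \<in> weight_span W"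
    using w by (intro weight_span_add normal_mono_weight_span weight_span_mono[OF _ mono_lead]) auto
  then show ?thesis by simp
qed

text \<open>Linear algebra by counting: there are \<open>p ^ card A\<close> combinations and only
  \<open>p ^ W\<close> possible values modulo \<open>J0\<close>. Two combinations with the same
  value differ by the required relation.\<close>

lemma pigeonhole_weight_span:
  assumes A: "finite A" "card A > W" and e: "\<And>a. a \<in> A \<Longrightarrow> e a \<in> weight_span W"
  obtains s :: "'a \<Rightarrow> int" where "\<exists>a\<in>A. \<not> int p dvd s a" "(\<Sum>a\<in>A. of_int (s a) * e a) \<in> J0"
proof -
  define FA where "FA = A \<rightarrow>\<^sub>E {0..<int p}"
  define FW where "FW = {..<W} \<rightarrow>\<^sub>E {0..<int p}"
  have "\<exists>c. c \<in> FW \<and> (\<Sum>a\<in>A. of_int (s a) * e a) - (\<Sum>w<W. of_int (c w) * normal_mono w) \<in> J0" for s :: "'a \<Rightarrow> int"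
  proof -
    have "(\<Sum>a\<in>A. of_int (s a) * e a) \<in> weight_span W" by (intro weight_span_sum weight_span_scale e)
    then obtain c where c: "J0.cg (\<Sum>a\<in>A. of_int (s a) * e a) (\<Sum>w<W. of_int (c w) * normal_mono w)"
      unfolding weight_span_def J0.cg_def by blast
    define c' where "c' = restrict (\<lambda>w. c w mod int p) {..<W}"
    note c
    also have "J0.cg (\<Sum>w<W. of_int (c w) * normal_mono w) (\<Sum>w<W. of_int (c' w) * normal_mono w)"
      by (intro J0.cg_sum J0.cg_mult J0.cg_refl J0.of_int_cg) (simp add: c'_def cong_def)
    finally show ?thesis using p_pos unfolding J0.cg_def
      by (intro exI[of _ c'] conjI) (auto simp: FW_def c'_def)
  qed
  then have "\<forall>s. \<exists>c. c \<in> FW \<and> (\<Sum>a\<in>A. of_int (s a) * e a) - (\<Sum>w<W. of_int (c w) * normal_mono w) \<in> J0"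
    by blast
  from choice[OF this] obtain h where
    h: "\<And>s. h s \<in> FW \<and> (\<Sum>a\<in>A. of_int (s a) * e a) - (\<Sum>w<W. of_int (h s w) * normal_mono w) \<in> J0"
    by blast
  have "card FW < card FA"
    unfolding FW_def FA_def using A p_gt_1 by (simp add: card_PiE power_strict_increasing)
  moreover have "finite FW" unfolding FW_def by (simp add: finite_PiE)
  ultimately have "\<not> inj_on h FA" using card_inj_on_le[of h FA FW] h by fastforce
  then obtain s s' where s: "s \<in> FA" "s' \<in> FA" "s \<noteq> s'" "h s = h s'" unfolding inj_on_def by blast
  obtain a where a: "a \<in> A" "s a \<noteq> s' a"
    using s(1-3) unfolding FA_def by (metis PiE_ext)
  show thesis
  proof (rule that[of "\<lambda>a. s a - s' a"])
    have "s a \<in> {0..<int p}" "s' a \<in> {0..<int p}" using s a unfolding FA_def by auto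
    then have "\<not> int p dvd s a - s' a"
      using a(2) by (metis atLeastLessThan_iff mod_eq_dvd_iff mod_pos_pos_trivial)
    then show "\<exists>a\<in>A. \<not> int p dvd s a - s' a" using a by blast
    have "(\<Sum>a\<in>A. of_int (s a - s' a) * e a) =
       ((\<Sum>a\<in>A. of_int (s a) * e a) - (\<Sum>w<W. of_int (h s w) * normal_mono w))
       - ((\<Sum>a\<in>A. of_int (s' a) * e a) - (\<Sum>w<W. of_int (h s' w) * normal_mono w))"
      by (simp add: s(4) left_diff_distrib sum_subtractf)
    also have "\<dots> \<in> J0" by (rule J0.diff_mem) (use h in blast)+
    finally show "(\<Sum>a\<in>A. of_int (s a - s' a) * e a) \<in> J0" .
  qed
qed

text \<open>Monomials of distinct weights are independent: the heaviest one with a coefficient prime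
  to \<open>p\<close> cannot be cancelled.\<close>

lemma leading_weight_span:
  assumes A: "finite A" and a: "\<exists>a\<in>A. \<not> int p dvd s a"
    and inj: "inj_on (\<lambda>a. weight (f a) (g a)) A"
  obtains a where "a \<in> A" "\<not> int p dvd s a"
    "(\<Sum>a\<in>A. of_int (s a) * (xx ^ f a * vv ^ g a)) - of_int (s a) * normal_mono (weight (f a) (g a)) \<in> weight_span (weight (f a) (g a))"
proof -
  define B where "B = {a \<in> A. \<not> int p dvd s a}"
  have B: "finite B" "B \<noteq> {}" "B \<subseteq> A" using A a by (auto simp: B_def)
  obtain b where b: "b \<in> B" "\<And>a. a \<in> B \<Longrightarrow> weight (f a) (g a) \<le> weight (f b) (g b)"
  proof -
    let ?M = "Max ((\<lambda>a. weight (f a) (g a)) ` B)"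
    have "?M \<in> (\<lambda>a. weight (f a) (g a)) ` B" using B by (intro Max_in) auto
    then obtain b where "b \<in> B" "weight (f b) (g b) = ?M" by auto
    moreover have "weight (f a) (g a) \<le> ?M" if "a \<in> B" for a using B that by (intro Max_ge) auto
    ultimately show thesis using that by simp
  qed
  define w where "w = weight (f b) (g b)"
  define M where "M a = xx ^ f a * vv ^ g a" for a
  show thesis
  proof (rule that[of b])
    show "b \<in> A" "\<not> int p dvd s b" using b by (auto simp: B_def)
    have "of_int (s a) * M a \<in> weight_span w" if "a \<in> A - {b}" for a
    proof (cases "a \<in> B")
      case True
      then have "weight (f a) (g a) \<le> w" using b by (simp add: w_def)
      moreover have "weight (f a) (g a) \<noteq> w" using inj that b(1) B(3) by (auto simp: w_def inj_on_def)
      ultimately show ?thesis unfolding M_def by (intro weight_span_scale mono_weight_span) simp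
    next
      case False
      then show ?thesis using that by (intro weight_span_J0 J0.mult_mem' J0.of_int_mem) (auto simp: B_def)
    qed
    then have "(\<Sum>a\<in>A - {b}. of_int (s a) * M a) \<in> weight_span w" by (rule weight_span_sum)
    moreover have "of_int (s b) * (M b - normal_mono w) \<in> weight_span w"
      unfolding w_def M_def by (intro weight_span_scale mono_lead)
    ultimately have "(\<Sum>a\<in>A - {b}. of_int (s a) * M a) + of_int (s b) * (M b - normal_mono w) \<in> weight_span w"
      by (rule weight_span_add)
    also have "(\<Sum>a\<in>A - {b}. of_int (s a) * M a) + of_int (s b) * (M b - normal_mono w)
       = (\<Sum>a\<in>A. of_int (s a) * M a) - of_int (s b) * normal_mono w"
      using A \<open>b \<in> A\<close> by (simp add: sum.remove[of A b] algebra_simps)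
    finally show "(\<Sum>a\<in>A. of_int (s a) * (xx ^ f a * vv ^ g a)) - of_int (s b) * normal_mono (weight (f b) (g b))
       \<in> weight_span (weight (f b) (g b))" by (simp add: w_def M_def)
  qed
qed

end

section \<open>Bombieri's form of Stepanov's method\<close>

context curve
begin

text \<open>Functions on the fibre of the curve above the roots of \<open>P\<close>.\<close>

definition JP :: "int poly \<Rightarrow> int poly poly set" where "JP P = adjoin (gen_ideal P) Phi"

lemma JP_char: "cring_ideal_char (JP P) p"
  unfolding JP_def by (rule cring_ideal_char.cring_ideal_char_adjoin[OF ideal_char_gen_ideal])

lemma J0_subset_JP: "J0 \<subseteq> JP P"
  unfolding J0_def JP_def by (rule adjoin_mono) (auto intro: p_ideal_subset_gen_ideal)

lemma const_mem_JP: "U \<in> gen_ideal P \<Longrightarrow> [:U:] \<in> JP P"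
  using coeffs_in_const[of U "gen_ideal P"] gen_ideal_zero cring_ideal.coeffs_subset_adjoin[OF cring_ideal_char.axioms(1)[OF ideal_char_gen_ideal], of P Phi]
  by (auto simp: JP_def)

lemma xx_power: "xx ^ k = [:X ^ k:]"
  by (simp add: xx_def poly_const_pow)

text \<open>Where the trace of \<open>x + D / x\<close> is \<open>t\<close>, the \<open>q\<close>-th
  power map sends \<open>y\<close> to \<open>y + t\<close>, that is \<open>v\<close> to
  \<open>v + t * x\<close>. Points with nonzero trace are thus treated directly, without introducing
  twisted curves.\<close>

lemma frobenius_vv:
  assumes tr: "(\<Sum>i<n. X ^ (q + p ^ i) + of_int D * X ^ (q - p ^ i)) - of_int t * X \<in> gen_ideal P"
    and q1: "X ^ (q - 1) - 1 \<in> gen_ideal P" and q: "q = p ^ n"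
  shows "vv ^ q - (vv + of_int t * xx) \<in> JP P"
proof -
  interpret J: cring_ideal_char "JP P" p by (rule JP_char)
  have "J.cg (vv ^ q) (xx ^ (q - 1) * vv + (\<Sum>i<n. xx ^ (q + p ^ i) + of_int D * xx ^ (q - p ^ i)))"
    using vv_power_pk[of n] J0_subset_JP[of P] unfolding q J0.cg_def J.cg_def by blast
  also have "J.cg \<dots> (1 * vv + of_int t * xx)"
  proof (intro J.cg_add J.cg_mult J.cg_refl)
    show "J.cg (xx ^ (q - 1)) 1"
      using const_mem_JP[OF q1] by (simp add: J.cg_def xx_power one_pCons)
    have "(\<Sum>i<n. xx ^ (q + p ^ i) + of_int D * xx ^ (q - p ^ i)) =
        (\<Sum>i<n. [:X ^ (q + p ^ i) + of_int D * X ^ (q - p ^ i):])"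
      unfolding xx_power by (simp add: of_int_poly)
    also have "\<dots> = [:\<Sum>i<n. X ^ (q + p ^ i) + of_int D * X ^ (q - p ^ i):]"
      by (induction n) auto
    finally show "J.cg (\<Sum>i<n. xx ^ (q + p ^ i) + of_int D * xx ^ (q - p ^ i)) (of_int t * xx)"
      using const_mem_JP[OF tr] by (simp add: J.cg_def xx_def of_int_poly)
  qed
  finally show ?thesis by (simp add: J.cg_def)
qed

lemma frobenius_pcompose:
  assumes v: "vv ^ q - (vv + of_int t * xx) \<in> JP P" and Xq: "X ^ q - X \<in> gen_ideal P" and q: "q = p ^ n"
  shows "N ^ q - pcompose N (vv + of_int t * xx) \<in> JP P"
proof -
  interpret J: cring_ideal_char "JP P" p by (rule JP_char)
  interpret I: cring_ideal_char "gen_ideal P" p by (rule ideal_char_gen_ideal)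
  have const: "J.cg ([:a:] ^ q) [:a:]" for a
  proof -
    have "I.cg (a ^ q) (poly (lift_poly a) (X ^ q))"
      using frobenius_lift_poly[OF ideal_char_gen_ideal, of a X n] by (simp add: I.cg_def q poly_lift_poly_X)
    also have "I.cg \<dots> (poly (lift_poly a) X)"
      unfolding poly_lift_poly using Xq by (intro I.cg_sum I.cg_mult I.cg_refl I.cg_power) (simp add: I.cg_def)
    finally have "a ^ q - a \<in> gen_ideal P" by (simp add: I.cg_def poly_lift_poly_X)
    from const_mem_JP[OF this] show ?thesis by (simp add: J.cg_def poly_const_pow)
  qed
  have "J.cg (N ^ q) (pcompose N (vv + of_int t * xx))"
  proof (induction N)
    case 0
    then show ?case using p_pos by (simp add: q power_0_left)
  next
    case (pCons a N)
    have "pCons a N = [:a:] + vv * N" by (simp add: vv_def)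
    then have "pCons a N ^ q = ([:a:] + vv * N) ^ q" by simp
    also have "J.cg \<dots> ([:a:] ^ q + (vv * N) ^ q)" unfolding q by (rule J.frobenius_pow_add)
    also have "\<dots> = [:a:] ^ q + vv ^ q * N ^ q" by (simp add: power_mult_distrib)
    also have "J.cg \<dots> ([:a:] + (vv + of_int t * xx) * pcompose N (vv + of_int t * xx))"
      using v by (intro J.cg_add J.cg_mult const pCons.IH) (simp add: J.cg_def)
    finally show ?case by (simp add: pcompose_pCons)
  qed
  then show ?thesis by (simp add: J.cg_def)
qed

lemma degree_normal_mono: "degree (normal_mono w) < p"
  using p_pos by (auto simp: normal_mono_def xx_vv_monom degree_monom_eq intro: le_less_trans[OF degree_monom_le])

text \<open>Different normal monomials have disjoint supports, so a coefficient of a combination in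
  normal form can be read off.\<close>

lemma coeff_normal_mono:
  assumes "j < p"
  shows "coeff (coeff (normal_mono w) j) i = (if w = weight i j then 1 else 0)"
proof -
  have co: "coeff (X ^ k) i = (if k = i then 1 else 0)" for k
    by (simp add: X_def flip: monom_altdef[of 1, simplified])
  show ?thesis
  proof (cases "w mod p = j")
    case False
    then have "w \<noteq> weight i j" using weight_mod[of i j] assms by auto
    then show ?thesis using False by (simp add: normal_mono_def xx_vv_monom)
  next
    case True
    show ?thesis
    proof (cases "(p + 1) * j \<le> w")
      case le: True
      have "p dvd w - (p + 1) * j"
      proof -
        have "w = j + p * (w div p)" using True by (metis mod_mult_div_eq)
        then have "w - (p + 1) * j = p * (w div p) - p * j" by simp
        then show ?thesis by (simp flip: diff_mult_distrib2)
      qed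
      then obtain k where k: "w - (p + 1) * j = p * k" by (auto simp: dvd_def)
      then have w: "w = weight k j" using le by (simp add: weight_def)
      have "weight k j = weight i j \<longleftrightarrow> k = i" using p_pos by (simp add: weight_def)
      then show ?thesis using assms by (simp add: w normal_mono_weight xx_vv_monom co)
    next
      case False
      then show ?thesis using True by (auto simp: normal_mono_def weight_def)
    qed
  qed
qed

text \<open>On the fibre \<open>N ^ q\<close> is \<open>N\<close> with \<open>v\<close> replaced by
  \<open>v + t * x\<close>. That substitution is invertible and preserves the degree in
  \<open>v\<close>, which is below that of \<open>Phi\<close>; hence the coefficients of
  \<open>N\<close> vanish at the roots of \<open>P\<close>. This replaces a comparison of zeros and
  poles on the curve: the \<open>p\<close> points above each \<open>x\<close> match the weight
  \<open>p\<close> of \<open>x\<close>.\<close>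

lemma vanishing_coeffs:
  assumes N: "degree N < p" and q: "q = p ^ n" and Nq: "N ^ q \<in> JP P"
    and v: "vv ^ q - (vv + of_int t * xx) \<in> JP P" and Xq: "X ^ q - X \<in> gen_ideal P"
  shows "N \<in> coeffs_in (gen_ideal P)"
proof -
  interpret J: cring_ideal_char "JP P" p by (rule JP_char)
  interpret I: cring_ideal_char "gen_ideal P" p by (rule ideal_char_gen_ideal)
  define g where "g = vv + of_int t * xx"
  have g: "g = [:of_int t * X, 1:]" by (simp add: g_def vv_def xx_def of_int_poly)
  have "pcompose N g \<in> JP P"
    using frobenius_pcompose[OF v Xq q, of N] Nq J.diff_mem[of "N ^ q" "N ^ q - pcompose N g"] by (simp add: g_def)
  moreover have "degree (pcompose N g) < p" using N by (simp add: degree_pcompose g)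
  ultimately have "pcompose N g \<in> coeffs_in (gen_ideal P)"
    unfolding JP_def using Phi_monic Phi_degree by (intro I.adjoin_small_degree) auto
  then have "pcompose (pcompose N g) [:- (of_int t * X), 1:] \<in> coeffs_in (gen_ideal P)"
    by (rule I.pcompose_coeffs_in)
  moreover have "pcompose (pcompose N g) [:- (of_int t * X), 1:] = N"
    by (simp add: pcompose_assoc[symmetric] g pcompose_pCons)
  ultimately show ?thesis by simp
qed

text \<open>A linear relation among the \<open>E z\<close> says that \<open>S ^ Q\<close> vanishes
  at every point with trace \<open>t\<close>, although \<open>S\<close> itself is a nonzero function
  on the curve. The coefficient \<open>C\<close> of the normal form of \<open>S\<close>, taken at
  the power of \<open>v\<close> in its leading term, is then nonzero and vanishes at all these
  \<open>x\<close>; its degree is controlled by the weight of \<open>S\<close>.\<close>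

lemma auxiliary_polynomial:
  assumes m: "m \<ge> 4"
  obtains C where "C \<notin> p_ideal" "p * degree C \<le> p ^ (2 * m) + 3 * p ^ 2 * p ^ m"
    "\<And>P. P \<in> prime_polys \<Longrightarrow> degree P dvd 2 * m \<Longrightarrow> \<not> int p dvd coeff P 0 \<Longrightarrow>
       [int (2 * m div degree P) * tau D P = t] (mod int p) \<Longrightarrow> C \<in> gen_ideal P"
proof -
  define Q where "Q = p ^ m"
  \<comment> \<open>The ranges give \<open>p * a = Q + 2 * p ^ 2\<close> and
    \<open>p * b = Q - p ^ 2\<close>. The number of monomials is the product of the two, the weight
    bound \<open>W\<close> below is \<open>Q * Q + 3 * p ^ 2\<close>, and the former exceeds the
    latter exactly when \<open>Q > 2 * p ^ 2 + 3\<close>.\<close>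
  define a where "a = p ^ (m - 1) + 2 * p"
  define b where "b = p ^ (m - 1) - p"
  have QQ: "Q * Q = p ^ (2 * m)" by (simp add: Q_def power_add[symmetric] mult_2)
  have pm: "p * p ^ (m - 1) = Q" using m by (simp add: Q_def power_eq_if)
  have pa: "p * a = Q + 2 * p ^ 2" using pm by (simp add: a_def distrib_left power2_eq_square)
  have "p ^ 1 \<le> p ^ (m - 1)" using m p_pos by (intro power_increasing) auto
  then have "p * p \<le> p * p ^ (m - 1)" by (intro mult_le_mono2) simp
  then have "p * p \<le> Q" unfolding pm .
  then have pb: "p * b + p ^ 2 = Q"
    using pm by (simp add: b_def diff_mult_distrib2 power2_eq_square)
  have Qbig: "Q > 2 * p ^ 2 + 3"
  proof -
    have "p ^ 4 \<le> Q" unfolding Q_def using m p_pos by (intro power_increasing) auto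
    moreover have "2 ^ 2 * p ^ 2 \<le> p ^ 2 * p ^ 2" using p_ge_2 by (intro mult_right_mono power_mono) auto
    then have "4 * p ^ 2 \<le> p ^ 4" by (simp flip: power_add)
    moreover have "2 ^ 2 \<le> p ^ 2" using p_ge_2 by (intro power_mono) auto
    ultimately show ?thesis by simp
  qed
  define A where "A = ({..<a} \<times> {..<p}) \<times> ({..<b} \<times> {..<p})"
  define si where "si = (\<lambda>((i::nat,j::nat),(k::nat,l::nat)). Q * i + k)"
  define sj where "sj = (\<lambda>((i::nat,j::nat),(k::nat,l::nat)). Q * j + l)"
  \<comment> \<open>\<open>E\<close> is the \<open>Q\<close>-th power of the monomial with exponents \<open>si\<close> and \<open>sj\<close>, evaluated at points where
    \<open>x ^ (Q * Q) = x\<close> and \<open>v ^ (Q * Q) = v + t * x\<close>. Its weight is low enough for a linear relation by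
    counting, whereas the monomials themselves have distinct weights and hence are independent.\<close>
  define E where "E = (\<lambda>((i,j),(k,l)). (xx ^ k * vv ^ l) ^ Q * (xx ^ i * (vv + of_int t * xx) ^ j))"
  \<comment> \<open>\<open>E z\<close> has weight at most
    \<open>Q * weight k l + weight i j\<close>, where \<open>weight k l \<le> Q - 1\<close> and
    \<open>weight i j < p * a + p ^ 2\<close>.\<close>
  define W where "W = Q * (Q - 1) + p * a + p ^ 2"
  have Q0: "Q > 0" using p_pos by (simp add: Q_def)
  have wtb: "weight k l < p * b + p ^ 2" if "k < b" "l < p" for b k l
  proof -
    have "p * k + (p + 1) * l \<le> p * (b - 1) + (p + 1) * (p - 1)"
      using that by (intro add_mono mult_left_mono) auto
    also have "\<dots> < p * b + p ^ 2"
    proof -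
      have "p * (b - 1) + p = p * b" using that(1) by (cases b) auto
      moreover have "(p + 1) * (p - 1) + 1 = p ^ 2"
        using p_pos by (cases p) (auto simp: power2_eq_square)
      ultimately show ?thesis using p_pos by linarith
    qed
    finally show ?thesis by (simp add: weight_def)
  qed
  have finA: "finite A" by (simp add: A_def)
  have cardA: "card A > W"
  proof -
    have cA: "card A = (Q + 2 * p ^ 2) * (p * b)"
      by (simp add: A_def card_cartesian_product mult_ac flip: pa)
    define z where "z = p ^ 2"
    obtain r where r: "Q = 2 * z + 3 + Suc r" using Qbig less_iff_Suc_add[of "2 * z + 3" Q] by (auto simp: z_def)
    have z: "z > 0" using p_pos by (simp add: z_def)
    have "p * b = z + 3 + Suc r" using pb r by (simp add: z_def)
    then have "card A = (2 * z + 3 + Suc r + 2 * z) * (z + 3 + Suc r)"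
      by (simp add: cA z_def r)
    moreover have "W = (2 * z + 3 + Suc r) * (2 * z + 3 + r) + (2 * z + 3 + Suc r + 2 * z) + z"
      by (simp add: W_def pa r flip: z_def)
    ultimately show ?thesis using z by (simp add: algebra_simps)
  qed
  have weight_split: "weight (Q * i + k) (Q * j + l) = Q * weight i j + weight k l" for i j k l
    by (simp add: weight_def algebra_simps)
  have wtQ: "weight k l < Q" if "k < b" "l < p" for k l
    using wtb[OF that] pb by simp
  have E_weight_span: "E z \<in> weight_span W" if z: "z \<in> A" for z
  proof -
    obtain i j k l where ijkl: "z = ((i,j),(k,l))" "i < a" "j < p" "k < b" "l < p"
      using z by (auto simp: A_def)
    have pw: "xx ^ (Q * k) = (xx ^ k) ^ Q" "vv ^ (Q * l) = (vv ^ l) ^ Q"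
      by (simp_all only: power_mult[symmetric] mult.commute)
    have "(vv + of_int t * xx) ^ j = (\<Sum>r\<le>j. of_nat (j choose r) * vv ^ r * (of_int t * xx) ^ (j - r))"
      by (rule binomial_ring)
    then have "E z = (\<Sum>r\<le>j. (xx ^ k * vv ^ l) ^ Q * (xx ^ i * (of_nat (j choose r) * vv ^ r * (of_int t * xx) ^ (j - r))))"
      by (simp only: E_def ijkl(1) prod.case sum_distrib_left)
    also have "\<dots> = (\<Sum>r\<le>j. of_int (int (j choose r) * t ^ (j - r)) * (xx ^ (Q * k + i + (j - r)) * vv ^ (Q * l + r)))"
      by (intro sum.cong refl)
        (simp only: power_add pw power_mult_distrib of_int_mult of_int_power of_int_of_nat_eq mult_ac)
    also have "\<dots> \<in> weight_span W"
    proof (intro weight_span_sum weight_span_scale mono_weight_span)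
      fix r assume r: "r \<in> {..j}"
      have "weight (Q * k + i + (j - r)) (Q * l + r) = Q * weight k l + (p * i + p * (j - r) + (p + 1) * r)"
        by (simp add: weight_def algebra_simps)
      also have "p * i + p * (j - r) + (p + 1) * r \<le> weight i j"
      proof -
        obtain u where "j = r + u" using r le_Suc_ex by auto
        then show ?thesis by (simp add: weight_def algebra_simps)
      qed
      also have "Q * weight k l + weight i j < Q * (Q - 1) + (p * a + p ^ 2)"
        using wtQ[OF ijkl(4,5)] by (intro add_le_less_mono mult_left_mono wtb ijkl) auto
      finally show "weight (Q * k + i + (j - r)) (Q * l + r) < W" by (simp add: W_def)
    qed
    finally show ?thesis .
  qed
  obtain s where s: "\<exists>z\<in>A. \<not> int p dvd s z" and sE: "(\<Sum>z\<in>A. of_int (s z) * E z) \<in> J0"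
    by (rule pigeonhole_weight_span[OF finA cardA E_weight_span])
  have weight_inj: "i = i' \<and> j = j'" if "weight i j = weight i' j'" "j < p" "j' < p" for i j i' j'
  proof -
    have "j = j'" using weight_mod[of i j] weight_mod[of i' j'] that by simp
    then show ?thesis using that(1) p_pos by (simp add: weight_def)
  qed
  \<comment> \<open>\<open>weight k l\<close> and \<open>weight i j\<close> are the remainder and
    the quotient of the total weight by \<open>Q\<close>, and a weight with second exponent below
    \<open>p\<close> determines both exponents.\<close>
  have inj: "inj_on (\<lambda>z. weight (si z) (sj z)) A"
  proof (rule inj_onI)
    fix z z' assume zz: "z \<in> A" "z' \<in> A" "weight (si z) (sj z) = weight (si z') (sj z')"
    obtain i j k l where z: "z = ((i,j),(k,l))" "i < a" "j < p" "k < b" "l < p"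
      using zz by (auto simp: A_def)
    obtain i' j' k' l' where z': "z' = ((i',j'),(k',l'))" "i' < a" "j' < p" "k' < b" "l' < p"
      using zz by (auto simp: A_def)
    have eq: "Q * weight i j + weight k l = Q * weight i' j' + weight k' l'"
      using zz(3) by (simp add: z(1) z'(1) si_def sj_def weight_split)
    from arg_cong[OF eq, of "\<lambda>w. w mod Q"] have "weight k l = weight k' l'"
      using wtQ z z' by simp
    moreover from this eq have "weight i j = weight i' j'" using Q0 by simp
    ultimately show "z = z'" using weight_inj z z' by blast
  qed
  define S where "S = (\<Sum>z\<in>A. of_int (s z) * (xx ^ si z * vv ^ sj z))"
  obtain z0 where z0: "z0 \<in> A" "\<not> int p dvd s z0"
    "S - of_int (s z0) * normal_mono (weight (si z0) (sj z0)) \<in> weight_span (weight (si z0) (sj z0))"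
    unfolding S_def by (rule leading_weight_span[OF finA s inj])
  define w where "w = weight (si z0) (sj z0)"
  obtain c where c: "S - of_int (s z0) * normal_mono w - (\<Sum>w'<w. of_int (c w') * normal_mono w') \<in> J0"
    using z0(3) unfolding weight_span_def w_def by blast
  define N where "N = of_int (s z0) * normal_mono w + (\<Sum>w'<w. of_int (c w') * normal_mono w')"
  have SN: "S - N \<in> J0" using c by (simp add: N_def diff_diff_eq)
  have N_deg: "degree N < p"
    unfolding N_def using degree_normal_mono p_pos
    by (intro degree_add_less degree_sum_less) (auto intro: le_less_trans[OF degree_mult_le])
  define j0 where "j0 = w mod p"
  have j0: "j0 < p" using p_pos by (simp add: j0_def)
  \<comment> \<open>Each \<open>v ^ p\<close> in the leading monomial is traded for
    \<open>x ^ (p + 1)\<close>, which has the same weight.\<close>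
  define i0 where "i0 = si z0 + (p + 1) * (sj z0 div p)"
  have w_eq: "w = weight i0 j0"
  proof -
    define u where "u = sj z0 div p"
    have "j0 = sj z0 mod p" by (simp add: j0_def w_def weight_mod)
    then have "sj z0 = p * u + j0" by (simp add: u_def)
    then have "w = p * si z0 + (p + 1) * (p * u + j0)" by (simp add: w_def weight_def)
    then show ?thesis by (simp add: weight_def i0_def u_def[symmetric] algebra_simps)
  qed
  define C where "C = coeff N j0"
  have coC: "coeff C i = s z0 * (if w = weight i j0 then 1 else 0) + (\<Sum>w'<w. c w' * (if w' = weight i j0 then 1 else 0))" for i
    by (simp add: C_def N_def of_int_poly coeff_sum coeff_normal_mono[OF j0])
  have wbound: "w \<le> p ^ (2 * m) + 3 * p ^ 2 * p ^ m"
  proof -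
    obtain i j k l where z: "z0 = ((i,j),(k,l))" "i < a" "j < p" "k < b" "l < p"
      using z0(1) by (auto simp: A_def)
    have "w = Q * weight i j + weight k l" by (simp add: w_def z(1) si_def sj_def weight_split)
    also have "\<dots> \<le> Q * weight i j + Q * 1" using wtQ[OF z(4,5)] by simp
    also have "\<dots> = Q * (weight i j + 1)" by simp
    also have "\<dots> \<le> Q * (p * a + p ^ 2)" using wtb[OF z(2,3)] by (intro mult_left_mono) auto
    also have "\<dots> = Q * Q + 3 * p ^ 2 * Q" unfolding pa by (simp add: algebra_simps)
    also have "\<dots> = p ^ (2 * m) + 3 * p ^ 2 * p ^ m" unfolding QQ by (simp add: Q_def)
    finally show ?thesis .
  qed
  show ?thesis
  proof (rule that[of C])
    have "coeff C i0 = s z0" unfolding coC using w_eq by (simp cong: sum.cong_simp)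
    then show C: "C \<notin> p_ideal" using z0(2) unfolding p_ideal_iff by metis
    have "coeff C (degree C) \<noteq> 0" using C p_ideal.zero_mem by auto
    then have "weight (degree C) j0 \<le> w"
      by (rule contrapos_np) (auto simp: coC intro!: sum.neutral)
    then show "p * degree C \<le> p ^ (2 * m) + 3 * p ^ 2 * p ^ m" using wbound by (simp add: weight_def)
  next
    fix P assume P: "P \<in> prime_polys" "degree P dvd 2 * m" "\<not> int p dvd coeff P 0"
      "[int (2 * m div degree P) * tau D P = t] (mod int p)"
    interpret J: cring_ideal_char "JP P" p by (rule JP_char)
    interpret I: cring_ideal_char "gen_ideal P" p by (rule ideal_char_gen_ideal)
    define q where "q = Q * Q"
    have q: "q = p ^ (2 * m)" by (simp add: q_def QQ)
    have m0: "2 * m > 0" using m by simp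
    note fr = frobenius_trace[OF P(1,2) m0 P(3) q]
    have "of_int (int (2 * m div degree P) * tau D P) * X - of_int t * X \<in> gen_ideal P"
      using I.of_int_cg[OF P(4)] I.mult_mem' unfolding I.cg_def by (simp only: left_diff_distrib[symmetric])
    from I.add_mem[OF fr(3)[of D] this]
    have tr: "(\<Sum>i<2 * m. X ^ (q + p ^ i) + of_int D * X ^ (q - p ^ i)) - of_int t * X \<in> gen_ideal P"
      by simp
    have v: "vv ^ q - (vv + of_int t * xx) \<in> JP P" by (rule frobenius_vv[OF tr fr(2) q])
    have xq: "J.cg (xx ^ q) xx"
      using const_mem_JP[OF fr(1)] by (simp add: J.cg_def xx_power) (simp add: xx_def)
    have "J.cg (S ^ Q) (\<Sum>z\<in>A. (of_int (s z) * (xx ^ si z * vv ^ sj z)) ^ Q)"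
      unfolding S_def Q_def by (rule J.frobenius_sum)
    also have "J.cg \<dots> (\<Sum>z\<in>A. of_int (s z) * E z)"
    proof (rule J.cg_sum)
      fix z assume "z \<in> A"
      then obtain i j k l where z: "z = ((i,j),(k,l))" by (auto simp: A_def)
      have "(of_int (s z) * (xx ^ si z * vv ^ sj z)) ^ Q =
        of_int (s z) ^ (p ^ m) * ((xx ^ k * vv ^ l) ^ Q * ((xx ^ q) ^ i * (vv ^ q) ^ j))"
        by (simp only: z si_def sj_def prod.case power_mult_distrib power_add q_def Q_def[symmetric]
            power_mult[symmetric] mult_ac)
      also have "J.cg \<dots> (of_int (s z) * ((xx ^ k * vv ^ l) ^ Q * (xx ^ i * (vv + of_int t * xx) ^ j)))"
        using v xq by (intro J.cg_mult J.cg_refl J.of_int_power_p J.cg_power) (auto simp: J.cg_def)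
      finally show "J.cg ((of_int (s z) * (xx ^ si z * vv ^ sj z)) ^ Q) (of_int (s z) * E z)"
        by (simp add: E_def z)
    qed
    finally have "S ^ Q \<in> JP P" using sE J0_subset_JP J.cg_mem by blast
    \<comment> \<open>\<open>JP P\<close> is not known to be radical, so no root of
      \<open>S ^ Q\<close> is taken; the power is raised to the exponent \<open>q\<close>, whose
      Frobenius map \<open>vanishing_coeffs\<close> can undo.\<close>
    then have "S ^ Q * (S ^ Q) ^ (Q - 1) \<in> JP P" by (rule J.mult_mem')
    also have "S ^ Q * (S ^ Q) ^ (Q - 1) = S ^ q"
      by (simp only: q_def power_mult power_Suc[symmetric] Suc_diff_1[OF Q0])
    finally have "S ^ q \<in> JP P" .
    moreover have "J.cg (S ^ q) (N ^ q)"
      using SN J0_subset_JP by (intro J.cg_power) (auto simp: J.cg_def)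
    ultimately have "N ^ q \<in> JP P" using J.cg_mem by blast
    from vanishing_coeffs[OF N_deg q this v fr(1)] show "C \<in> gen_ideal P"
      by (simp add: C_def coeffs_in_def)
  qed
qed

text \<open>Distinct prime divisors of \<open>C\<close> also divide its monic multiple modulo
  \<open>p\<close>, whose prime factors have total degree at most \<open>degree C\<close>.\<close>

lemma sum_degree_le:
  assumes "finite A" "A \<subseteq> prime_polys" "C \<notin> p_ideal" "\<And>P. P \<in> A \<Longrightarrow> C \<in> gen_ideal P"
  shows "(\<Sum>P\<in>A. degree P) \<le> degree C"
proof -
  obtain c C' where C': "lead_coeff C' = 1" "degree C' \<le> degree C" "C' - smult c C \<in> p_ideal"
    using monic_scaling[OF assms(3)] by metis
  have "C' \<in> gen_ideal P" if "P \<in> A" for P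
  proof -
    have "[:c:] * C \<in> gen_ideal P" by (rule gen_ideal_mult[OF assms(4)[OF that]])
    then show ?thesis using gen_ideal_cong[OF C'(3), of P] by simp
  qed
  then have sub: "(\<lambda>P. (P, 1)) ` A \<subseteq> prime_power_divs C'" using assms(2) by (auto simp: prime_power_divs_def)
  have "(\<Sum>P\<in>A. degree P) = (\<Sum>z\<in>(\<lambda>P. (P, 1::nat)) ` A. degree (fst z))"
    by (subst sum.reindex) (auto simp: inj_on_def)
  also have "\<dots> \<le> (\<Sum>z\<in>prime_power_divs C'. degree (fst z))"
    using prime_power_divs_sum[OF C'(1)] sub by (intro sum_mono2) auto
  also have "\<dots> = degree C'" using prime_power_divs_sum[OF C'(1)] by (simp add: case_prod_unfold)
  finally show ?thesis using C'(2) by simp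
qed

end

section \<open>Weil's bound for Kloosterman sums\<close>

lemma e_q_add: "e_q q (a + b) = e_q q a * e_q q b"
  by (simp add: e_q_def exp_add [symmetric] add_divide_distrib ring_distribs)

lemma e_q_0 [simp]: "e_q q 0 = 1"
  by (simp add: e_q_def)

lemma e_q_eq_1_iff: "q > 0 \<Longrightarrow> e_q q a = 1 \<longleftrightarrow> q dvd a"
proof -
  assume q: "q > 0"
  have "e_q q a = 1 \<longleftrightarrow> (\<exists>n. 2 * pi * of_int a / of_int q = of_int (2 * n) * pi)"
    unfolding e_q_def exp_eq_1 by (simp add: Re_divide_of_real)
  also have "\<dots> \<longleftrightarrow> (\<exists>n. real_of_int a = of_int (q * n))"
  proof -
    have "real_of_int q > 0" using q by simp
    then show ?thesis by (intro arg_cong[where f = Ex] ext) (auto simp: field_simps)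
  qed
  also have "\<dots> \<longleftrightarrow> q dvd a" by (simp only: of_int_eq_iff dvd_def)
  finally show ?thesis .
qed

lemma e_q_cong: "q > 0 \<Longrightarrow> [a = b] (mod q) \<Longrightarrow> e_q q a = e_q q b"
proof -
  assume q: "q > 0" and "[a = b] (mod q)"
  then have "q dvd a - b" by (simp add: cong_iff_dvd_diff)
  then have "e_q q (a - b) = 1" using e_q_eq_1_iff[OF q] by simp
  then show ?thesis using e_q_add[of q "a - b" b] by simp
qed

lemma norm_e_q [simp]: "norm (e_q q a) = 1"
  by (simp add: e_q_def)

lemma cnj_e_q: "cnj (e_q q a) = e_q q (- a)"
  by (simp add: e_q_def exp_cnj)

lemma e_q_power: "e_q q a ^ n = e_q q (int n * a)"
  by (induction n) (simp_all add: e_q_add [symmetric] ring_distribs)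

lemma e_q_orthogonal:
  assumes q: "q > 0"
  shows "(\<Sum>c\<in>{0..<int q}. e_q (int q) (c * k)) = (if int q dvd k then of_nat q else 0)"
proof -
  have "(\<Sum>c\<in>{0..<int q}. e_q (int q) (c * k)) = (\<Sum>c<q. e_q (int q) k ^ c)"
    by (rule sum.reindex_bij_witness[of _ int nat]) (auto simp: e_q_power)
  also have "\<dots> = (if int q dvd k then of_nat q else 0)"
  proof (cases "int q dvd k")
    case True
    then show ?thesis using e_q_eq_1_iff[of "int q" k] q by simp
  next
    case False
    then have "e_q (int q) k \<noteq> 1" using e_q_eq_1_iff[of "int q" k] q by simp
    moreover have "e_q (int q) k ^ q = 1"
      unfolding e_q_power using e_q_eq_1_iff[of "int q" "int q * k"] q by simp
    ultimately show ?thesis using False by (simp add: geometric_sum)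
  qed
  finally show ?thesis .
qed

lemma coeff_mult_0: "coeff (F * G :: 'a::comm_semiring_1 poly) 0 = coeff F 0 * coeff G 0"
  and coeff_mult_1: "coeff (F * G :: 'a::comm_semiring_1 poly) 1 = coeff F 0 * coeff G 1 + coeff F 1 * coeff G 0"
  by (simp_all add: coeff_mult)

text \<open>Reflection turns the two top coefficients into the two bottom ones, where the product
  formula is immediate.\<close>

lemma coeff_mult_pre_degree:
  fixes F G :: "int poly"
  assumes "lead_coeff F = 1" "lead_coeff G = 1" "degree F > 0" "degree G > 0"
  shows "coeff (F * G) (degree F + degree G - 1) = coeff F (degree F - 1) + coeff G (degree G - 1)"
proof -
  have r: "coeff (reflect_poly H) 1 = coeff H (degree H - 1)" "coeff (reflect_poly H) 0 = lead_coeff H"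
    if "degree H > 0" for H :: "int poly"
    using that by (auto simp: coeff_reflect_poly)
  have ne: "F \<noteq> 0" "G \<noteq> 0" using assms by auto
  then have d: "degree (F * G) = degree F + degree G" by (rule degree_mult_eq)
  have "coeff (F * G) (degree F + degree G - 1) = coeff (reflect_poly F * reflect_poly G) 1"
    using r(1)[of "F * G"] d assms(3) by (simp add: reflect_poly_mult)
  also have "\<dots> = coeff G (degree G - 1) + coeff F (degree F - 1)"
    unfolding coeff_mult_1 using r[of F] r[of G] assms by simp
  finally show ?thesis by simp
qed

section \<open>The character of the overview and its L-function\<close>

locale kloosterman = curve +
  assumes D: "\<not> int p dvd D"
begin

lemma p_int_pos: "int p > 0" using p_pos by simp

text \<open>Degree 0 is separate because natural subtraction would make \<open>tau\<close> read the
  coefficient 1 of the constant polynomial and spoil \<open>lam 1 = 1\<close>.\<close>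

definition lam :: "int poly \<Rightarrow> complex" where
  "lam F = (if int p dvd coeff F 0 then 0 else if degree F = 0 then 1 else e_q (int p) (tau D F))"

lemma p_dvd_mult: "int p dvd a * b \<longleftrightarrow> int p dvd a \<or> int p dvd b"
  using prime_p by (simp add: prime_dvd_mult_iff)

lemma degree_0_monic: "lead_coeff F = 1 \<Longrightarrow> degree F = 0 \<Longrightarrow> F = 1" for F :: "int poly"
  by (metis degree_0_id one_pCons)

lemma lam_one: "lam 1 = 1"
  using p_gt_1 by (simp add: lam_def)

lemma inv_power: "\<not> int p dvd a \<Longrightarrow> [a * a ^ (p - 2) = 1] (mod int p)"
proof -
  assume "\<not> int p dvd a"
  moreover have "p - 1 = Suc (p - 2)" using p_ge_2 by simp
  ultimately show ?thesis using fermat_int[OF prime_p, of a] by simp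
qed

text \<open>A sum over roots is additive. In coefficients, the one next to the top is additive for
  monic polynomials, and so is the logarithmic derivative
  \<open>coeff F 1 / coeff F 0\<close>.\<close>

lemma tau_mult:
  assumes "lead_coeff F = 1" "lead_coeff G = 1" "degree F > 0" "degree G > 0"
    "\<not> int p dvd coeff F 0" "\<not> int p dvd coeff G 0"
  shows "[tau D (F * G) = tau D F + tau D G] (mod int p)"
proof -
  have "F \<noteq> 0" "G \<noteq> 0" using assms by auto
  then have d: "degree (F * G) = degree F + degree G" by (rule degree_mult_eq)
  define f g where "f = coeff F 0" and "g = coeff G 0"
  define f1 g1 where "f1 = coeff F 1" and "g1 = coeff G 1"
  have "(f * g1 + f1 * g) * (f * g) ^ (p - 2) =
      (f * f ^ (p - 2)) * (g1 * g ^ (p - 2)) + (g * g ^ (p - 2)) * (f1 * f ^ (p - 2))"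
    by (simp add: power_mult_distrib algebra_simps)
  also have "[\<dots> = 1 * (g1 * g ^ (p - 2)) + 1 * (f1 * f ^ (p - 2))] (mod int p)"
    using assms by (intro cong_add cong_mult cong_refl inv_power) (auto simp: f_def g_def)
  finally have *: "[(f * g1 + f1 * g) * (f * g) ^ (p - 2) = g1 * g ^ (p - 2) + f1 * f ^ (p - 2)] (mod int p)"
    by simp
  have "tau D (F * G) = - ((coeff F (degree F - 1) + coeff G (degree G - 1)) + D * ((f * g1 + f1 * g) * (f * g) ^ (p - 2)))"
    unfolding tau_def d coeff_mult_pre_degree[OF assms(1-4)] coeff_mult_0 coeff_mult_1
    by (simp add: f_def g_def f1_def g1_def)
  also have "[\<dots> = - ((coeff F (degree F - 1) + coeff G (degree G - 1)) + D * (g1 * g ^ (p - 2) + f1 * f ^ (p - 2)))] (mod int p)"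
    by (intro cong_minus_minus_iff[THEN iffD2] cong_add cong_mult cong_refl *)
  also have "- ((coeff F (degree F - 1) + coeff G (degree G - 1)) + D * (g1 * g ^ (p - 2) + f1 * f ^ (p - 2))) = tau D F + tau D G"
    by (simp add: tau_def f_def g_def f1_def g1_def algebra_simps)
  finally show ?thesis .
qed

lemma lam_mult:
  assumes F: "lead_coeff F = 1" and G: "lead_coeff G = 1"
  shows "lam (F * G) = lam F * lam G"
proof (cases "int p dvd coeff F 0 \<or> int p dvd coeff G 0")
  case True
  then show ?thesis by (auto simp: lam_def coeff_mult_0)
next
  case False
  consider "degree F = 0" | "degree G = 0" | "degree F > 0" "degree G > 0" by auto
  then show ?thesis
  proof cases
    case 3
    have "F \<noteq> 0" "G \<noteq> 0" using assms by auto
    then have "degree (F * G) > 0" using 3 by (simp add: degree_mult_eq)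
    then show ?thesis
      using False 3 e_q_cong[OF p_int_pos tau_mult[OF F G 3]] by (simp add: lam_def coeff_mult_0 p_dvd_mult e_q_add)
  qed (use degree_0_monic[OF F] degree_0_monic[OF G] lam_one in auto)
qed

lemma lam_cong:
  assumes F: "lead_coeff F = 1" and G: "lead_coeff G = 1" and FG: "F - G \<in> p_ideal"
  shows "lam F = lam G"
proof -
  have c: "[coeff F i = coeff G i] (mod int p)" for i
    using FG by (simp add: p_ideal_iff cong_iff_dvd_diff)
  have le: "degree A \<le> degree B" if "lead_coeff A = 1" "A - B \<in> p_ideal" for A B
  proof (rule ccontr)
    assume "\<not> ?thesis"
    then have "coeff (A - B) (degree A) = 1" using that(1) by (simp add: coeff_eq_0)
    moreover have "int p dvd coeff (A - B) (degree A)" using that(2) unfolding p_ideal_iff ..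
    ultimately show False using p_gt_1 by simp
  qed
  have GF: "G - F \<in> p_ideal" using p_ideal.uminus_mem[OF FG] by simp
  have d: "degree F = degree G" using le[OF F FG] le[OF G GF] by simp
  have "[tau D F = tau D G] (mod int p)" unfolding tau_def d
    by (intro cong_minus_minus_iff[THEN iffD2] cong_add cong_mult cong_pow cong_refl c)
  moreover have "int p dvd coeff F 0 \<longleftrightarrow> int p dvd coeff G 0" using c[of 0] by (rule cong_dvd_iff)
  ultimately show ?thesis using e_q_cong[OF p_int_pos] d by (simp add: lam_def)
qed

lemma bij_monic_polys_1: "bij_betw (\<lambda>e. [:e, 1:]) {0..<int p} (monic_polys 1)"
proof (rule bij_betw_imageI)
  show "(\<lambda>e. [:e, 1:]) ` {0..<int p} = monic_polys 1"
  proof (intro equalityI subsetI)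
    fix F assume F: "F \<in> monic_polys 1"
    then have "F = [:coeff F 0, 1:]"
      by (intro poly_eqI) (auto simp: monic_polys_def coeff_pCons coeff_eq_0 split: nat.splits)
    then show "F \<in> (\<lambda>e. [:e, 1:]) ` {0..<int p}" using F by (auto simp: monic_polys_def)
  qed (use p_gt_1 in \<open>auto simp: monic_polys_def coeff_pCons split: nat.splits\<close>)
qed (auto simp: inj_on_def)

lemma bij_monic_polys_2: "bij_betw (\<lambda>(e, c). [:e, c, 1:]) ({0..<int p} \<times> {0..<int p}) (monic_polys 2)"
proof (rule bij_betw_imageI)
  show "(\<lambda>(e, c). [:e, c, 1:]) ` ({0..<int p} \<times> {0..<int p}) = monic_polys 2"
  proof (intro equalityI subsetI)
    fix F assume F: "F \<in> monic_polys 2"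
    then have "F = [:coeff F 0, coeff F 1, 1:]"
      by (intro poly_eqI) (auto simp: monic_polys_def coeff_pCons coeff_eq_0 numeral_2_eq_2 split: nat.splits)
    then show "F \<in> (\<lambda>(e, c). [:e, c, 1:]) ` ({0..<int p} \<times> {0..<int p})" using F
      by (intro image_eqI[of _ _ "(coeff F 0, coeff F 1)"]) (auto simp: monic_polys_def)
  qed (use p_gt_1 in \<open>auto simp: monic_polys_def coeff_pCons numeral_2_eq_2 split: nat.splits\<close>)
qed (auto simp: inj_on_def)

definition kl_sum :: complex where
  "kl_sum = (\<Sum>e\<in>{1..<int p}. e_q (int p) (- (e + D * e ^ (p - 2))))"

lemma char_sum_0: "char_sum lam 0 = 1"
proof -
  have "monic_polys 0 = {1}"
  proof (intro equalityI subsetI)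
    fix F assume "F \<in> monic_polys 0"
    then show "F \<in> {1}" using degree_0_monic[of F] monic_polys_monic[of F 0] by simp
  qed (use p_gt_1 in \<open>auto simp: monic_polys_def coeff_1\<close>)
  then show ?thesis by (simp add: char_sum_def lam_one)
qed

lemma not_dvd_small: "e \<in> {1..<int p} \<Longrightarrow> \<not> int p dvd e"
  by (auto dest: zdvd_imp_le)

lemma split_0: "{0..<int p} = insert 0 {1..<int p}"
  using p_pos by auto

lemma char_sum_1: "char_sum lam 1 = kl_sum"
proof -
  have "char_sum lam 1 = (\<Sum>e\<in>{0..<int p}. lam [:e, 1:])"
    unfolding char_sum_def by (rule sum.reindex_bij_betw[OF bij_monic_polys_1, symmetric])
  also have "\<dots> = (\<Sum>e\<in>{1..<int p}. lam [:e, 1:])"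
    unfolding split_0 by (simp add: lam_def)
  also have "\<dots> = kl_sum"
    unfolding kl_sum_def using not_dvd_small by (intro sum.cong refl) (simp add: lam_def tau_def)
  finally show ?thesis .
qed

text \<open>For fixed constant term \<open>e\<close> the phase is linear in the middle coefficient
  with slope \<open>- (1 + D / e)\<close>. The sum over that coefficient vanishes unless
  \<open>e\<close> is congruent to \<open>- D\<close>, which is a nonzero residue since
  \<open>p\<close> does not divide \<open>D\<close>.\<close>

lemma char_sum_2: "char_sum lam 2 = of_nat p"
proof -
  define u where "u e = - (1 + D * e ^ (p - 2))" for e
  define e0 where "e0 = (- D) mod int p"
  have root: "int p dvd u e \<longleftrightarrow> e = e0" if e: "e \<in> {1..<int p}" for e
  proof -
    have "\<not> int p dvd e" by (rule not_dvd_small[OF e])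
    then have "int p dvd u e \<longleftrightarrow> int p dvd e * (1 + D * e ^ (p - 2))"
      by (simp only: u_def dvd_minus_iff p_dvd_mult) simp
    also have "e * (1 + D * e ^ (p - 2)) = e + D * (e * e ^ (p - 2))" by (simp add: algebra_simps)
    also have "int p dvd \<dots> \<longleftrightarrow> int p dvd e + D * 1"
      by (intro cong_dvd_iff cong_add cong_mult cong_refl inv_power not_dvd_small[OF e])
    also have "\<dots> \<longleftrightarrow> [e = - D] (mod int p)" by (simp add: cong_iff_dvd_diff)
    also have "\<dots> \<longleftrightarrow> e = e0" using e by (simp add: cong_def e0_def)
    finally show ?thesis .
  qed
  have e0: "e0 \<in> {1..<int p}"
  proof -
    have "e0 \<noteq> 0" using D by (simp add: e0_def mod_eq_0_iff_dvd)
    moreover have "e0 \<ge> 0" "e0 < int p" using p_pos by (simp_all add: e0_def)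
    ultimately show ?thesis by simp
  qed
  have "char_sum lam 2 = (\<Sum>z\<in>{0..<int p} \<times> {0..<int p}. lam ((\<lambda>(e, c). [:e, c, 1:]) z))"
    unfolding char_sum_def by (rule sum.reindex_bij_betw[OF bij_monic_polys_2, symmetric])
  also have "\<dots> = (\<Sum>e\<in>{0..<int p}. \<Sum>c\<in>{0..<int p}. lam [:e, c, 1:])"
    by (simp add: sum.cartesian_product case_prod_unfold)
  also have "\<dots> = (\<Sum>e\<in>{1..<int p}. \<Sum>c\<in>{0..<int p}. lam [:e, c, 1:])"
    unfolding split_0 by (subst (1) sum.insert) (auto simp: lam_def)
  also have "\<dots> = (\<Sum>e\<in>{1..<int p}. \<Sum>c\<in>{0..<int p}. e_q (int p) (c * u e))"
    using not_dvd_small by (intro sum.cong refl) (simp add: lam_def tau_def u_def algebra_simps)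
  also have "\<dots> = (\<Sum>e\<in>{1..<int p}. if e = e0 then of_nat p else 0)"
    using root by (intro sum.cong refl) (simp add: e_q_orthogonal[OF p_pos])
  also have "\<dots> = of_nat p" using e0 by simp
  finally show ?thesis .
qed

text \<open>Adding \<open>T ^ (n - 1)\<close> permutes the polynomials and lowers \<open>tau\<close>
  by 1, because the coefficients 0 and 1 stay fixed for \<open>n \<ge> 3\<close>. Hence the sum
  equals itself times a nontrivial root of unity.\<close>

lemma char_sum_ge_3: "n \<ge> 3 \<Longrightarrow> char_sum lam n = 0"
proof -
  assume n: "n \<ge> 3"
  define sh where "sh F = reduce (F + monom 1 (n - 1))" for F
  have mon: "lead_coeff (F + monom 1 (n - 1)) = 1" "degree (F + monom 1 (n - 1)) = n" if F: "F \<in> monic_polys n" for F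
  proof -
    have "degree (monom (1::int) (n - 1)) < degree F" using F n by (simp add: degree_monom_eq monic_polys_def)
    then show "degree (F + monom 1 (n - 1)) = n" using F by (simp add: degree_add_eq_left monic_polys_def)
    then show "lead_coeff (F + monom 1 (n - 1)) = 1" using F n by (simp add: monic_polys_def)
  qed
  have into: "sh F \<in> monic_polys n" if "F \<in> monic_polys n" for F
    using reduce_in_monic_polys[OF mon(1)[OF that]] mon(2)[OF that] by (simp add: sh_def)
  have inj: "inj_on sh (monic_polys n)"
  proof (rule inj_onI)
    fix F G assume FG: "F \<in> monic_polys n" "G \<in> monic_polys n" "sh F = sh G"
    have "F - G = (F + monom 1 (n - 1) - sh F) - (G + monom 1 (n - 1) - sh G)" using FG(3) by simp
    also have "\<dots> \<in> p_ideal" unfolding sh_def by (intro p_ideal.diff_mem reduce_cong)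
    finally show "F = G" using monic_polys_eqI FG by blast
  qed
  have "sh ` monic_polys n = monic_polys n"
    using into by (intro endo_inj_surj finite_monic_polys inj) auto
  then have bij: "bij_betw sh (monic_polys n) (monic_polys n)" using inj by (simp add: bij_betw_def)
  have lamsh: "lam (sh F) = e_q (int p) (- 1) * lam F" if F: "F \<in> monic_polys n" for F
  proof -
    have "lam (sh F) = lam (F + monom 1 (n - 1))"
      unfolding sh_def using monic_polys_monic(1)[OF into[OF F]] mon(1)[OF F] reduce_cong'
      by (intro lam_cong) (auto simp: sh_def)
    moreover have "tau D (F + monom 1 (n - 1)) = - 1 + tau D F"
      unfolding tau_def mon(2)[OF F] using n monic_polys_monic(2)[OF F] by simp
    ultimately show ?thesis
      using n mon(2)[OF F] monic_polys_monic(2)[OF F] e_q_add[of "int p" "- 1" "tau D F"] by (simp add: lam_def)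
  qed
  have "char_sum lam n = (\<Sum>F\<in>monic_polys n. lam (sh F))"
    unfolding char_sum_def by (rule sum.reindex_bij_betw[OF bij, symmetric])
  also have "\<dots> = e_q (int p) (- 1) * char_sum lam n"
    unfolding char_sum_def sum_distrib_left by (intro sum.cong refl lamsh)
  finally have "(1 - e_q (int p) (- 1)) * char_sum lam n = 0" by (simp add: algebra_simps)
  moreover have "e_q (int p) (- 1) \<noteq> 1" using e_q_eq_1_iff[OF p_int_pos, of "- 1"] p_gt_1 by simp
  ultimately show ?thesis by simp
qed

text \<open>Newton's identities: as the L-function has degree 2, only three terms of the recurrence
  survive.\<close>

lemma prime_power_sum_power_sums:
  assumes ab: "\<alpha> + \<beta> = - kl_sum" "\<alpha> * \<beta> = of_nat p"
  shows "n > 0 \<Longrightarrow> prime_power_sum lam n = - (\<alpha> ^ n + \<beta> ^ n)"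
proof (induction n rule: less_induct)
  case (less n)
  have rec: "of_nat n * char_sum lam n = (\<Sum>k=1..n. prime_power_sum lam k * char_sum lam (n - k))" for n
    by (rule char_sum_recurrence) (use lam_mult lam_cong lam_one in auto)
  have kl_sum: "kl_sum = - (\<alpha> + \<beta>)" using ab(1) by simp
  consider "n = 1" | "n = 2" | "n \<ge> 3" using less.prems by linarith
  then show ?case
  proof cases
    case 1
    then show ?thesis using rec[of 1] by (simp add: char_sum_0 char_sum_1[simplified] kl_sum)
  next
    case 2
    have K1: "prime_power_sum lam 1 = kl_sum" using rec[of 1] by (simp add: char_sum_0 char_sum_1[simplified])
    have "{1..2} = {1, 2::nat}" by auto
    then have "2 * char_sum lam 2 = prime_power_sum lam 1 * char_sum lam 1 + prime_power_sum lam 2 * char_sum lam 0" using rec[of 2] by simp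
    then have "prime_power_sum lam 2 = 2 * of_nat p - kl_sum * kl_sum" unfolding char_sum_2 char_sum_0 char_sum_1 K1 by simp
    then show ?thesis using 2 ab(2)[symmetric] by (simp add: kl_sum power2_eq_square algebra_simps)
  next
    case 3
    have "0 = (\<Sum>k=1..n. prime_power_sum lam k * char_sum lam (n - k))" using rec[of n] char_sum_ge_3[OF 3] by simp
    also have "\<dots> = (\<Sum>k\<in>{n - 2, n - 1, n}. prime_power_sum lam k * char_sum lam (n - k))"
      using 3 by (intro sum.mono_neutral_right) (auto intro!: char_sum_ge_3)
    also have "\<dots> = prime_power_sum lam (n - 2) * of_nat p + (prime_power_sum lam (n - 1) * kl_sum + prime_power_sum lam n)"
    proof -
      have "n - 2 \<noteq> n - 1" "n - 2 \<noteq> n" "n - 1 \<noteq> n" "n - (n - 2) = 2" "n - (n - 1) = 1" using 3 by auto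
      then show ?thesis using char_sum_2 char_sum_1 char_sum_0 by simp
    qed
    finally have z: "0 = prime_power_sum lam (n - 2) * of_nat p + (prime_power_sum lam (n - 1) * kl_sum + prime_power_sum lam n)" .
    have "prime_power_sum lam n = (prime_power_sum lam (n - 2) * of_nat p + (prime_power_sum lam (n - 1) * kl_sum + prime_power_sum lam n))
        - prime_power_sum lam (n - 2) * of_nat p - prime_power_sum lam (n - 1) * kl_sum" by simp
    also have "\<dots> = - prime_power_sum lam (n - 2) * of_nat p - prime_power_sum lam (n - 1) * kl_sum"
      unfolding z[symmetric] by simp
    also have "\<dots> = (\<alpha> ^ (n - 2) + \<beta> ^ (n - 2)) * (\<alpha> * \<beta>) - (\<alpha> ^ (n - 1) + \<beta> ^ (n - 1)) * (\<alpha> + \<beta>)"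
    proof -
      have "prime_power_sum lam (n - 2) = - (\<alpha> ^ (n - 2) + \<beta> ^ (n - 2))" "prime_power_sum lam (n - 1) = - (\<alpha> ^ (n - 1) + \<beta> ^ (n - 1))"
        using less.IH[of "n - 2"] less.IH[of "n - 1"] 3 by simp_all
      then show ?thesis unfolding ab(2) kl_sum by (simp only: minus_minus mult_minus_left mult_minus_right)
    qed
    also have "\<dots> = - (\<alpha> ^ n + \<beta> ^ n)"
    proof -
      define k where "k = n - 2"
      have "n = Suc (Suc k)" using 3 by (simp add: k_def)
      then show ?thesis by (simp add: algebra_simps)
    qed
    finally show ?thesis .
  qed
qed

text \<open>The number of points \<open>x \<noteq> 0\<close> over the field with \<open>p ^ n\<close> elements at which the trace of \<open>x + D / x\<close> to \<open>F_p\<close>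
is \<open>t\<close>: each \<open>P\<close> collects a Frobenius orbit.\<close>
definition trace_count :: "nat \<Rightarrow> int \<Rightarrow> nat" where
  "trace_count n t = (\<Sum>P | P \<in> prime_polys_dvd n \<and> \<not> int p dvd coeff P 0 \<and> (int (n div degree P) * tau D P) mod int p = t. degree P)"

lemma trace_count_le:
  assumes m: "m \<ge> 4"
  shows "p * trace_count (2 * m) t \<le> p ^ (2 * m) + 3 * p ^ 2 * p ^ m"
proof -
  obtain C where C: "C \<notin> p_ideal" "p * degree C \<le> p ^ (2 * m) + 3 * p ^ 2 * p ^ m"
    "\<And>P. P \<in> prime_polys \<Longrightarrow> degree P dvd 2 * m \<Longrightarrow> \<not> int p dvd coeff P 0 \<Longrightarrow>
       [int (2 * m div degree P) * tau D P = t] (mod int p) \<Longrightarrow> C \<in> gen_ideal P"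
    using auxiliary_polynomial[OF m] by metis
  have "trace_count (2 * m) t \<le> degree C"
    unfolding trace_count_def
  proof (intro sum_degree_le C)
    show "finite {P \<in> prime_polys_dvd (2 * m). \<not> int p dvd coeff P 0 \<and> int (2 * m div degree P) * tau D P mod int p = t}"
      by (rule finite_subset[OF _ finite_prime_polys_dvd[of "2 * m"]]) (use m in auto)
  qed (auto simp: prime_polys_dvd_def cong_def)
  then have "p * trace_count (2 * m) t \<le> p * degree C" by simp
  then show ?thesis using C(2) by linarith
qed

section \<open>From point counts to the absolute value of the roots\<close>

lemma finite_prime_polys_dvd_filter: "n > 0 \<Longrightarrow> finite {P. P \<in> prime_polys_dvd n \<and> Q P}"
  by (rule finite_subset[OF _ finite_prime_polys_dvd[of n]]) auto

lemma prime_power_sum_trace_count: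
  assumes n: "n > 0"
  shows "prime_power_sum lam n = (\<Sum>t\<in>{0..<int p}. of_nat (trace_count n t) * e_q (int p) t)"
proof -
  define g where "g P = (int (n div degree P) * tau D P) mod int p" for P
  have t: "of_nat (degree P) * lam P ^ (n div degree P) =
      (if \<not> int p dvd coeff P 0 then of_nat (degree P) * e_q (int p) (g P) else 0)" if P: "P \<in> prime_polys_dvd n" for P
  proof -
    have "n div degree P > 0" "degree P > 0"
      using P n prime_polys_degree[of P] by (auto simp: prime_polys_dvd_def div_greater_zero_iff dvd_imp_le)
    moreover have "e_q (int p) (g P) = e_q (int p) (int (n div degree P) * tau D P)"
      by (rule e_q_cong[OF p_int_pos]) (simp add: g_def cong_def)
    ultimately show ?thesis by (simp add: lam_def e_q_power)
  qed
  have "prime_power_sum lam n = (\<Sum>P\<in>prime_polys_dvd n. if \<not> int p dvd coeff P 0 then of_nat (degree P) * e_q (int p) (g P) else 0)"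
    unfolding prime_power_sum_def by (intro sum.cong refl t)
  also have "\<dots> = (\<Sum>P | P \<in> prime_polys_dvd n \<and> \<not> int p dvd coeff P 0. of_nat (degree P) * e_q (int p) (g P))"
    using finite_prime_polys_dvd[OF n] by (simp add: sum.inter_filter)
  also have "\<dots> = (\<Sum>t\<in>{0..<int p}. \<Sum>P | P \<in> {P. P \<in> prime_polys_dvd n \<and> \<not> int p dvd coeff P 0} \<and> g P = t. of_nat (degree P) * e_q (int p) (g P))"
    using p_pos by (intro sum.group[symmetric] finite_prime_polys_dvd_filter n) (auto simp: g_def)
  also have "\<dots> = (\<Sum>t\<in>{0..<int p}. of_nat (trace_count n t) * e_q (int p) t)"
    by (intro sum.cong refl) (simp add: trace_count_def g_def sum_distrib_right conj_assoc)
  finally show ?thesis .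
qed

lemma prime_polys_coeff_0:
  assumes P: "P \<in> prime_polys" "int p dvd coeff P 0"
  shows "P = X"
proof -
  have P0: "coeff P 0 = 0" 
  proof -
    have "coeff P 0 \<in> {0..<int p}" using prime_polys_monic_polys[OF P(1)] unfolding monic_polys_def by blast
    then show ?thesis using P(2) zdvd_imp_le[of "int p" "coeff P 0"] by fastforce
  qed
  obtain c P' where cP: "P = pCons c P'" by (cases P) auto
  then have XP: "P = X * P'" using P0 by (simp add: X_def)
  have P'0: "P' \<noteq> 0" using prime_polys_degree[OF P(1)] cP by auto
  have m': "lead_coeff P' = 1" using prime_polys_monic[OF P(1)] P'0 by (simp add: cP)
  have "P' \<notin> gen_ideal P"
  proof
    assume "P' \<in> gen_ideal P"
    then have "P' \<in> p_ideal" using gen_ideal_small_degree[OF prime_polys_monic[OF P(1)], of P'] P'0 by (simp add: cP)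
    then show False using monic_not_in_p_ideal[OF m'] by simp
  qed
  moreover have "X * P' \<in> gen_ideal P" using gen_ideal_self[of P] XP by simp
  ultimately have "X \<in> gen_ideal P" using prime_polys_prime[OF P(1)] by blast
  moreover have "X \<notin> p_ideal" by (rule monic_not_in_p_ideal) (simp add: X_def)
  ultimately have "\<not> degree X < degree P" using gen_ideal_small_degree[OF prime_polys_monic[OF P(1)], of X] by blast
  then have "degree P' = 0" using P'0 by (simp add: X_def cP)
  then have "P' = 1" using degree_0_monic[OF m'] by simp
  then show ?thesis using XP by simp
qed

text \<open>The 1 makes up for the point \<open>x = 0\<close>, that is for the prime polynomial
  \<open>X\<close>.\<close>

lemma sum_trace_count:
  assumes n: "n > 0"
  shows "(\<Sum>t\<in>{0..<int p}. trace_count n t) + 1 \<ge> p ^ n"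
proof -
  define g where "g P = (int (n div degree P) * tau D P) mod int p" for P
  have "p ^ n = (\<Sum>P\<in>prime_polys_dvd n. degree P)" by (simp add: sum_degree_prime_polys_dvd n)
  also have "prime_polys_dvd n = {P. P \<in> prime_polys_dvd n \<and> \<not> int p dvd coeff P 0} \<union> {P. P \<in> prime_polys_dvd n \<and> int p dvd coeff P 0}"
    by auto
  also have "(\<Sum>P\<in>\<dots>. degree P) = (\<Sum>P | P \<in> prime_polys_dvd n \<and> \<not> int p dvd coeff P 0. degree P)
      + (\<Sum>P | P \<in> prime_polys_dvd n \<and> int p dvd coeff P 0. degree P)"
    by (intro sum.union_disjoint finite_prime_polys_dvd_filter n) auto
  also have "(\<Sum>P | P \<in> prime_polys_dvd n \<and> int p dvd coeff P 0. degree P) \<le> (\<Sum>P\<in>{X}. degree P)"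
    by (rule sum_mono2) (auto simp: prime_polys_dvd_def dest: prime_polys_coeff_0)
  also have "\<dots> = 1" by (simp add: X_def)
  also have "(\<Sum>P | P \<in> prime_polys_dvd n \<and> \<not> int p dvd coeff P 0. degree P)
     = (\<Sum>t\<in>{0..<int p}. \<Sum>P | P \<in> {P. P \<in> prime_polys_dvd n \<and> \<not> int p dvd coeff P 0} \<and> g P = t. degree P)"
    using p_pos by (intro sum.group[symmetric] finite_prime_polys_dvd_filter n) (auto simp: g_def)
  also have "\<dots> = (\<Sum>t\<in>{0..<int p}. trace_count n t)"
    by (intro sum.cong refl) (simp add: trace_count_def g_def conj_assoc)
  finally show ?thesis by simp
qed

text \<open>Removing the mean from the counts is free, since the values of a nontrivial character
  sum to 0. The deviations are at most \<open>B\<close> and sum to at least -1, so their negative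
  parts are controlled by the positive ones.\<close>

lemma prime_power_sum_bound:
  assumes m: "m \<ge> 4"
  shows "norm (prime_power_sum lam (2 * m)) \<le> 7 * real p ^ 2 * real p ^ m"
proof -
  define n where "n = 2 * m"
  define u where "u t = real (trace_count n t) - real p ^ n / real p" for t
  define B where "B = 3 * real p * real p ^ m"
  have B0: "B \<ge> 0" by (simp add: B_def)
  have n0: "n > 0" using m by (simp add: n_def)
  have uB: "u t \<le> B" for t
  proof -
    have "real (p * trace_count n t) \<le> real (p ^ n + 3 * p ^ 2 * p ^ m)"
      using trace_count_le[OF m, of t] by (simp only: n_def of_nat_le_iff)
    then have "real p * real (trace_count n t) \<le> real p ^ n + real p * B"
      by (simp add: B_def power2_eq_square mult_ac)
    then show ?thesis using p_pos by (simp add: u_def field_simps)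
  qed
  have "real (p ^ n) \<le> real ((\<Sum>t\<in>{0..<int p}. trace_count n t) + 1)"
    using sum_trace_count[OF n0] by (simp only: of_nat_le_iff)
  then have su: "(\<Sum>t\<in>{0..<int p}. u t) \<ge> - 1"
    using p_pos by (simp add: u_def sum_subtractf)
  have "(\<Sum>t\<in>{0..<int p}. e_q (int p) t) = 0"
    using e_q_orthogonal[OF p_pos, of 1] p_gt_1 by simp
  then have "prime_power_sum lam n = (\<Sum>t\<in>{0..<int p}. of_real (u t) * e_q (int p) t)"
    unfolding prime_power_sum_trace_count[OF n0] u_def by (simp add: left_diff_distrib sum_subtractf flip: sum_distrib_left sum_divide_distrib)
  also have "norm \<dots> \<le> (\<Sum>t\<in>{0..<int p}. \<bar>u t\<bar>)"
    by (rule order.trans[OF norm_sum]) (simp add: norm_mult)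
  \<comment> \<open>For \<open>u t \<ge> 0\<close> this is \<open>u t \<le> B\<close>, and for
    \<open>u t < 0\<close> it is \<open>B \<ge> 0\<close>.\<close>
  also have "\<dots> \<le> (\<Sum>t\<in>{0..<int p}. 2 * B - u t)"
    using uB B0 by (intro sum_mono) (smt (verit))
  also have "\<dots> \<le> 2 * real p * B + 1"
    using su by (simp add: sum_subtractf)
  also have "\<dots> \<le> 7 * real p ^ 2 * real p ^ m"
  proof -
    have "1 \<le> real p ^ (2 + m)" using p_pos by (intro one_le_power) simp
    then have "1 \<le> real p ^ 2 * real p ^ m" by (simp only: power_add)
    then show ?thesis by (simp add: B_def power2_eq_square)
  qed
  finally show ?thesis by (simp add: n_def)
qed

text \<open>If \<open>\<alpha>\<close> exceeded \<open>sqrt p\<close>, then \<open>\<beta>\<close>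
  would lie below it, and the powers of \<open>norm \<alpha> ^ 2 / p\<close> would grow without
  bound, against the uniform bound just proved.\<close>

lemma root_bound:
  assumes ab: "\<alpha> + \<beta> = - kl_sum" "\<alpha> * \<beta> = of_nat p"
  shows "norm \<alpha> \<le> sqrt (real p)"
proof (rule ccontr)
  assume "\<not> ?thesis"
  then have a: "norm \<alpha> > sqrt (real p)" by simp
  have pp: "real p > 0" using p_pos by simp
  then have sp: "sqrt (real p) > 0" by simp
  have ab': "norm \<alpha> * norm \<beta> = sqrt (real p) * sqrt (real p)"
    using arg_cong[OF ab(2), of norm] pp by (simp add: norm_mult)
  have b: "norm \<beta> \<le> sqrt (real p)"
  proof (rule ccontr)
    assume "\<not> ?thesis"
    then have "sqrt (real p) * sqrt (real p) < norm \<alpha> * norm \<beta>"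
      using a sp by (intro mult_strict_mono) auto
    then show False using ab' by simp
  qed
  define r where "r = (norm \<alpha>)\<^sup>2 / real p"
  have "(sqrt (real p))\<^sup>2 < (norm \<alpha>)\<^sup>2" using a sp by (intro power_strict_mono) auto
  then have r: "r > 1" using pp by (simp add: r_def)
  have bound: "r ^ m \<le> 7 * real p ^ 2 + 1" if m: "m \<ge> 4" for m
  proof -
    have "norm \<alpha> ^ (2 * m) = norm (\<alpha> ^ (2 * m))" by (simp add: norm_power)
    also have "\<alpha> ^ (2 * m) = - prime_power_sum lam (2 * m) - \<beta> ^ (2 * m)"
      using prime_power_sum_power_sums[OF ab, of "2 * m"] m by simp
    also have "norm \<dots> \<le> norm (prime_power_sum lam (2 * m)) + norm (\<beta> ^ (2 * m))"
      by (metis norm_minus_cancel norm_triangle_ineq4)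
    also have "norm (\<beta> ^ (2 * m)) \<le> sqrt (real p) ^ (2 * m)"
      unfolding norm_power by (rule power_mono[OF b]) simp
    also have "\<dots> = real p ^ m" using pp by (simp add: power_mult)
    also have "norm (prime_power_sum lam (2 * m)) \<le> 7 * real p ^ 2 * real p ^ m" by (rule prime_power_sum_bound[OF m])
    finally have "norm \<alpha> ^ (2 * m) \<le> (7 * real p ^ 2 + 1) * real p ^ m"
      by (simp add: algebra_simps)
    then show ?thesis using pp by (simp add: r_def power_mult power_divide divide_le_eq)
  qed
  obtain k where k: "7 * real p ^ 2 + 1 < r ^ k" using real_arch_pow[OF r] by blast
  have "r ^ k \<le> r ^ (k + 4)" using r by (intro power_increasing) auto
  then show False using bound[of "k + 4"] k by simp
qed

lemma kl_sum_bound: "norm kl_sum \<le> 2 * sqrt (real p)"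
proof -
  define s where "s = csqrt (kl_sum\<^sup>2 - 4 * of_nat p)"
  define \<alpha> \<beta> where "\<alpha> = (- kl_sum + s) / 2" and "\<beta> = (- kl_sum - s) / 2"
  have sum: "\<alpha> + \<beta> = - kl_sum" by (simp add: \<alpha>_def \<beta>_def field_simps)
  have "\<alpha> * \<beta> = (kl_sum\<^sup>2 - s\<^sup>2) / 4" by (simp add: \<alpha>_def \<beta>_def power2_eq_square field_simps)
  then have prod: "\<alpha> * \<beta> = of_nat p" by (simp add: s_def)
  have "norm \<alpha> \<le> sqrt (real p)" by (rule root_bound[OF sum prod])
  moreover have "norm \<beta> \<le> sqrt (real p)"
    by (rule root_bound[of \<beta> \<alpha>]) (use sum prod in \<open>simp_all add: add.commute mult.commute\<close>)
  moreover have "norm kl_sum \<le> norm \<alpha> + norm \<beta>"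
    using norm_triangle_ineq[of \<alpha> \<beta>] sum by simp
  ultimately show ?thesis by simp
qed

end

text \<open>For \<open>b\<close> prime to \<open>p\<close>, the substitution
  \<open>e = - b * n\<close> turns the sum into \<open>kl_sum\<close> with \<open>D = a * b\<close>.
  Otherwise inversion permutes the nonzero residues, and the sum over them is -1.\<close>

lemma kloosterman_sum_bound:
  assumes p: "prime p" and a: "\<not> int p dvd a" and inv: "\<And>n. n \<in> {1..<int p} \<Longrightarrow> [n * v n = 1] (mod int p)"
  shows "norm (\<Sum>n\<in>{1..<int p}. e_q (int p) (a * v n + b * n)) \<le> 2 * sqrt (real p)"
proof -
  have p1: "p > 1" using prime_gt_1_nat[OF p] .
  have p0: "int p > 0" using p1 by simp
  have dvdm: "int p dvd x * y \<longleftrightarrow> int p dvd x \<or> int p dvd y" for x y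
    using p by (simp add: prime_dvd_mult_iff)
  have nd: "\<not> int p dvd n" if "n \<in> {1..<int p}" for n using that by (auto dest: zdvd_imp_le)
  have perm: "bij_betw (\<lambda>n. (c * n) mod int p) {1..<int p} {1..<int p}" if c: "\<not> int p dvd c" for c
  proof -
    have inj: "inj_on (\<lambda>n. (c * n) mod int p) {1..<int p}"
    proof (rule inj_onI)
      fix m n assume mn: "m \<in> {1..<int p}" "n \<in> {1..<int p}" "(c * m) mod int p = (c * n) mod int p"
      then have "int p dvd c * (m - n)" by (simp add: mod_eq_dvd_iff algebra_simps)
      then have "[m = n] (mod int p)" using c by (simp add: dvdm cong_iff_dvd_diff)
      then show "m = n" using mn by (auto simp: cong_def)
    qed
    have "(\<lambda>n. (c * n) mod int p) ` {1..<int p} \<subseteq> {1..<int p}"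
    proof
      fix y assume "y \<in> (\<lambda>n. (c * n) mod int p) ` {1..<int p}"
      then obtain n where n: "n \<in> {1..<int p}" "y = (c * n) mod int p" by blast
      have "y \<noteq> 0" using nd[OF n(1)] c n(2) dvdm[of c n] by (auto simp: mod_eq_0_iff_dvd)
      moreover have "y \<ge> 0" "y < int p" using n(2) p0 by auto
      ultimately show "y \<in> {1..<int p}" by simp
    qed
    then show ?thesis using inj endo_inj_surj[of "{1..<int p}"] by (simp add: bij_betw_def)
  qed
  have fer: "[n * n ^ (p - 2) = 1] (mod int p)" if "n \<in> {1..<int p}" for n
  proof -
    have "p - 1 = Suc (p - 2)" using p1 by simp
    then show ?thesis using fermat_int[OF p nd[OF that]] by simp
  qed
  show ?thesis
  proof (cases "int p dvd b")
    case False
    interpret kloosterman p "a * b"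
      by unfold_locales (use p a False dvdm in auto)
    have "kl_sum = (\<Sum>n\<in>{1..<int p}. (\<lambda>e. e_q (int p) (- (e + a * b * e ^ (p - 2)))) ((- b * n) mod int p))"
      unfolding kl_sum_def using perm[of "- b"] False by (intro sum.reindex_bij_betw[symmetric]) simp
    also have "\<dots> = (\<Sum>n\<in>{1..<int p}. e_q (int p) (a * v n + b * n))"
    proof (intro sum.cong refl)
      fix n assume n: "n \<in> {1..<int p}"
      define e where "e = (- b * n) mod int p"
      have e: "[e = - b * n] (mod int p)" by (simp add: e_def cong_def)
      have eU: "e \<in> {1..<int p}" using bij_betwE[OF perm[of "- b"]] n False by (simp add: e_def)
      have "e * (a * v n + a * b * e ^ (p - 2)) = a * (e * v n) + a * b * (e * e ^ (p - 2))"
        by (simp add: algebra_simps)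
      also have "[\<dots> = a * ((- b * n) * v n) + a * b * 1] (mod int p)"
        by (intro cong_add cong_mult cong_refl e fer eU)
      also have "a * ((- b * n) * v n) + a * b * 1 = (- a * b) * (n * v n) + a * b" by (simp add: algebra_simps)
      also have "[\<dots> = (- a * b) * 1 + a * b] (mod int p)" by (intro cong_add cong_mult cong_refl inv n)
      finally have "int p dvd e * (a * v n + a * b * e ^ (p - 2))" by (simp add: cong_0_iff)
      then have "[- (a * b * e ^ (p - 2)) = a * v n] (mod int p)"
        using nd[OF eU] by (simp add: dvdm cong_iff_dvd_diff) (metis dvd_minus_iff diff_minus_eq_add minus_diff_eq)
      moreover have "[- e = b * n] (mod int p)" using cong_minus_minus_iff[THEN iffD2, OF e] by simp
      ultimately have "[- e + - (a * b * e ^ (p - 2)) = b * n + a * v n] (mod int p)"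
        by (intro cong_add)
      then show "e_q (int p) (- ((- b * n) mod int p + a * b * ((- b * n) mod int p) ^ (p - 2))) = e_q (int p) (a * v n + b * n)"
        by (intro e_q_cong p0) (simp add: e_def add.commute)
    qed
    finally show ?thesis using kl_sum_bound by simp
  next
    case True
    have inj: "inj_on (\<lambda>n. v n mod int p) {1..<int p}"
    proof (rule inj_onI)
      fix m n assume mn: "m \<in> {1..<int p}" "n \<in> {1..<int p}" "v m mod int p = v n mod int p"
      have "[m * 1 = m * (n * v n)] (mod int p)" using inv[OF mn(2)] by (intro cong_mult cong_refl) (rule cong_sym)
      also have "[m * (n * v n) = m * (n * v m)] (mod int p)" using mn(3) by (intro cong_mult cong_refl) (simp add: cong_def)
      also have "m * (n * v m) = n * (m * v m)" by simp
      also have "[n * (m * v m) = n * 1] (mod int p)" by (intro cong_mult cong_refl inv mn)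
      finally show "m = n" using mn by (auto simp: cong_def)
    qed
    have "v n mod int p \<in> {1..<int p}" if n: "n \<in> {1..<int p}" for n
    proof -
      have "v n mod int p \<noteq> 0"
      proof
        assume "v n mod int p = 0"
        then have "int p dvd n * v n" by (simp add: mod_eq_0_iff_dvd)
        then have "int p dvd 1" using inv[OF n] by (simp add: cong_dvd_iff)
        then show False using p1 by simp
      qed
      moreover have "v n mod int p \<ge> 0" "v n mod int p < int p" using p0 by auto
      ultimately show ?thesis by simp
    qed
    then have "(\<lambda>n. v n mod int p) ` {1..<int p} \<subseteq> {1..<int p}" by blast
    then have bij: "bij_betw (\<lambda>n. v n mod int p) {1..<int p} {1..<int p}"
      using inj endo_inj_surj[of "{1..<int p}" "\<lambda>n. v n mod int p"] by (simp add: bij_betw_def)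
    have "(\<Sum>n\<in>{1..<int p}. e_q (int p) (a * v n + b * n)) = (\<Sum>n\<in>{1..<int p}. (\<lambda>c. e_q (int p) (c * a)) (v n mod int p))"
    proof (intro sum.cong refl)
      fix n
      have "[a * v n + b * n = a * (v n mod int p) + 0] (mod int p)"
        using True by (intro cong_add cong_mult cong_refl) (auto simp: cong_def)
      then show "e_q (int p) (a * v n + b * n) = e_q (int p) (v n mod int p * a)"
        by (intro e_q_cong p0) (simp add: mult.commute)
    qed
    also have "\<dots> = (\<Sum>c\<in>{1..<int p}. e_q (int p) (c * a))"
      by (rule sum.reindex_bij_betw[OF bij])
    also have "\<dots> = - 1"
    proof -
      have "{0..<int p} = insert 0 {1..<int p}" using p0 by auto
      then have "0 = 1 + (\<Sum>c\<in>{1..<int p}. e_q (int p) (c * a))"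
        using e_q_orthogonal[of p a] p1 a by simp
      then show ?thesis using eq_neg_iff_add_eq_0[of "\<Sum>c\<in>{1..<int p}. e_q (int p) (c * a)" 1] by (simp only: add.commute)
    qed
    finally have "norm (\<Sum>n\<in>{1..<int p}. e_q (int p) (a * v n + b * n)) = 1" by simp
    moreover have "sqrt (real p) \<ge> 1" using p1 by simp
    ultimately show ?thesis by linarith
  qed
qed

section \<open>Incomplete Kloosterman sums\<close>

text \<open>The Taylor error \<open>x ^ 3 / 6\<close> is at most \<open>2 * x / 3\<close> on this
  interval. The constant 1/3 is enough because it meets \<open>pi > 3\<close> below.\<close>

lemma sin_ge_third:
  fixes x :: real
  assumes "0 \<le> x" "x \<le> 2"
  shows "x / 3 \<le> sin x"
proof -
  have "\<bar>sin x - (\<Sum>m<3. sin_coeff m * x ^ m)\<bar> \<le> inverse (fact 3) * \<bar>x\<bar> ^ 3"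
    by (rule Maclaurin_sin_bound)
  then have "\<bar>sin x - x\<bar> \<le> x ^ 3 / 6"
    using assms(1) by (simp add: sin_coeff_def eval_nat_numeral)
  moreover have "x ^ 3 \<le> 4 * x"
  proof -
    have "x * (x * x) \<le> x * (2 * 2)" using assms by (intro mult_left_mono mult_mono) auto
    then show ?thesis by (simp add: power3_eq_cube mult_ac)
  qed
  ultimately show ?thesis by linarith
qed

lemma norm_e_q_minus_1_ge:
  assumes "0 < h" "h < q"
  shows "norm (e_q q h - 1) \<ge> 2 * min (real_of_int h) (real_of_int (q - h)) / real_of_int q"
proof -
  have q: "real_of_int q > 0" using assms by simp
  have e: "e_q q h = exp (\<i> * of_real (2 * (pi * of_int h / of_int q)))"
    by (simp add: e_q_def mult_ac)
  have n: "norm (e_q q h - 1) = 2 * \<bar>sin (pi * of_int h / of_int q)\<bar>"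
    unfolding e dist_exp_i_1 by simp
  have key: "real_of_int k / real_of_int q \<le> sin (pi * of_int k / of_int q)" if k: "0 < k" "2 * k \<le> q" for k
  proof -
    have x: "0 \<le> pi * of_int k / of_int q" "pi * of_int k / of_int q \<le> 2"
    proof -
      show "0 \<le> pi * of_int k / of_int q" using k q by simp
      have "pi * of_int k \<le> 4 * real_of_int k" using k pi_less_4 by (intro mult_right_mono) auto
      also have "\<dots> \<le> 2 * real_of_int q" using k(2) by linarith
      finally show "pi * of_int k / of_int q \<le> 2" using q by (simp add: field_simps)
    qed
    have "3 * real_of_int k \<le> pi * of_int k" using k pi_gt3 by (intro mult_right_mono) auto
    then have "real_of_int k / real_of_int q \<le> pi * of_int k / of_int q / 3"
      using q by (simp add: field_simps)
    also have "\<dots> \<le> sin (pi * of_int k / of_int q)" by (rule sin_ge_third[OF x])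
    finally show ?thesis .
  qed
  have "2 * h \<le> q \<or> 2 * (q - h) \<le> q" by presburger
  then consider "2 * h \<le> q" | "2 * (q - h) \<le> q" by blast
  then show ?thesis
  proof cases
    case 1
    have "min (real_of_int h) (real_of_int (q - h)) / real_of_int q \<le> real_of_int h / real_of_int q"
      using q by (intro divide_right_mono) auto
    then show ?thesis unfolding n using key[OF assms(1) 1] by linarith
  next
    case 2
    have "pi * real_of_int h / of_int q = pi - pi * of_int (q - h) / of_int q"
      using q by (simp add: field_simps)
    then have s: "sin (pi * of_int h / of_int q) = sin (pi * of_int (q - h) / of_int q)" by simp
    have "min (real_of_int h) (real_of_int (q - h)) / real_of_int q \<le> real_of_int (q - h) / real_of_int q"
      using q by (intro divide_right_mono) auto
    then show ?thesis unfolding n s using key[of "q - h"] 2 assms by linarith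
  qed
qed

lemma norm_geometric_e_q:
  assumes "0 < h" "h < q" "N \<ge> 0"
  shows "norm (\<Sum>n\<in>{1..N}. e_q q (- (h * n))) \<le> of_int q / of_int h + of_int q / of_int (q - h)"
proof -
  define z where "z = e_q q (- h)"
  have z1: "norm z = 1" by (simp add: z_def)
  define \<mu> where "\<mu> = min (real_of_int h) (real_of_int (q - h))"
  have \<mu>: "\<mu> > 0" and q: "real_of_int q > 0" using assms by (auto simp: \<mu>_def)
  have "norm (z - 1) = norm (cnj (e_q q h - 1))" by (simp add: z_def cnj_e_q)
  then have d: "norm (z - 1) \<ge> 2 * \<mu> / of_int q"
    unfolding complex_mod_cnj using norm_e_q_minus_1_ge[OF assms(1,2)] by (simp add: \<mu>_def)
  moreover have "2 * \<mu> / of_int q > 0" using \<mu> q by simp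
  ultimately have d0: "norm (z - 1) > 0" by linarith
  then have zne: "z \<noteq> 1" by auto
  have "(\<Sum>n\<in>{1..N}. e_q q (- (h * n))) = (\<Sum>n<nat N. z ^ Suc n)"
    by (rule sum.reindex_bij_witness[of _ "\<lambda>n. int (Suc n)" "\<lambda>n. nat (n - 1)"])
      (auto simp: z_def e_q_power mult_ac simp flip: power_Suc)
  also have "\<dots> = z * (\<Sum>n<nat N. z ^ n)" by (simp add: sum_distrib_left)
  also have "\<dots> = z * ((z ^ nat N - 1) / (z - 1))" using zne by (simp add: geometric_sum)
  also have "norm \<dots> = norm (z ^ nat N - 1) / norm (z - 1)" by (simp add: norm_mult norm_divide z1)
  also have "\<dots> \<le> 2 / (2 * \<mu> / of_int q)"
  proof (rule frac_le)
    have "norm (z ^ nat N - 1) \<le> norm (z ^ nat N) + norm (1 :: complex)" by (rule norm_triangle_ineq4)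
    then show "norm (z ^ nat N - 1) \<le> 2" by (simp add: norm_power z1)
  qed (use d \<mu> q in auto)
  also have "\<dots> = of_int q / \<mu>" using \<mu> q by simp
  \<comment> \<open>The sum of both reciprocals replaces the larger one, so that summation over
    \<open>h\<close> yields two equal harmonic sums.\<close>
  also have "\<dots> \<le> of_int q / of_int h + of_int q / of_int (q - h)"
    using assms by (auto simp: \<mu>_def min_def)
  finally show ?thesis .
qed

lemma sum_inverse_le:
  assumes "q > 1"
  shows "(\<Sum>h\<in>{1..<int q}. 1 / real_of_int h) \<le> 1 + ln (real q)"
proof -
  have "(\<Sum>h\<in>{1..<int q}. 1 / real_of_int h) = (\<Sum>k=1..q-1. 1 / real k)"
    by (rule sum.reindex_bij_witness[of _ int nat]) auto
  also have "\<dots> = harm (Suc (q - 2))" using assms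
    by (simp add: harm_def inverse_eq_divide Suc_diff_Suc numeral_2_eq_2)
  also have "\<dots> \<le> 1 + ln (real (Suc (q - 2)))"
    using decseqD[OF decseq_harm_diff_ln, of 0 "q - 2"] by (simp add: harm_def)
  also have "\<dots> \<le> 1 + ln (real q)" using assms by simp
  finally show ?thesis .
qed

text \<open>Completion: the range of \<open>m\<close> is detected by additive characters. This
  changes \<open>b\<close> to \<open>b + h\<close> but leaves \<open>a\<close> prime to
  \<open>p\<close>, so Weil's bound applies for every \<open>h\<close>; the geometric sums
  \<open>G h\<close> contribute the logarithm.\<close>

lemma incomplete_kloosterman_bound:
  assumes p: "prime p" and a: "\<not> int p dvd a" and inv: "\<And>n. n \<in> {1..<int p} \<Longrightarrow> [n * v n = 1] (mod int p)"
    and N: "0 \<le> N" "N < int p"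
  shows "norm (\<Sum>m\<in>{1..N}. e_q (int p) (a * v m + b * m)) \<le> sqrt (real p) * (6 + 4 * ln (real p))"
proof -
  have p1: "p > 1" using prime_gt_1_nat[OF p] .
  define U where "U = {1..<int p}"
  define F where "F m = e_q (int p) (a * v m + b * m)" for m
  define G where "G h = (\<Sum>n\<in>{1..N}. e_q (int p) (- (h * n)))" for h
  define K where "K h = (\<Sum>m\<in>U. e_q (int p) (a * v m + (b + h) * m))" for h
  have sub: "{1..N} \<subseteq> U" using N by (auto simp: U_def)
  have orth: "(\<Sum>h\<in>{0..<int p}. e_q (int p) (h * (m - n))) = (if m = n then of_nat p else 0)"
    if "m \<in> U" "n \<in> U" for m n
  proof -
    have "int p dvd m - n \<longleftrightarrow> m = n" using that by (auto simp: U_def mod_eq_dvd_iff[symmetric])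
    then show ?thesis using e_q_orthogonal[of p "m - n"] p1 by simp
  qed
  have "of_nat p * (\<Sum>m\<in>{1..N}. F m) = (\<Sum>n\<in>{1..N}. \<Sum>m\<in>U. if m = n then of_nat p * F m else 0)"
    using sub by (simp add: sum_distrib_left U_def subset_iff)
  also have "\<dots> = (\<Sum>n\<in>{1..N}. \<Sum>m\<in>U. \<Sum>h\<in>{0..<int p}. e_q (int p) (h * (m - n)) * F m)"
    using sub by (intro sum.cong refl) (auto simp: orth simp flip: sum_distrib_right)
  also have "\<dots> = (\<Sum>h\<in>{0..<int p}. \<Sum>n\<in>{1..N}. \<Sum>m\<in>U. e_q (int p) (h * (m - n)) * F m)"
    by (subst sum.swap[of _ "{0..<int p}"], subst sum.swap[of _ "{0..<int p}"]) simp
  also have "\<dots> = (\<Sum>h\<in>{0..<int p}. G h * K h)"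
  proof (intro sum.cong refl)
    fix h
    have "G h * K h = (\<Sum>n\<in>{1..N}. \<Sum>m\<in>U. e_q (int p) (- (h * n)) * e_q (int p) (a * v m + (b + h) * m))"
      by (simp add: G_def K_def sum_product)
    also have "\<dots> = (\<Sum>n\<in>{1..N}. \<Sum>m\<in>U. e_q (int p) (h * (m - n)) * F m)"
      by (intro sum.cong refl) (simp add: F_def e_q_add[symmetric] algebra_simps)
    finally show "(\<Sum>n\<in>{1..N}. \<Sum>m\<in>U. e_q (int p) (h * (m - n)) * F m) = G h * K h" ..
  qed
  finally have id: "of_nat p * (\<Sum>m\<in>{1..N}. F m) = (\<Sum>h\<in>{0..<int p}. G h * K h)" .
  have Kb: "norm (K h) \<le> 2 * sqrt (real p)" for h
    unfolding K_def U_def by (rule kloosterman_sum_bound[OF p a inv])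
  have split: "{0..<int p} = insert 0 U" "0 \<notin> U" "finite U" using p1 by (auto simp: U_def)
  have G0: "norm (G 0) \<le> real p" using N by (simp add: G_def)
  have "(\<Sum>h\<in>U. norm (G h)) \<le> (\<Sum>h\<in>U. real p * (1 / of_int h) + real p * (1 / of_int (int p - h)))"
  proof (rule sum_mono)
    fix h assume "h \<in> U"
    then show "norm (G h) \<le> real p * (1 / of_int h) + real p * (1 / of_int (int p - h))"
      unfolding G_def using norm_geometric_e_q[of h "int p" N] N by (simp add: U_def)
  qed
  also have "\<dots> = real p * (\<Sum>h\<in>U. 1 / of_int h) + real p * (\<Sum>h\<in>U. 1 / of_int (int p - h))"
    by (simp only: sum.distrib sum_distrib_left)
  also have "(\<Sum>h\<in>U. 1 / real_of_int (int p - h)) = (\<Sum>h\<in>U. 1 / of_int h)"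
    by (rule sum.reindex_bij_witness[of _ "\<lambda>h. int p - h" "\<lambda>h. int p - h"]) (auto simp: U_def)
  also have "real p * (\<Sum>h\<in>U. 1 / of_int h) + real p * (\<Sum>h\<in>U. 1 / of_int h) \<le> real p * (1 + ln (real p)) + real p * (1 + ln (real p))"
    using sum_inverse_le[OF p1] by (intro add_mono mult_left_mono) (auto simp: U_def)
  finally have Gs: "(\<Sum>h\<in>{0..<int p}. norm (G h)) \<le> real p * (3 + 2 * ln (real p))"
    using split G0 by (simp add: algebra_simps)
  have "real p * norm (\<Sum>m\<in>{1..N}. F m) = norm (\<Sum>h\<in>{0..<int p}. G h * K h)"
    by (simp flip: id add: norm_mult)
  also have "\<dots> \<le> (\<Sum>h\<in>{0..<int p}. norm (G h) * (2 * sqrt (real p)))"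
    by (rule order.trans[OF norm_sum]) (auto simp: norm_mult intro!: sum_mono mult_left_mono Kb)
  also have "\<dots> = (\<Sum>h\<in>{0..<int p}. norm (G h)) * (2 * sqrt (real p))" by (rule sum_distrib_right[symmetric])
  also have "\<dots> \<le> (real p * (3 + 2 * ln (real p))) * (2 * sqrt (real p))"
    by (intro mult_right_mono Gs) auto
  also have "\<dots> = real p * (sqrt (real p) * (6 + 4 * ln (real p)))" by (simp add: algebra_simps)
  finally show ?thesis using p1 by (simp add: F_def)
qed

section \<open>A sieve bound\<close>

text \<open>A truncated Euler product. Adjoining a prime \<open>p\<close>, the multiples of
  \<open>p\<close> are \<open>p\<close> times members of the same set, so the new sum is at most the
  old one plus \<open>1 / p\<close> of itself.\<close>

lemma smooth_reciprocal_sum_le: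
  assumes "finite S" "\<And>r. r \<in> S \<Longrightarrow> prime (r :: nat)"
  shows "(\<Sum>n | n \<in> {1..N} \<and> (\<forall>r. prime r \<longrightarrow> r dvd n \<longrightarrow> r \<in> S). 1 / real n)
    \<le> (\<Prod>r\<in>S. 1 / (1 - 1 / real r))"
  using assms
proof (induction S rule: finite_induct)
  case empty
  have "{n. n \<in> {1..N} \<and> (\<forall>r. prime r \<longrightarrow> r dvd n \<longrightarrow> r \<in> {})} \<subseteq> {1}"
    using prime_factor_nat by fastforce
  then have "(\<Sum>n | n \<in> {1..N} \<and> (\<forall>r. prime r \<longrightarrow> r dvd n \<longrightarrow> r \<in> {}). 1 / real n) \<le> (\<Sum>n\<in>{1}. 1 / real n)"
    by (intro sum_mono2) auto
  then show ?case by simp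
next
  case (insert p S)
  have p: "prime p" using insert.prems by blast
  then have p1: "p > 1" by (rule prime_gt_1_nat)
  define A where "A = {n. n \<in> {1..N} \<and> (\<forall>r. prime r \<longrightarrow> r dvd n \<longrightarrow> r \<in> S)}"
  define B where "B = {n. n \<in> {1..N} \<and> (\<forall>r. prime r \<longrightarrow> r dvd n \<longrightarrow> r \<in> insert p S)}"
  have fin: "finite A" "finite B" by (simp_all add: A_def B_def)
  have sub: "B \<subseteq> A \<union> (\<lambda>m. p * m) ` B"
  proof
    fix n assume n: "n \<in> B"
    show "n \<in> A \<union> (\<lambda>m. p * m) ` B"
    proof (cases "p dvd n")
      case True
      then obtain m where m: "n = p * m" by (auto simp: dvd_def)
      have "m \<le> n" "m \<noteq> 0" using m p1 n by (auto simp: B_def)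
      then have "m \<in> {1..N}" using n by (auto simp: B_def)
      then have "m \<in> B" using n unfolding B_def m by simp
      then show ?thesis using m by blast
    qed (use n in \<open>auto simp: A_def B_def\<close>)
  qed
  have "(\<Sum>n\<in>B. 1 / real n) \<le> (\<Sum>n\<in>A \<union> (\<lambda>m. p * m) ` B. 1 / real n)"
    using fin sub by (intro sum_mono2) auto
  also have "\<dots> \<le> (\<Sum>n\<in>A. 1 / real n) + (\<Sum>n\<in>(\<lambda>m. p * m) ` B. 1 / real n)"
    using fin by (subst sum.union_inter[symmetric]) (auto intro!: sum_nonneg)
  also have "(\<Sum>n\<in>(\<lambda>m. p * m) ` B. 1 / real n) = (\<Sum>m\<in>B. 1 / real m) / real p"
    using p1 by (subst sum.reindex) (auto simp: inj_on_def sum_divide_distrib mult.commute)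
  finally have "(1 - 1 / real p) * (\<Sum>n\<in>B. 1 / real n) \<le> (\<Sum>n\<in>A. 1 / real n)"
    by (simp add: algebra_simps)
  also have "\<dots> \<le> (\<Prod>r\<in>S. 1 / (1 - 1 / real r))"
    unfolding A_def using insert.IH insert.prems by blast
  finally have "(\<Sum>n\<in>B. 1 / real n) \<le> (\<Prod>r\<in>S. 1 / (1 - 1 / real r)) / (1 - 1 / real p)"
    using p1 by (simp add: pos_le_divide_eq mult.commute)
  also have "\<dots> = (\<Prod>r\<in>insert p S. 1 / (1 - 1 / real r))" using insert by simp
  finally show ?case by (simp only: B_def)
qed

section \<open>Chebyshev and Mertens type bounds in dyadic blocks\<close>

definition primes_upto :: "nat \<Rightarrow> nat set" where "primes_upto J = {r. prime r \<and> r \<le> 2 ^ J}"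
definition primes_block :: "nat \<Rightarrow> nat set" where "primes_block j = {r. prime r \<and> 2 ^ j < r \<and> r \<le> 2 ^ Suc j}"

lemma finite_primes_upto [simp]: "finite (primes_upto J)" and finite_primes_block [simp]: "finite (primes_block j)"
  unfolding primes_upto_def primes_block_def by simp_all

lemma primes_upto_Suc: "primes_upto (Suc J) = primes_upto J \<union> primes_block J" "primes_upto J \<inter> primes_block J = {}"
proof -
  have le: "(2::nat) ^ J \<le> 2 ^ Suc J" by simp
  show "primes_upto (Suc J) = primes_upto J \<union> primes_block J"
    unfolding primes_upto_def primes_block_def using order_trans[OF _ le] by (auto simp del: power_Suc)
qed (auto simp: primes_upto_def primes_block_def)

text \<open>Euler's argument: the product dominates the harmonic sum up to
  \<open>2 ^ J\<close>.\<close>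

lemma ln_le_primes_upto_prod: "J * ln 2 \<le> (\<Prod>r\<in>primes_upto J. 1 / (1 - 1 / real r))"
proof -
  have "J * ln 2 = ln (real (2 ^ J))" by (simp add: ln_realpow)
  also have "\<dots> \<le> ln (real (2 ^ J) + 1)" by (subst ln_le_cancel_iff) (auto simp: add_pos_pos)
  also have "\<dots> \<le> harm (2 ^ J)" by (rule ln_le_harm)
  also have "\<dots> = (\<Sum>n=1..2 ^ J. 1 / real n)" by (simp add: harm_def inverse_eq_divide)
  also have "{1..2 ^ J} = {n. n \<in> {1..2 ^ J} \<and> (\<forall>r. prime r \<longrightarrow> r dvd n \<longrightarrow> r \<in> primes_upto J)}"
  proof -
    have "r \<in> primes_upto J" if "n \<in> {1..2 ^ J}" "prime r" "r dvd n" for n r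
      using dvd_imp_le[OF that(3)] that(1,2) by (simp add: primes_upto_def)
    then show ?thesis by blast
  qed
  also have "(\<Sum>n\<in>\<dots>. 1 / real n) \<le> (\<Prod>r\<in>primes_upto J. 1 / (1 - 1 / real r))"
    by (rule smooth_reciprocal_sum_le) (auto simp: primes_upto_def)
  finally show ?thesis .
qed

lemma prod_primes_dvd:
  assumes "finite S" "\<And>r. r \<in> S \<Longrightarrow> prime (r :: nat)" "\<And>r. r \<in> S \<Longrightarrow> r dvd n"
  shows "\<Prod>S dvd n"
  using assms
proof (induction S rule: finite_induct)
  case (insert p S)
  have "coprime p (\<Prod>S)"
  proof (rule prod_coprime_right)
    fix r assume "r \<in> S"
    then show "coprime p r" using insert.prems(1) insert.hyps(2) by (intro primes_coprime) auto
  qed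
  then show ?case using insert by (auto intro: divides_mult)
qed simp

text \<open>Chebyshev: the primes between \<open>n\<close> and \<open>2 * n\<close> divide the
  central binomial coefficient, which is at most \<open>2 ^ (2 * n)\<close>; here
  \<open>n = 2 ^ j\<close>.\<close>

lemma card_primes_block: "j * card (primes_block j) \<le> 2 ^ Suc j"
proof -
  define n :: nat where "n = 2 ^ j"
  have "r dvd (2 * n choose n)" if r: "r \<in> primes_block j" for r
  proof -
    have r': "prime r" "n < r" "r \<le> 2 * n" using r by (auto simp: primes_block_def n_def)
    have "fact n * fact n * (2 * n choose n) = (fact (2 * n) :: nat)"
      using binomial_fact_lemma[of n "2 * n"] by (simp add: mult_2)
    moreover have "r dvd fact (2 * n)" using r' by (simp add: prime_dvd_fact_iff)
    moreover have "\<not> r dvd fact n" using r' by (simp add: prime_dvd_fact_iff)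
    ultimately show ?thesis using r'(1) by (metis prime_dvd_mult_iff)
  qed
  then have "\<Prod>(primes_block j) dvd (2 * n choose n)"
    by (intro prod_primes_dvd) (auto simp: primes_block_def)
  then have "\<Prod>(primes_block j) \<le> (2 * n choose n)" by (rule dvd_imp_le) simp
  also have "\<dots> \<le> 2 ^ (2 * n)" by (rule binomial_le_pow2)
  finally have 1: "\<Prod>(primes_block j) \<le> 2 ^ (2 * n)" .
  have "2 ^ (j * card (primes_block j)) = (\<Prod>r\<in>primes_block j. 2 ^ j :: nat)" by (simp add: power_mult)
  also have "\<dots> \<le> \<Prod>(primes_block j)" by (rule prod_mono) (auto simp: primes_block_def)
  finally have "(2::nat) ^ (j * card (primes_block j)) \<le> 2 ^ (2 * n)" using 1 by linarith
  then have "j * card (primes_block j) \<le> 2 * n" by (subst (asm) power_increasing_iff) auto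
  then show ?thesis by (simp add: n_def)
qed

lemma primes_block_prod_le:
  assumes "j > 0"
  shows "(\<Prod>r\<in>primes_block j. 1 / (1 - 1 / real r)) \<le> exp (4 / real j)"
proof -
  have each: "1 / (1 - 1 / real r) \<le> exp (2 / 2 ^ j)" if r: "r \<in> primes_block j" for r
  proof -
    have "real (2 ^ j) < real r" using r by (simp only: primes_block_def of_nat_less_iff mem_Collect_eq)
    then have rj: "real r > 2 ^ j" by simp
    have "(2::real) ^ 1 \<le> 2 ^ j" using assms by (intro power_increasing) auto
    then have r2: "real r > 2" using rj unfolding power_one_right by linarith
    have "1 / (1 - 1 / real r) = 1 + 1 / (real r - 1)" using r2 by (simp add: field_simps)
    also have "1 / (real r - 1) \<le> 2 / real r" using r2 by (simp add: field_simps)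
    also have "2 / real r \<le> 2 / 2 ^ j" using rj by (intro divide_left_mono) auto
    also have "1 + 2 / 2 ^ j \<le> exp (2 / 2 ^ j :: real)" by (rule exp_ge_add_one_self)
    finally show ?thesis by simp
  qed
  have "(\<Prod>r\<in>primes_block j. 1 / (1 - 1 / real r)) \<le> (\<Prod>r\<in>primes_block j. exp (2 / 2 ^ j))"
    using each by (intro prod_mono) (auto simp: primes_block_def dest: prime_gt_1_nat)
  also have "\<dots> = exp (real (card (primes_block j)) * (2 / 2 ^ j))" by (simp only: prod_constant exp_of_nat_mult)
  also have "\<dots> \<le> exp (4 / real j)"
  proof -
    have "real (j * card (primes_block j)) \<le> real (2 ^ Suc j)" using card_primes_block[of j] by (simp only: of_nat_le_iff)
    then have "real j * real (card (primes_block j)) \<le> 2 * 2 ^ j" by simp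
    then show ?thesis using assms by (simp add: field_simps)
  qed
  finally show ?thesis .
qed

lemma primes_upto_prod_pos: "(\<Prod>r\<in>primes_upto J. 1 / (1 - 1 / real r)) > 0"
  by (intro prod_pos) (auto simp: primes_upto_def dest: prime_gt_1_nat)

text \<open>The blocks contribute \<open>exp (4 / j)\<close> each, hence the fourth power of
  \<open>J\<close> where Mertens' theorem has the first. This is harmless, because it is applied
  only to \<open>J0\<close>, which is logarithmic in \<open>L\<close>.\<close>

lemma primes_upto_prod_le: "J > 0 \<Longrightarrow> (\<Prod>r\<in>primes_upto J. 1 / (1 - 1 / real r)) \<le> 2 * exp 4 * real J ^ 4"
proof -
  have main: "(\<Prod>r\<in>primes_upto (Suc k). 1 / (1 - 1 / real r)) \<le> 2 * exp (4 * harm k)" for k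
  proof (induction k)
    case 0
    have "r \<in> primes_upto (Suc 0) \<longleftrightarrow> r = 2" for r
    proof (cases "prime r")
      case True
      then show ?thesis using prime_ge_2_nat[OF True] by (auto simp: primes_upto_def)
    qed (auto simp: primes_upto_def)
    then have "primes_upto (Suc 0) = {2}" by blast
    then show ?case by (simp add: harm_def)
  next
    case (Suc k)
    have "(\<Prod>r\<in>primes_upto (Suc (Suc k)). 1 / (1 - 1 / real r))
      = (\<Prod>r\<in>primes_upto (Suc k). 1 / (1 - 1 / real r)) * (\<Prod>r\<in>primes_block (Suc k). 1 / (1 - 1 / real r))"
      unfolding primes_upto_Suc(1)[of "Suc k"] by (intro prod.union_disjoint primes_upto_Suc(2)) auto
    also have "\<dots> \<le> (2 * exp (4 * harm k)) * exp (4 / real (Suc k))"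
      using primes_upto_prod_pos by (intro mult_mono Suc primes_block_prod_le) (auto intro!: prod_nonneg simp: primes_block_def dest: prime_gt_1_nat)
    also have "\<dots> = 2 * exp (4 * harm (Suc k))"
      by (simp add: harm_Suc exp_add [symmetric] algebra_simps inverse_eq_divide)
    finally show ?case .
  qed
  assume J: "J > 0"
  have "harm (Suc (J - 1)) \<le> 1 + ln (real (Suc (J - 1)))"
    using decseqD[OF decseq_harm_diff_ln, of 0 "J - 1"] by (simp add: harm_def)
  then have h: "harm J \<le> 1 + ln (real J)" using J by simp
  have "harm (J - 1) \<le> (harm J :: real)" by (intro harm_mono) simp
  then have "exp (4 * harm (J - 1)) \<le> exp (4 + 4 * ln (real J))" using h by simp
  also have "\<dots> = exp 4 * exp (ln (real J)) ^ 4" using exp_of_nat_mult[of 4 "ln (real J)"] by (simp add: exp_add)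
  also have "\<dots> = exp 4 * real J ^ 4" using J by simp
  finally show ?thesis using main[of "J - 1"] J by simp
qed

text \<open>One prime at a time: the sieved integers divisible by \<open>p\<close> are
  \<open>p\<close> times the sieved integers up to \<open>x / p\<close>, so the error at most
  doubles.\<close>

lemma legendre_sieve:
  assumes "finite S" "\<And>r. r \<in> S \<Longrightarrow> prime (r :: nat)" "x \<ge> 0"
  shows "\<bar>real (card {n::nat. 1 \<le> n \<and> real n \<le> x \<and> (\<forall>r\<in>S. \<not> r dvd n)}) - x * (\<Prod>r\<in>S. 1 - 1 / real r)\<bar> \<le> 2 ^ card S"
  using assms
proof (induction S arbitrary: x rule: finite_induct)
  case empty
  have "{n::nat. 1 \<le> n \<and> real n \<le> x} = {1..nat \<lfloor>x\<rfloor>}" using empty by (auto simp: le_nat_iff le_floor_iff)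
  then have "card {n::nat. 1 \<le> n \<and> real n \<le> x} = nat \<lfloor>x\<rfloor>" by simp
  moreover have "\<lfloor>x\<rfloor> \<ge> 0" using empty by simp
  ultimately show ?case by simp linarith
next
  case (insert p S)
  have p: "prime p" using insert.prems by blast
  then have p1: "p > 1" by (rule prime_gt_1_nat)
  define C where "C x = {n::nat. 1 \<le> n \<and> real n \<le> x \<and> (\<forall>r\<in>S. \<not> r dvd n)}" for x
  have finC: "finite (C x)" for x
    by (rule finite_subset[of _ "{..nat \<lfloor>x\<rfloor>}"]) (auto simp: C_def intro: le_nat_floor)
  have im: "{n \<in> C x. p dvd n} = (\<lambda>m. p * m) ` C (x / p)"
  proof (intro equalityI subsetI)
    fix n assume n: "n \<in> {n \<in> C x. p dvd n}"
    then obtain m where m: "n = p * m" by (auto simp: dvd_def)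
    have "m \<in> C (x / p)" using n p1 by (auto simp: C_def m field_simps Suc_le_eq)
    then show "n \<in> (\<lambda>m. p * m) ` C (x / p)" using m by blast
  next
    fix n assume "n \<in> (\<lambda>m. p * m) ` C (x / p)"
    then obtain m where m: "n = p * m" "m \<in> C (x / p)" by blast
    have "\<not> r dvd p * m" if r: "r \<in> S" for r
    proof
      assume "r dvd p * m"
      moreover have "prime r" using r insert.prems by blast
      ultimately have "r dvd p" using m(2) r by (auto simp: C_def prime_dvd_mult_iff)
      then have "r = p" using p \<open>prime r\<close> by (simp add: primes_dvd_imp_eq)
      then show False using r insert.hyps by simp
    qed
    then show "n \<in> {n \<in> C x. p dvd n}" using m p1 by (auto simp: C_def field_simps Suc_le_eq)
  qed
  have "C x = {n \<in> C x. \<not> p dvd n} \<union> {n \<in> C x. p dvd n}" by auto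
  then have "card (C x) = card {n \<in> C x. \<not> p dvd n} + card {n \<in> C x. p dvd n}"
    using finC by (metis (no_types, lifting) card_Un_disjoint finite_Un mem_Collect_eq disjoint_iff)
  also have "card {n \<in> C x. p dvd n} = card (C (x / p))"
    unfolding im using p1 by (intro card_image) (auto simp: inj_on_def)
  finally have f1: "real (card {n \<in> C x. \<not> p dvd n}) = real (card (C x)) - real (card (C (x / p)))" by simp
  have seteq: "{n::nat. 1 \<le> n \<and> real n \<le> x \<and> (\<forall>r\<in>insert p S. \<not> r dvd n)} = {n \<in> C x. \<not> p dvd n}"
    by (auto simp: C_def)
  have f2: "\<bar>real (card (C x)) - x * (\<Prod>r\<in>S. 1 - 1 / real r)\<bar> \<le> 2 ^ card S"
    unfolding C_def using insert by auto
  have f3: "\<bar>real (card (C (x / p))) - x / p * (\<Prod>r\<in>S. 1 - 1 / real r)\<bar> \<le> 2 ^ card S"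
    unfolding C_def by (rule insert.IH) (use insert.prems in auto)
  have f4: "x * (\<Prod>r\<in>insert p S. 1 - 1 / real r) = x * (\<Prod>r\<in>S. 1 - 1 / real r) - x / p * (\<Prod>r\<in>S. 1 - 1 / real r)"
    using insert by (simp add: algebra_simps)
  have f5: "(2::real) ^ card (insert p S) = 2 ^ card S + 2 ^ card S" using insert by simp
  have ar: "\<bar>A - v\<bar> \<le> E" if "A = B - B'" "\<bar>B - u\<bar> \<le> e" "\<bar>B' - w\<bar> \<le> e" "v = u - w" "E = e + e"
    for A B B' u v w e E :: real using that by linarith
  show ?case unfolding seteq by (rule ar[OF f1 f2 f3 f4 f5])
qed

text \<open>The density is a quotient of two Euler products, bounded by Euler's argument at
  \<open>J1\<close> and by Chebyshev's at \<open>J0\<close>.\<close>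

lemma sieved_count_le:
  assumes J: "0 < J0" "J0 \<le> J1" and x: "x \<ge> 0"
  shows "real (card {n::nat. 1 \<le> n \<and> real n \<le> x \<and> (\<forall>r\<in>primes_upto J1 - primes_upto J0. \<not> r dvd n)})
    \<le> x * (2 * exp 4 * real J0 ^ 4 / (real J1 * ln 2)) + 2 ^ (2 ^ J1)"
proof -
  define S where "S = primes_upto J1 - primes_upto J0"
  define f where "f A = (\<Prod>r\<in>A. 1 - 1 / real r)" for A :: "nat set"
  have inv: "(\<Prod>r\<in>A. 1 / (1 - 1 / real r)) = 1 / f A" for A by (simp add: f_def prod_dividef)
  have "(2::nat) ^ J0 \<le> 2 ^ J1" using J by (intro power_increasing) auto
  then have "primes_upto J0 \<subseteq> primes_upto J1" unfolding primes_upto_def by (auto intro: order_trans)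
  then have "f (primes_upto J1) = f (primes_upto J0) * f S"
    unfolding f_def S_def by (subst prod.subset_diff[of "primes_upto J0" "primes_upto J1"]) (auto simp: mult.commute)
  moreover have pos: "f (primes_upto J) > 0" for J using primes_upto_prod_pos[of J] unfolding inv by simp
  ultimately have "f S = (1 / f (primes_upto J0)) * f (primes_upto J1)" using less_imp_neq[OF pos[of J0]] by simp
  also have "\<dots> \<le> (2 * exp 4 * real J0 ^ 4) * (1 / (real J1 * ln 2))"
  proof (rule mult_mono)
    show "1 / f (primes_upto J0) \<le> 2 * exp 4 * real J0 ^ 4" using primes_upto_prod_le[OF J(1)] by (simp add: inv)
    have "real J1 * ln 2 \<le> 1 / f (primes_upto J1)" using ln_le_primes_upto_prod[of J1] by (simp add: inv)
    moreover have "real J1 * ln 2 > 0" using J by simp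
    ultimately show "f (primes_upto J1) \<le> 1 / (real J1 * ln 2)" using pos[of J1] by (simp add: field_simps)
  qed (use pos[of J1] in auto)
  finally have fS: "f S \<le> 2 * exp 4 * real J0 ^ 4 / (real J1 * ln 2)" by simp
  have "card S \<le> card {1..(2::nat) ^ J1}"
    by (rule card_mono) (auto simp: S_def primes_upto_def Suc_le_eq prime_gt_0_nat)
  then have cS: "(2::real) ^ card S \<le> 2 ^ (2 ^ J1)" by (intro power_increasing) auto
  have "\<bar>real (card {n::nat. 1 \<le> n \<and> real n \<le> x \<and> (\<forall>r\<in>S. \<not> r dvd n)}) - x * f S\<bar> \<le> 2 ^ card S"
    unfolding f_def by (rule legendre_sieve) (auto simp: S_def primes_upto_def x)
  moreover have "x * f S \<le> x * (2 * exp 4 * real J0 ^ 4 / (real J1 * ln 2))"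
    by (rule mult_left_mono[OF fS x])
  ultimately show ?thesis using cS unfolding S_def by linarith
qed

section \<open>Sums of multiplicative functions and bilinear correlations\<close>

lemma sum_inverse_squares_le:
  assumes "0 < a"
  shows "(\<Sum>k\<in>{a<..b}. 1 / real k ^ 2) \<le> 1 / real a"
proof (cases "a \<le> b")
  case True
  have "(\<Sum>k\<in>{a<..b}. 1 / real k ^ 2) \<le> 1 / real a - 1 / real b"
    using True
  proof (induction b rule: dec_induct)
    case (step n)
    have n: "real n > 0" using step assms by simp
    have "{a<..Suc n} = insert (Suc n) {a<..n}" using step by auto
    then have "(\<Sum>k\<in>{a<..Suc n}. 1 / real k ^ 2) = 1 / real (Suc n) ^ 2 + (\<Sum>k\<in>{a<..n}. 1 / real k ^ 2)"
      by simp
    moreover have "1 / real (Suc n) ^ 2 \<le> 1 / real n - 1 / real (Suc n)"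
    proof -
      have "1 / real (Suc n) ^ 2 \<le> 1 / (real n * real (Suc n))"
        using n by (intro divide_left_mono) (auto simp: power2_eq_square intro!: mult_right_mono)
      also have "\<dots> = 1 / real n - 1 / real (Suc n)" using n by (simp add: field_simps)
      finally show ?thesis .
    qed
    ultimately show ?case using step.IH by linarith
  qed simp
  also have "\<dots> \<le> 1 / real a" by simp
  finally show ?thesis .
qed simp

lemma sum_primes_upto_blocks:
  fixes g :: "nat \<Rightarrow> 'a::comm_monoid_add"
  assumes "J0 \<le> J1"
  shows "(\<Sum>p\<in>primes_upto J1. g p) = (\<Sum>p\<in>primes_upto J0. g p) + (\<Sum>j=J0..<J1. \<Sum>p\<in>primes_block j. g p)"
  using assms
proof (induction J1 rule: dec_induct)
  case (step n)
  have "(\<Sum>p\<in>primes_upto (Suc n). g p) = (\<Sum>p\<in>primes_upto n. g p) + (\<Sum>p\<in>primes_block n. g p)"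
    unfolding primes_upto_Suc(1) by (intro sum.union_disjoint primes_upto_Suc(2)) auto
  then show ?case using step by (simp add: add.assoc)
qed simp

section \<open>Ramare's identity and Cauchy--Schwarz on dyadic blocks\<close>

locale ramare =
  fixes f F :: "nat \<Rightarrow> complex" and N J0 J1 :: nat
  assumes f_mult: "multiplicative f" and f_le: "\<And>n. norm (f n) \<le> 1" and F_le: "\<And>n. norm (F n) \<le> 1"
begin

definition sieve_primes :: "nat set" where "sieve_primes = primes_upto J1 - primes_upto J0"

definition omega :: "nat \<Rightarrow> nat" where "omega n = card {r \<in> sieve_primes. r dvd n}"

text \<open>For \<open>n = p * m\<close> with \<open>p\<close> in the sieving set and not dividing
  \<open>m\<close>, this is the reciprocal of the number of sieving primes dividing
  \<open>n\<close>.\<close>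

definition w :: "nat \<Rightarrow> real" where "w m = 1 / (real (omega m) + 1)"

definition T :: "nat \<Rightarrow> complex" where
  "T p = (\<Sum>m\<in>{1..N div p}. f p * f m * of_real (w m) * F (p * m))"

lemma finite_sieve_primes: "finite sieve_primes" and sieve_primes_prime: "p \<in> sieve_primes \<Longrightarrow> prime p"
  by (auto simp: sieve_primes_def primes_upto_def)

lemma w_nonneg: "w m \<ge> 0" and w_le_1: "w m \<le> 1"
  by (simp_all add: w_def)

lemma norm_term_le: "norm (f p * f m * of_real (w m) * F n) \<le> w m"
proof -
  have "norm (f p * f m) \<le> 1 * 1" unfolding norm_mult by (intro mult_mono f_le) auto
  then have "norm (f p * f m * of_real (w m) * F n) \<le> 1 * w m * 1"
    unfolding norm_mult[of "f p * f m * of_real (w m)"] norm_mult[of "f p * f m"]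
    by (intro mult_mono F_le) (auto simp: w_nonneg)
  then show ?thesis by simp
qed

text \<open>If no square of a sieving prime divides \<open>n\<close>, each of the
  \<open>card D\<close> terms is \<open>f n * F n / card D\<close>. Integers without sieving prime
  cost at most 1. In the square case \<open>card D \<le> omega (n div p) + 1\<close> still bounds
  \<open>r\<close> by 1, for a total cost of 2.\<close>

lemma ramare_identity:
  assumes n: "n > 0"
  defines "r \<equiv> (\<Sum>p | p \<in> sieve_primes \<and> p dvd n. f p * f (n div p) * of_real (w (n div p)) * F n)"
  shows "norm (f n * F n - r) \<le> (if \<forall>p\<in>sieve_primes. \<not> p dvd n then 1 else 0) + (if \<exists>p\<in>sieve_primes. p\<^sup>2 dvd n then 2 else 0)"
proof -
  define D where "D = {p \<in> sieve_primes. p dvd n}"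
  have finD: "finite D" using finite_sieve_primes by (simp add: D_def)
  have fF: "norm (f n * F n) \<le> 1"
    using mult_mono[OF f_le[of n] F_le[of n]] by (simp add: norm_mult)
  consider (A) "D = {}" | (B) "D \<noteq> {}" "\<exists>p\<in>sieve_primes. p\<^sup>2 dvd n" | (C) "D \<noteq> {}" "\<not> (\<exists>p\<in>sieve_primes. p\<^sup>2 dvd n)" by blast
  then show ?thesis
  proof cases
    case A
    then have "r = 0" unfolding r_def D_def by (simp only: sum.empty)
    moreover have "\<forall>p\<in>sieve_primes. \<not> p dvd n" using A by (auto simp: D_def)
    ultimately show ?thesis using fF by simp
  next
    case B
    have D0: "card D > 0" using B finD by (simp add: card_gt_0_iff)
    have "norm (f p * f (n div p) * of_real (w (n div p)) * F n) \<le> 1 / real (card D)" if p: "p \<in> D" for p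
    proof -
      have "D \<subseteq> insert p {r \<in> sieve_primes. r dvd n div p}"
      proof
        fix s assume s: "s \<in> D"
        obtain m where m: "n = p * m" using p by (auto simp: D_def dvd_def)
        have "p > 0" using m n by auto
        have "s dvd p \<or> s dvd m" using s m sieve_primes_prime by (auto simp: D_def prime_dvd_mult_iff)
        moreover have "s = p" if "s dvd p"
          using that s p sieve_primes_prime primes_dvd_imp_eq[of s p] by (auto simp: D_def)
        ultimately show "s \<in> insert p {r \<in> sieve_primes. r dvd n div p}" using s m \<open>p > 0\<close> by (auto simp: D_def)
      qed
      then have "card D \<le> card (insert p {r \<in> sieve_primes. r dvd n div p})"
        using finite_sieve_primes by (intro card_mono) auto
      also have "\<dots> \<le> Suc (omega (n div p))" unfolding omega_def by (rule card_insert_le_m1) auto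
      finally have "real (card D) \<le> real (omega (n div p)) + 1" by linarith
      then have "w (n div p) \<le> 1 / real (card D)" unfolding w_def using D0 by (intro divide_left_mono) auto
      then show ?thesis using norm_term_le[of p "n div p" n] by linarith
    qed
    then have "norm r \<le> (\<Sum>p\<in>D. 1 / real (card D))"
      unfolding r_def D_def by (intro sum_norm_le) auto
    also have "\<dots> = 1" using D0 by simp
    finally have "norm (f n * F n - r) \<le> 2" using fF norm_triangle_ineq4[of "f n * F n" r] by linarith
    then show ?thesis using B by simp
  next
    case C
    have "f p * f (n div p) * of_real (w (n div p)) * F n = f n * F n * of_real (1 / real (card D))" if p: "p \<in> D" for p
    proof -
      obtain m where m: "n = p * m" using p by (auto simp: D_def dvd_def)
      have pp: "prime p" "p \<in> sieve_primes" using p sieve_primes_prime by (auto simp: D_def)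
      then have p0: "p > 0" by (auto simp: prime_gt_0_nat)
      have nd: "\<not> p dvd m" using C(2) pp(2) m by (auto simp: power2_eq_square)
      then have "coprime p m" using pp(1) by (simp add: prime_imp_coprime)
      then have fn: "f n = f p * f m" using f_mult by (simp add: multiplicative_def m)
      have "D = insert p {r \<in> sieve_primes. r dvd m}"
      proof (intro equalityI subsetI)
        fix s assume s: "s \<in> D"
        have "s dvd p \<or> s dvd m" using s m sieve_primes_prime by (auto simp: D_def prime_dvd_mult_iff)
        moreover have "s = p" if "s dvd p"
          using that s p sieve_primes_prime primes_dvd_imp_eq[of s p] by (auto simp: D_def)
        ultimately show "s \<in> insert p {r \<in> sieve_primes. r dvd m}" using s by (auto simp: D_def)
      qed (use p m in \<open>auto simp: D_def\<close>)
      then have "card D = Suc (omega m)" unfolding omega_def using nd finite_sieve_primes by simp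
      then show ?thesis using fn m p0 by (simp add: w_def)
    qed
    then have "r = (\<Sum>p\<in>D. f n * F n * of_real (1 / real (card D)))"
      unfolding r_def D_def by (intro sum.cong) auto
    also have "\<dots> = f n * F n" using C(1) finD by simp
    finally show ?thesis by simp
  qed
qed

lemma sum_T_eq:
  "(\<Sum>p\<in>sieve_primes. T p) = (\<Sum>n=1..N. \<Sum>p | p \<in> sieve_primes \<and> p dvd n. f p * f (n div p) * of_real (w (n div p)) * F n)"
proof -
  have T: "T p = (\<Sum>n\<in>{1..N}. if p dvd n then f p * f (n div p) * of_real (w (n div p)) * F n else 0)" if "p \<in> sieve_primes" for p
  proof -
    have p0: "p > 0" using sieve_primes_prime[OF that] by (rule prime_gt_0_nat)
    have "T p = (\<Sum>n\<in>{n \<in> {1..N}. p dvd n}. f p * f (n div p) * of_real (w (n div p)) * F n)"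
      unfolding T_def
      by (rule sum.reindex_bij_witness[of _ "\<lambda>n. n div p" "\<lambda>m. p * m"])
        (use p0 in \<open>auto simp: div_le_mono less_eq_div_iff_mult_less_eq mult.commute Suc_le_eq elim!: dvdE\<close>)
    also have "\<dots> = (\<Sum>n\<in>{1..N}. if p dvd n then f p * f (n div p) * of_real (w (n div p)) * F n else 0)"
      by (rule sum.inter_filter) simp
    finally show ?thesis .
  qed
  have "(\<Sum>p\<in>sieve_primes. T p) = (\<Sum>n\<in>{1..N}. \<Sum>p\<in>sieve_primes. if p dvd n then f p * f (n div p) * of_real (w (n div p)) * F n else 0)"
    by (subst sum.swap) (simp add: T cong: sum.cong)
  then show ?thesis by (simp only: sum.inter_filter[OF finite_sieve_primes, symmetric])
qed

lemma square_divisible_count: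
  "real (card {n \<in> {1..N}. \<exists>p\<in>sieve_primes. p\<^sup>2 dvd n}) \<le> real N / 2 ^ J0"
proof -
  have c: "card {n \<in> {1..N}. p\<^sup>2 dvd n} = N div p\<^sup>2" if "p > 0" for p
  proof -
    have "{n \<in> {1..N}. p\<^sup>2 dvd n} = (\<lambda>m. p\<^sup>2 * m) ` {1..N div p\<^sup>2}"
      using that by (auto simp: less_eq_div_iff_mult_less_eq mult.commute Suc_le_eq elim!: dvdE)
    then show ?thesis using that by (simp add: card_image inj_on_def)
  qed
  have "{n \<in> {1..N}. \<exists>p\<in>sieve_primes. p\<^sup>2 dvd n} = (\<Union>p\<in>sieve_primes. {n \<in> {1..N}. p\<^sup>2 dvd n})" by auto
  then have "card {n \<in> {1..N}. \<exists>p\<in>sieve_primes. p\<^sup>2 dvd n} \<le> (\<Sum>p\<in>sieve_primes. card {n \<in> {1..N}. p\<^sup>2 dvd n})"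
    using card_UN_le[OF finite_sieve_primes] by simp
  also have "\<dots> = (\<Sum>p\<in>sieve_primes. N div p\<^sup>2)"
    using c sieve_primes_prime by (intro sum.cong) (auto simp: prime_gt_0_nat)
  finally have "real (card {n \<in> {1..N}. \<exists>p\<in>sieve_primes. p\<^sup>2 dvd n}) \<le> real (\<Sum>p\<in>sieve_primes. N div p\<^sup>2)"
    by (simp only: of_nat_le_iff)
  also have "\<dots> \<le> (\<Sum>p\<in>sieve_primes. real N * (1 / real p ^ 2))"
    unfolding of_nat_sum
  proof (rule sum_mono)
    fix p
    show "real (N div p\<^sup>2) \<le> real N * (1 / real p ^ 2)" using of_nat_div_le_of_nat[where 'a = real, of N "p\<^sup>2"] by simp
  qed
  also have "\<dots> = real N * (\<Sum>p\<in>sieve_primes. 1 / real p ^ 2)" by (simp only: sum_distrib_left)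
  also have "(\<Sum>p\<in>sieve_primes. 1 / real p ^ 2) \<le> (\<Sum>k\<in>{2 ^ J0<..2 ^ J1}. 1 / real k ^ 2)"
    by (rule sum_mono2) (auto simp: sieve_primes_def primes_upto_def)
  also have "\<dots> \<le> 1 / real (2 ^ J0)" by (rule sum_inverse_squares_le) simp
  finally show ?thesis by (simp add: mult_left_mono)
qed

text \<open>Cauchy--Schwarz over \<open>m\<close> removes the unknown \<open>f m * w m\<close>.
  After opening the square, \<open>p = p'\<close> gives the first term and the correlations give the
  second. Within a block \<open>N div p\<close> varies by a bounded factor only, so one range
  \<open>M\<close> serves all primes.\<close>

lemma block_bound:
  assumes j: "J0 \<le> j" "j < J1" and B: "B \<ge> 0"
    and corr: "\<And>p p' K. p \<in> sieve_primes \<Longrightarrow> p' \<in> sieve_primes \<Longrightarrow> p \<noteq> p' \<Longrightarrow> K * p \<le> N \<Longrightarrow> K * p' \<le> N \<Longrightarrow>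
      norm (\<Sum>m=1..K. F (p * m) * cnj (F (p' * m))) \<le> B"
  shows "norm (\<Sum>p\<in>primes_block j. T p) \<le> real N / sqrt (2 ^ j) + sqrt (real N * 2 ^ j * B)"
proof -
  define P where "P = primes_block j"
  have Pfin: "finite P" by (simp add: P_def)
  have "(2::nat) ^ J0 \<le> 2 ^ j" "(2::nat) ^ Suc j \<le> 2 ^ J1"
    using j by (auto intro!: power_increasing simp del: power_Suc)
  note pow_le = this
  have PPP: "p \<in> sieve_primes" "p > 2 ^ j" "prime p" if "p \<in> P" for p
  proof -
    have p: "prime p" "2 ^ j < p" "p \<le> 2 ^ Suc j" using that by (auto simp: P_def primes_block_def simp del: power_Suc)
    then have "p \<le> 2 ^ J1" "\<not> p \<le> 2 ^ J0" using pow_le by linarith+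
    then show "p \<in> sieve_primes" "p > 2 ^ j" "prime p" using p by (auto simp: sieve_primes_def primes_upto_def)
  qed
  define M where "M = N div 2 ^ j"
  \<comment> \<open>The condition \<open>p * m \<le> N\<close> is kept inside, so that the range of
    \<open>m\<close> no longer depends on \<open>p\<close> and the sums can be interchanged.\<close>
  define U where "U m = (\<Sum>p\<in>P. if p * m \<le> N then f p * F (p * m) else 0)" for m
  have NM: "N div p \<le> M" if "p \<in> P" for p
    unfolding M_def using PPP(2)[OF that] by (intro div_le_mono2) auto
  have iff: "m \<le> N div p \<longleftrightarrow> p * m \<le> N" if "p \<in> P" for p m
    using PPP(3)[OF that] by (simp add: less_eq_div_iff_mult_less_eq prime_gt_0_nat mult.commute)
  have T_eq: "T p = (\<Sum>m\<in>{1..M}. if p * m \<le> N then f p * f m * of_real (w m) * F (p * m) else 0)" if "p \<in> P" for p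
  proof -
    have "{1..N div p} = {m \<in> {1..M}. p * m \<le> N}"
      unfolding iff[OF that, symmetric] using NM[OF that] by auto
    then show ?thesis unfolding T_def by (simp only: sum.inter_filter finite_atLeastAtMost)
  qed
  have "(\<Sum>p\<in>P. T p) = (\<Sum>p\<in>P. \<Sum>m\<in>{1..M}. if p * m \<le> N then f p * f m * of_real (w m) * F (p * m) else 0)"
    by (intro sum.cong refl T_eq)
  also have "\<dots> = (\<Sum>m\<in>{1..M}. f m * of_real (w m) * U m)"
    by (subst sum.swap) (auto simp: U_def sum_distrib_left mult_ac intro!: sum.cong)
  finally have "norm (\<Sum>p\<in>P. T p) \<le> (\<Sum>m\<in>{1..M}. norm (f m * of_real (w m) * U m))"
    by (simp add: norm_sum)
  also have "\<dots> \<le> (\<Sum>m\<in>{1..M}. norm (U m))"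
  proof (rule sum_mono)
    fix m
    have "norm (f m * of_real (w m)) \<le> 1 * 1"
      unfolding norm_mult by (intro mult_mono f_le) (auto simp: w_nonneg w_le_1)
    then show "norm (f m * of_real (w m) * U m) \<le> norm (U m)"
      unfolding norm_mult[of "f m * of_real (w m)"] by (simp add: mult_left_le_one_le)
  qed
  finally have 1: "norm (\<Sum>p\<in>P. T p) \<le> (\<Sum>m\<in>{1..M}. norm (U m))" .
  have "(\<Sum>m\<in>{1..M}. norm (U m))\<^sup>2 \<le> (\<Sum>m\<in>{1..M}. (norm (U m))\<^sup>2) * real M"
    using Cauchy_Schwarz_ineq_sum[of "\<lambda>m. norm (U m)" "\<lambda>_. 1" "{1..M}"] by simp
  moreover have "(\<Sum>m\<in>{1..M}. (norm (U m))\<^sup>2) \<le> 2 ^ j * real M + 2 ^ j * 2 ^ j * B"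
  proof -
    define C where "C p p' = (\<Sum>m\<in>{1..M}. if p * m \<le> N \<and> p' * m \<le> N then F (p * m) * cnj (F (p' * m)) else 0)" for p p'
    have C_le: "norm (C p p') \<le> (if p = p' then real M else 0) + B" if p: "p \<in> P" and p': "p' \<in> P" for p p'
    proof (cases "p = p'")
      case True
      have "norm (C p p') \<le> (\<Sum>m\<in>{1..M}. 1)"
        unfolding C_def using F_le by (intro sum_norm_le) (auto simp: norm_mult intro: mult_le_one)
      then show ?thesis using True B by simp
    next
      case False
      define K where "K = min (N div p) (N div p')"
      have "{1..K} = {m \<in> {1..M}. p * m \<le> N \<and> p' * m \<le> N}"
        unfolding iff[OF p, symmetric] iff[OF p', symmetric] using NM[OF p] by (auto simp: K_def)
      then have "C p p' = (\<Sum>m\<in>{1..K}. F (p * m) * cnj (F (p' * m)))"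
        unfolding C_def by (simp only: sum.inter_filter finite_atLeastAtMost)
      moreover have "K * p \<le> N" "K * p' \<le> N"
        using iff[OF p, of K] iff[OF p', of K] by (simp_all add: K_def mult.commute)
      ultimately show ?thesis using corr[OF PPP(1)[OF p] PPP(1)[OF p'] False] False by simp
    qed
    have "of_real (\<Sum>m\<in>{1..M}. (norm (U m))\<^sup>2) = (\<Sum>m\<in>{1..M}. U m * cnj (U m))"
      by (simp only: of_real_sum complex_norm_square)
    also have "\<dots> = (\<Sum>m\<in>{1..M}. \<Sum>p\<in>P. \<Sum>p'\<in>P. f p * cnj (f p') * (if p * m \<le> N \<and> p' * m \<le> N then F (p * m) * cnj (F (p' * m)) else 0))"
      unfolding U_def cnj_sum sum_product by (intro sum.cong refl) auto
    also have "\<dots> = (\<Sum>p\<in>P. \<Sum>p'\<in>P. f p * cnj (f p') * C p p')"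
      by (subst sum.swap, rule sum.cong[OF refl], subst sum.swap) (simp add: C_def sum_distrib_left)
    finally have eq: "of_real (\<Sum>m\<in>{1..M}. (norm (U m))\<^sup>2) = (\<Sum>p\<in>P. \<Sum>p'\<in>P. f p * cnj (f p') * C p p')" .
    have "(\<Sum>m\<in>{1..M}. (norm (U m))\<^sup>2) = norm (\<Sum>p\<in>P. \<Sum>p'\<in>P. f p * cnj (f p') * C p p')"
      unfolding eq[symmetric] norm_of_real by (simp add: sum_nonneg)
    also have "\<dots> \<le> (\<Sum>p\<in>P. \<Sum>p'\<in>P. (if p = p' then real M else 0) + B)"
    proof (intro sum_norm_le)
      fix p p' assume p: "p \<in> P" "p' \<in> P"
      have "norm (f p * cnj (f p')) \<le> 1 * 1" unfolding norm_mult complex_mod_cnj by (intro mult_mono f_le) auto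
      then have "norm (f p * cnj (f p') * C p p') \<le> norm (C p p')"
        unfolding norm_mult[of "f p * cnj (f p')"] by (simp add: mult_left_le_one_le)
      then show "norm (f p * cnj (f p') * C p p') \<le> (if p = p' then real M else 0) + B"
        using C_le[OF p] by linarith
    qed
    also have "\<dots> = real (card P) * real M + real (card P) * real (card P) * B"
      using Pfin by (simp add: sum.distrib algebra_simps)
    also have "\<dots> \<le> 2 ^ j * real M + 2 ^ j * 2 ^ j * B"
    proof -
      have "card P \<le> card {2 ^ j<..(2::nat) ^ Suc j}" by (rule card_mono) (auto simp: P_def primes_block_def)
      then have "real (card P) \<le> 2 ^ j" by simp
      then show ?thesis using B by (intro add_mono mult_right_mono mult_mono) auto
    qed
    finally show ?thesis .
  qed
  ultimately have "(\<Sum>m\<in>{1..M}. norm (U m))\<^sup>2 \<le> (2 ^ j * real M + 2 ^ j * 2 ^ j * B) * real M"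
    by (meson mult_right_mono of_nat_0_le_iff order_trans)
  also have "\<dots> \<le> (2 ^ j * (real N / 2 ^ j) + 2 ^ j * 2 ^ j * B) * (real N / 2 ^ j)"
  proof -
    have "real M \<le> real N / 2 ^ j" unfolding M_def using of_nat_div_le_of_nat[where 'a = real, of N "2 ^ j"] by simp
    then show ?thesis using B by (intro mult_mono add_mono) auto
  qed
  also have "\<dots> = (real N / sqrt (2 ^ j))\<^sup>2 + real N * 2 ^ j * B"
    by (simp add: power_divide field_simps power2_eq_square)
  finally have "(\<Sum>m\<in>{1..M}. norm (U m)) \<le> sqrt ((real N / sqrt (2 ^ j))\<^sup>2 + real N * 2 ^ j * B)"
    by (rule real_le_rsqrt)
  also have "\<dots> \<le> sqrt ((real N / sqrt (2 ^ j))\<^sup>2) + sqrt (real N * 2 ^ j * B)"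
    using B by (intro sqrt_add_le_add_sqrt) auto
  also have "sqrt ((real N / sqrt (2 ^ j))\<^sup>2) = real N / sqrt (2 ^ j)" by simp
  finally show ?thesis using 1 by (simp add: P_def)
qed

lemma sieve_primes_blocks: "J0 \<le> J1 \<Longrightarrow> (\<Sum>p\<in>sieve_primes. T p) = (\<Sum>j=J0..<J1. \<Sum>p\<in>primes_block j. T p)"
proof -
  assume J: "J0 \<le> J1"
  have "(2::nat) ^ J0 \<le> 2 ^ J1" using J by (intro power_increasing) auto
  then have "primes_upto J0 \<subseteq> primes_upto J1" unfolding primes_upto_def by (auto intro: order_trans)
  then show ?thesis using sum_primes_upto_blocks[OF J, of T] by (simp add: sieve_primes_def sum_diff)
qed

theorem multiplicative_sum_bound:
  assumes J: "0 < J0" "J0 \<le> J1" and B: "B \<ge> 0"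
    and corr: "\<And>p p' K. p \<in> sieve_primes \<Longrightarrow> p' \<in> sieve_primes \<Longrightarrow> p \<noteq> p' \<Longrightarrow> K * p \<le> N \<Longrightarrow> K * p' \<le> N \<Longrightarrow>
      norm (\<Sum>m=1..K. F (p * m) * cnj (F (p' * m))) \<le> B"
  shows "norm (\<Sum>n=1..N. f n * F n) \<le> real N * (2 * exp 4 * real J0 ^ 4 / (real J1 * ln 2)) + 2 ^ (2 ^ J1)
    + 2 * (real N / 2 ^ J0) + real J1 * (real N / sqrt (2 ^ J0) + sqrt (real N * 2 ^ J1 * B))"
proof -
  define r where "r n = (\<Sum>p | p \<in> sieve_primes \<and> p dvd n. f p * f (n div p) * of_real (w (n div p)) * F n)" for n
  have "norm (\<Sum>n=1..N. f n * F n - r n) \<le> (\<Sum>n=1..N. (if \<forall>p\<in>sieve_primes. \<not> p dvd n then 1 else 0) + (if \<exists>p\<in>sieve_primes. p\<^sup>2 dvd n then 2 else 0))"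
    unfolding r_def by (intro sum_norm_le ramare_identity) auto
  also have "\<dots> = real (card {n \<in> {1..N}. \<forall>p\<in>sieve_primes. \<not> p dvd n}) + 2 * real (card {n \<in> {1..N}. \<exists>p\<in>sieve_primes. p\<^sup>2 dvd n})"
    by (simp add: sum.distrib flip: sum.inter_filter)
  also have "{n \<in> {1..N}. \<forall>p\<in>sieve_primes. \<not> p dvd n} = {n. 1 \<le> n \<and> real n \<le> real N \<and> (\<forall>p\<in>sieve_primes. \<not> p dvd n)}" by auto
  also have "real (card \<dots>) \<le> real N * (2 * exp 4 * real J0 ^ 4 / (real J1 * ln 2)) + 2 ^ (2 ^ J1)"
    unfolding sieve_primes_def by (rule sieved_count_le[OF J]) simp
  also have "2 * real (card {n \<in> {1..N}. \<exists>p\<in>sieve_primes. p\<^sup>2 dvd n}) \<le> 2 * (real N / 2 ^ J0)"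
    using square_divisible_count by simp
  finally have 1: "norm (\<Sum>n=1..N. f n * F n - r n) \<le> real N * (2 * exp 4 * real J0 ^ 4 / (real J1 * ln 2)) + 2 ^ (2 ^ J1) + 2 * (real N / 2 ^ J0)"
    by simp
  have "(\<Sum>n=1..N. r n) = (\<Sum>j=J0..<J1. \<Sum>p\<in>primes_block j. T p)"
    using sum_T_eq sieve_primes_blocks[OF J(2)] by (simp add: r_def)
  also have "norm \<dots> \<le> (\<Sum>j=J0..<J1. real N / sqrt (2 ^ J0) + sqrt (real N * 2 ^ J1 * B))"
  proof (rule sum_norm_le)
    fix j assume "j \<in> {J0..<J1}"
    then have j: "J0 \<le> j" "j < J1" by auto
    have "(2::real) ^ J0 \<le> 2 ^ j" "(2::real) ^ j \<le> 2 ^ J1" using j by (auto intro!: power_increasing)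
    then have "real N / sqrt (2 ^ j) \<le> real N / sqrt (2 ^ J0)" "sqrt (real N * 2 ^ j * B) \<le> sqrt (real N * 2 ^ J1 * B)"
      using B by (auto intro!: divide_left_mono mult_right_mono mult_left_mono)
    then show "norm (\<Sum>p\<in>primes_block j. T p) \<le> real N / sqrt (2 ^ J0) + sqrt (real N * 2 ^ J1 * B)"
      using block_bound[OF j B corr] by linarith
  qed
  also have "\<dots> = real (J1 - J0) * (real N / sqrt (2 ^ J0) + sqrt (real N * 2 ^ J1 * B))" by simp
  also have "\<dots> \<le> real J1 * (real N / sqrt (2 ^ J0) + sqrt (real N * 2 ^ J1 * B))"
    using B by (intro mult_right_mono) auto
  finally have 2: "norm (\<Sum>n=1..N. r n) \<le> real J1 * (real N / sqrt (2 ^ J0) + sqrt (real N * 2 ^ J1 * B))" .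
  have "(\<Sum>n=1..N. f n * F n) = (\<Sum>n=1..N. f n * F n - r n) + (\<Sum>n=1..N. r n)" by (simp add: sum_subtractf)
  then have "norm (\<Sum>n=1..N. f n * F n) \<le> norm (\<Sum>n=1..N. f n * F n - r n) + norm (\<Sum>n=1..N. r n)"
    by (metis norm_triangle_ineq)
  then show ?thesis using 1 2 by linarith
qed

end

section \<open>The main estimate\<close>

text \<open>The phase in \<open>m\<close> is \<open>c / m + d * m\<close> with
  \<open>c = a * (1 / p - 1 / p')\<close>. It is nonzero modulo \<open>q\<close> because
  \<open>p\<close> and \<open>p'\<close> are distinct and below \<open>q\<close>.\<close>

lemma kloosterman_correlation_bound:
  fixes a b :: int and q :: nat
  defines "F \<equiv> \<lambda>n::nat. if coprime n q then e_q (int q) (a * modular_inverse (int q) (int n) + b * int n) else 0"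
  assumes q: "prime q" and a: "coprime a (int q)"
    and p: "0 < p" "p < q" "0 < p'" "p' < q" "p \<noteq> p'" and K: "K < q"
  shows "norm (\<Sum>m=1..K. F (p * m) * cnj (F (p' * m))) \<le> sqrt (real q) * (6 + 4 * ln (real q))"
proof -
  define v where "v n = modular_inverse (int q) n" for n
  have q0: "int q > 0" using q by (simp add: prime_gt_0_nat)
  have co: "coprime n q" if "0 < n" "n < q" for n :: nat
    using that q by (metis coprime_commute nat_dvd_not_less prime_imp_coprime)
  have coi: "coprime (int n) (int q)" if "0 < n" "n < q" for n :: nat
    using co[OF that] by simp
  have vinv: "[n * v n = 1] (mod int q)" if "n \<in> {1..<int q}" for n
  proof -
    have "coprime (int (nat n)) (int q)" using that by (intro coi) auto
    then show ?thesis using that unfolding v_def by (intro cong_modular_inverse1) auto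
  qed
  define c where "c = a * (v (int p) - v (int p'))"
  have c: "\<not> int q dvd c"
  proof
    assume "int q dvd c"
    then have "int q dvd v (int p) - v (int p')"
      using a unfolding c_def by (simp add: coprime_commute coprime_dvd_mult_right_iff)
    then have vv: "[v (int p) = v (int p')] (mod int q)" by (simp add: cong_iff_dvd_diff)
    have "[int p * 1 = int p * (int p' * v (int p'))] (mod int q)"
      using p by (intro cong_mult cong_refl cong_sym[OF vinv]) auto
    also have "[int p * (int p' * v (int p')) = int p * (int p' * v (int p))] (mod int q)"
      by (intro cong_mult cong_refl cong_sym[OF vv])
    also have "int p * (int p' * v (int p)) = int p' * (int p * v (int p))" by simp
    also have "[int p' * (int p * v (int p)) = int p' * 1] (mod int q)"
      using p by (intro cong_mult cong_refl vinv) auto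
    finally have "int p = int p'" using p by (simp add: cong_def)
    then show False using p by simp
  qed
  have F: "F (r * m) = e_q (int q) (a * (v (int r) * v (int m)) + b * (int r * int m))"
    if r: "0 < r" "r < q" and m: "0 < m" "m < q" for r m
  proof -
    have rm: "coprime (r * m) q" using co[OF r] co[OF m] by simp
    have qr: "coprime q r" "coprime q m"
      using co[OF r] co[OF m] coprime_commute by blast+
    have "[modular_inverse (int q) (int (r * m)) = v (int r) * v (int m)] (mod int q)"
      unfolding of_nat_mult v_def
      by (subst modular_inverse_int_mult) (use qr co[OF r] co[OF m] q0 in \<open>auto simp: cong_def mult.commute\<close>)
    then have "[a * modular_inverse (int q) (int (r * m)) + b * int (r * m)
        = a * (v (int r) * v (int m)) + b * (int r * int m)] (mod int q)"
      by (intro cong_add cong_mult cong_refl) simp_all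
    with rm show ?thesis unfolding F_def using e_q_cong[OF q0] by simp
  qed
  have "(\<Sum>m=1..K. F (p * m) * cnj (F (p' * m))) = (\<Sum>m=1..K. e_q (int q) (c * v (int m) + (b * (int p - int p')) * int m))"
  proof (intro sum.cong refl)
    fix m assume "m \<in> {1..K}"
    then have m: "0 < m" "m < q" using K by auto
    show "F (p * m) * cnj (F (p' * m)) = e_q (int q) (c * v (int m) + (b * (int p - int p')) * int m)"
      unfolding F[OF p(1,2) m] F[OF p(3,4) m] cnj_e_q e_q_add[symmetric]
      by (rule arg_cong[where f = "e_q (int q)"]) (simp add: c_def algebra_simps)
  qed
  also have "\<dots> = (\<Sum>m\<in>{1..int K}. e_q (int q) (c * v m + (b * (int p - int p')) * m))"
    by (rule sum.reindex_bij_witness[of _ nat int]) auto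
  also have "norm \<dots> \<le> sqrt (real q) * (6 + 4 * ln (real q))"
    by (rule incomplete_kloosterman_bound[OF q c vinv]) (use K in auto)
  finally show ?thesis .
qed

theorem theorem4:
  fixes \<gamma> :: real
  assumes "\<gamma> > 0"
  shows "\<exists>q4::real. \<forall>(q::nat) (a::int) (b::int) (f::nat \<Rightarrow> complex) (x::real).
    prime q \<longrightarrow> real q \<ge> q4 \<longrightarrow> coprime a (int q) \<longrightarrow>
    multiplicative f \<longrightarrow> (\<forall>n. norm (f n) \<le> 1) \<longrightarrow>
    sqrt (real q) * ln (real q) * exp ((ln (ln (ln (real q)))) powr (1 + \<gamma>)) \<le> x \<longrightarrow>
    x \<le> real q \<longrightarrow>
    norm (\<Sum>n\<in>{n::nat. 1 \<le> n \<and> real n \<le> x \<and> coprime n q}.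
            f n * e_q (int q) (a * modular_inverse (int q) (int n) + b * int n))
      \<le> 562 * x / (ln (ln (ln (real q)))) powr \<gamma>"
proof -
  \<comment> \<open>Since \<open>ln 2 \<ge> 2 / 3\<close>, the factor 3 yields
    \<open>sqrt (2 ^ J0) \<ge> L powr (1 + 2 * \<gamma>)\<close>, which is what the diagonal term
    \<open>t4\<close> requires.\<close>
  define c where "c = 3 * (1 + 2 * \<gamma>)"
  have c0: "c > 0" using assms by (simp add: c_def)
  have "eventually (\<lambda>L::real. L > 1 \<and> 8 * exp 4 * (c * ln L + 1) ^ 4 \<le> ln 2 * L \<and>
      L powr (1 + \<gamma>) / 2 + ln 2 \<le> exp L \<and> c * ln L + 1 \<le> L powr (1 + \<gamma>) / 2 - 1 \<and>
      2 * (L powr (1 + \<gamma>)) ^ 2 \<le> exp (L powr (1 + \<gamma>) / 4) \<and> L powr (1 + \<gamma>) \<ge> 4) at_top"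
    using assms c0 by (intro eventually_conj; real_asymp)
  then obtain L0 where L0: "\<And>L. L \<ge> L0 \<Longrightarrow> L > 1 \<and> 8 * exp 4 * (c * ln L + 1) ^ 4 \<le> ln 2 * L \<and>
      L powr (1 + \<gamma>) / 2 + ln 2 \<le> exp L \<and> c * ln L + 1 \<le> L powr (1 + \<gamma>) / 2 - 1 \<and>
      2 * (L powr (1 + \<gamma>)) ^ 2 \<le> exp (L powr (1 + \<gamma>) / 4) \<and> L powr (1 + \<gamma>) \<ge> 4"
    unfolding eventually_at_top_linorder by metis
  show ?thesis
  \<comment> \<open>The triple exponential makes the triple logarithm at least \<open>L0\<close>,
    and all nested logarithms positive.\<close>
  proof (intro exI[of _ "exp (exp (exp L0))"] allI impI)
    fix q :: nat and a b :: int and f :: "nat \<Rightarrow> complex" and x :: real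
    assume q: "prime q" and qbig: "real q \<ge> exp (exp (exp L0))" and a: "coprime a (int q)"
      and f: "multiplicative f" "\<forall>n. norm (f n) \<le> 1"
      and xl: "sqrt (real q) * ln (real q) * exp ((ln (ln (ln (real q)))) powr (1 + \<gamma>)) \<le> x"
      and xu: "x \<le> real q"
    define L where "L = ln (ln (ln (real q)))"
    define u where "u = L powr (1 + \<gamma>)"
    have q0: "real q > 0" using q by (simp add: prime_gt_0_nat)
    have l1: "ln (real q) \<ge> exp (exp L0)" using qbig q0 by (simp add: ln_ge_iff)
    then have lq0: "ln (real q) > 0" using exp_gt_zero less_le_trans by blast
    have l2: "ln (ln (real q)) \<ge> exp L0" using l1 lq0 by (simp add: ln_ge_iff)
    then have llq0: "ln (ln (real q)) > 0" using exp_gt_zero less_le_trans by blast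
    have "L \<ge> L0" using l2 llq0 by (simp add: L_def ln_ge_iff)
    from L0[OF this] have L: "L > 1" and h1: "8 * exp 4 * (c * ln L + 1) ^ 4 \<le> ln 2 * L"
      and h2: "u / 2 + ln 2 \<le> exp L" and h3: "c * ln L + 1 \<le> u / 2 - 1"
      and h4: "2 * u ^ 2 \<le> exp (u / 4)" and h5: "u \<ge> 4"
      by (simp_all add: u_def)
    have lnL: "ln L > 0" using L by simp
    have lq: "ln (real q) = exp (exp L)" using lq0 llq0 by (simp add: L_def)
    have uL: "u = L * L powr \<gamma>" using L by (simp add: u_def powr_add)
    have Lg: "L powr \<gamma> \<ge> 1" using L assms by (simp add: ge_one_powr_ge_zero)
    have Lgu: "L powr \<gamma> \<le> u" using L Lg by (simp add: uL)
    \<comment> \<open>As \<open>ln 2 < 1\<close>, this keeps \<open>2 ^ J1\<close> below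
      \<open>exp (u / 2)\<close>, half of the exponent by which \<open>x\<close> exceeds
      \<open>B\<close>. The other half is the saving in \<open>t5\<close>.\<close>
    define J1 where "J1 = nat \<lfloor>u / 2\<rfloor>"
    define J0 where "J0 = nat \<lceil>c * ln L\<rceil>"
    have cL: "c * ln L > 0" using c0 lnL by simp
    have J1: "real J1 \<le> u / 2" "real J1 \<ge> u / 4" "real J1 \<ge> u / 2 - 1" using h5 unfolding J1_def by linarith+
    have J0: "real J0 \<ge> c * ln L" "real J0 \<le> c * ln L + 1" using cL unfolding J0_def by linarith+
    have J0p: "0 < J0" using J0 cL by linarith
    have J01: "J0 \<le> J1" using J0(2) J1(3) h3 by linarith
    have two: "2 ^ J = exp (real J * ln 2)" for J :: nat by (simp add: exp_of_nat_mult)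
    have pow1: "2 ^ J1 \<le> exp (u / 2)"
    proof -
      have "real J1 * ln 2 \<le> real J1 * 1" using ln_2_less_1 by (intro mult_left_mono) auto
      then show ?thesis unfolding two using J1(1) by simp
    qed
    have pow1': "2 ^ J1 \<le> ln (real q) / 2"
    proof -
      have "exp (u / 2) * 2 = exp (u / 2 + ln 2)" by (simp add: exp_add)
      also have "\<dots> \<le> exp (exp L)" using h2 by simp
      finally show ?thesis using pow1 lq by simp
    qed
    have pow0: "sqrt (2 ^ J0) \<ge> L * L powr (2 * \<gamma>)"
    proof -
      have "2 / 3 * (c * ln L) \<le> ln 2 * real J0"
        using ln2_ge_two_thirds J0(1) cL by (intro mult_mono) auto
      moreover have "2 / 3 * (c * ln L) = 2 * ((1 + 2 * \<gamma>) * ln L)" by (simp add: c_def)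
      ultimately have "2 * ((1 + 2 * \<gamma>) * ln L) \<le> real J0 * ln 2" by (simp only: mult.commute[of "ln 2"])
      then have "exp (2 * ((1 + 2 * \<gamma>) * ln L)) \<le> 2 ^ J0" unfolding two by (simp only: exp_le_cancel_iff)
      moreover have "exp (2 * ((1 + 2 * \<gamma>) * ln L)) = (L powr (1 + 2 * \<gamma>))\<^sup>2"
        using L by (simp add: powr_def exp_double)
      ultimately have "(L powr (1 + 2 * \<gamma>))\<^sup>2 \<le> 2 ^ J0" by simp
      then have "L powr (1 + 2 * \<gamma>) \<le> sqrt (2 ^ J0)" by (rule real_le_rsqrt)
      then show ?thesis using L by (simp add: powr_add)
    qed
    define N where "N = nat \<lfloor>x\<rfloor>"
    have lq1: "ln (real q) \<ge> 1" using lq by simp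
    have sq: "sqrt (real q) > 0" using q0 by simp
    have xE: "sqrt (real q) * ln (real q) * exp u \<le> x" using xl by (simp add: u_def L_def)
    have "sqrt (real q) * ln (real q) * exp u > 0" using sq lq0 by simp
    then have x0: "x > 0" using xE by linarith
    have Nx: "real N \<le> x" using x0 by (simp add: N_def)
    have Nq: "N \<le> q" using Nx xu by linarith
    have sqx: "sqrt (real q) \<le> x / L powr \<gamma>"
    proof -
      have "sqrt (real q) * L powr \<gamma> \<le> sqrt (real q) * ln (real q) * exp u"
      proof -
        have "L powr \<gamma> \<le> exp u" using Lgu exp_ge_add_one_self[of u] by linarith
        also have "\<dots> \<le> ln (real q) * exp u" using lq1 by simp
        finally show ?thesis using sq by simp
      qed
      then have "sqrt (real q) * L powr \<gamma> \<le> x" using xE by linarith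
      moreover have "L powr \<gamma> > 0" using Lg by linarith
      ultimately show ?thesis by (simp add: pos_le_divide_eq)
    qed
    \<comment> \<open>The value 0 at integers not prime to \<open>q\<close> lets the sum run over
      all of \<open>{1..N}\<close>.\<close>
    define F where "F = (\<lambda>n::nat. if coprime n q then e_q (int q) (a * modular_inverse (int q) (int n) + b * int n) else 0)"
    define B where "B = sqrt (real q) * (6 + 4 * ln (real q))"
    have B0: "B \<ge> 0" using lq0 by (simp add: B_def)
    have Bx: "B \<le> 10 * x / exp u"
    proof -
      have "B \<le> sqrt (real q) * (10 * ln (real q))" unfolding B_def using lq1 by (intro mult_left_mono) auto
      then have "B * exp u \<le> sqrt (real q) * (10 * ln (real q)) * exp u" by (intro mult_right_mono) auto
      also have "\<dots> \<le> 10 * x" using xE by (simp add: mult_ac)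
      finally show ?thesis by (simp add: pos_le_divide_eq)
    qed
    interpret ramare f F N J0 J1
      by unfold_locales (use f in \<open>auto simp: F_def\<close>)
    have bound: "norm (\<Sum>n=1..N. f n * F n) \<le> real N * (2 * exp 4 * real J0 ^ 4 / (real J1 * ln 2)) + 2 ^ (2 ^ J1)
      + 2 * (real N / 2 ^ J0) + real J1 * (real N / sqrt (2 ^ J0) + sqrt (real N * 2 ^ J1 * B))"
    proof (rule multiplicative_sum_bound[OF J0p J01 B0])
      fix p p' K assume p: "p \<in> sieve_primes" "p' \<in> sieve_primes" "p \<noteq> p'" "K * p \<le> N"
      have lt: "0 < r \<and> r < q" "1 < r" if "r \<in> sieve_primes" for r
      proof -
        have "real r \<le> real (2 ^ J1)" using that by (simp only: sieve_primes_def primes_upto_def of_nat_le_iff) auto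
        also have "\<dots> \<le> ln (real q) / 2" using pow1' by simp
        also have "\<dots> < real q" using ln_less_self[OF q0] lq0 by linarith
        finally show "0 < r \<and> r < q" using sieve_primes_prime[OF that] by (simp add: prime_gt_0_nat)
        show "1 < r" using sieve_primes_prime[OF that] by (rule prime_gt_1_nat)
      qed
      \<comment> \<open>Possibly \<open>N = q\<close>; strictness comes from
        \<open>p > 1\<close>.\<close>
      have "K < q"
      proof (cases "K = 0")
        case False
        then have "K * 1 < K * p" using lt(2)[OF p(1)] by simp
        then show ?thesis using p(4) Nq by linarith
      qed (use lt[OF p(1)] in auto)
      then show "norm (\<Sum>m=1..K. F (p * m) * cnj (F (p' * m))) \<le> B"
        unfolding F_def B_def using lt p by (intro kloosterman_correlation_bound q a) auto
    qed
    \<comment> \<open>The polylogarithmic factor in \<open>L\<close> from \<open>J0 ^ 4\<close> is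
      absorbed by the spare factor \<open>L\<close> in
      \<open>u = L * L powr \<gamma>\<close>.\<close>
    have t1: "real N * (2 * exp 4 * real J0 ^ 4 / (real J1 * ln 2)) \<le> x / L powr \<gamma>"
    proof -
      have "2 * exp 4 * real J0 ^ 4 / (real J1 * ln 2) \<le> 2 * exp 4 * (c * ln L + 1) ^ 4 / (u / 4 * ln 2)"
        using J0(2) J1(2) h5 by (intro frac_le mult_left_mono power_mono mult_right_mono) auto
      also have "\<dots> = 8 * exp 4 * (c * ln L + 1) ^ 4 / (ln 2 * u)" by (simp add: field_simps)
      also have "\<dots> \<le> ln 2 * L / (ln 2 * u)" using h1 h5 by (intro divide_right_mono) auto
      also have "\<dots> = 1 / L powr \<gamma>" using L by (simp add: uL)
      finally have "real N * (2 * exp 4 * real J0 ^ 4 / (real J1 * ln 2)) \<le> x * (1 / L powr \<gamma>)"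
        using Nx x0 by (intro mult_mono) auto
      then show ?thesis by simp
    qed
    have t2: "(2::real) ^ (2 ^ J1) \<le> x / L powr \<gamma>"
    proof -
      have "(2::real) ^ (2 ^ J1) = exp (2 ^ J1 * ln 2)" using two[of "2 ^ J1"] by simp
      also have "\<dots> \<le> exp (ln (real q) / 2)"
      proof -
        have "2 ^ J1 * ln 2 \<le> 2 ^ J1 * (1::real)" using ln_2_less_1 by (intro mult_left_mono) auto
        then show ?thesis unfolding exp_le_cancel_iff using pow1' by linarith
      qed
      also have "\<dots> = sqrt (real q)" using q0 by (simp add: ln_sqrt [symmetric])
      finally show ?thesis using sqx by linarith
    qed
    have t3: "2 * (real N / 2 ^ J0) \<le> 2 * x / L powr \<gamma>"
    proof -
      have "L powr \<gamma> \<le> L * L powr (2 * \<gamma>)"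
      proof -
        have "L powr \<gamma> \<le> L powr (2 * \<gamma>)" using L assms by (intro powr_mono) auto
        also have "\<dots> \<le> L * L powr (2 * \<gamma>)" using L by simp
        finally show ?thesis .
      qed
      also have "\<dots> \<le> sqrt (2 ^ J0)" by (rule pow0)
      also have "\<dots> \<le> 2 ^ J0" by (rule real_le_lsqrt) (auto simp: self_le_power)
      finally have "L powr \<gamma> \<le> 2 ^ J0" .
      then have "real N / 2 ^ J0 \<le> x / L powr \<gamma>" using Nx x0 Lg by (intro frac_le) auto
      then show ?thesis by simp
    qed
    have t4: "real J1 * (real N / sqrt (2 ^ J0)) \<le> x / L powr \<gamma>"
    proof -
      have pos: "L * L powr (2 * \<gamma>) > 0" using L by simp
      have "real J1 * (real N / sqrt (2 ^ J0)) \<le> u * (x / (L * L powr (2 * \<gamma>)))"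
        using J1(1) h5 Nx x0 pow0 pos by (intro mult_mono frac_le) auto
      also have "\<dots> = x / L powr \<gamma>" using L by (simp add: uL powr_add[symmetric] field_simps)
      finally show ?thesis .
    qed
    \<comment> \<open>With \<open>B\<close> about \<open>x / exp u\<close> and \<open>2 ^ J1\<close>
      at most \<open>exp (u / 2)\<close>, the square root saves \<open>exp (u / 4)\<close>, which
      beats \<open>u * L powr \<gamma>\<close>.\<close>
    have t5: "real J1 * sqrt (real N * 2 ^ J1 * B) \<le> x / L powr \<gamma>"
    proof -
      have "real N * 2 ^ J1 * B \<le> x * exp (u / 2) * (10 * x / exp u)"
        using Nx x0 pow1 Bx B0 by (intro mult_mono) auto
      also have "\<dots> = 10 * x\<^sup>2 * exp (- (u / 2))"
        by (simp add: power2_eq_square exp_minus field_simps) (simp flip: exp_add)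
      also have "\<dots> \<le> 16 * x\<^sup>2 * exp (- (u / 2))" by (intro mult_right_mono) auto
      also have "\<dots> = (4 * x * exp (- (u / 4)))\<^sup>2"
        by (simp add: power_mult_distrib flip: exp_double)
      finally have "sqrt (real N * 2 ^ J1 * B) \<le> 4 * x * exp (- (u / 4))"
        using x0 by (intro real_le_lsqrt) auto
      then have "real J1 * sqrt (real N * 2 ^ J1 * B) \<le> u / 2 * (4 * x * exp (- (u / 4)))"
        using J1(1) B0 h5 by (intro mult_mono) auto
      also have "\<dots> = x * (2 * u / exp (u / 4))" by (simp add: exp_minus field_simps)
      also have "\<dots> \<le> x * (1 / L powr \<gamma>)"
      proof (intro mult_left_mono)
        have "2 * u * L powr \<gamma> \<le> 2 * u * u" using Lgu h5 by (intro mult_left_mono) auto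
        also have "\<dots> \<le> exp (u / 4)" using h4 by (simp add: power2_eq_square)
        finally have "2 * u * L powr \<gamma> \<le> exp (u / 4)" .
        moreover have "L powr \<gamma> > 0" using Lg by linarith
        ultimately show "2 * u / exp (u / 4) \<le> 1 / L powr \<gamma>"
          by (simp add: pos_divide_le_eq pos_le_divide_eq)
      qed (use x0 in auto)
      finally show ?thesis by simp
    qed
    have "(\<Sum>n\<in>{n::nat. 1 \<le> n \<and> real n \<le> x \<and> coprime n q}. f n * e_q (int q) (a * modular_inverse (int q) (int n) + b * int n))
      = (\<Sum>n=1..N. f n * F n)"
    proof (rule sum.mono_neutral_cong_left)
      show "{n::nat. 1 \<le> n \<and> real n \<le> x \<and> coprime n q} \<subseteq> {1..N}"
        by (auto simp: N_def intro: le_nat_floor)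
      have "real n \<le> x" if "n \<le> N" for n using that Nx by linarith
      then show "\<forall>n\<in>{1..N} - {n::nat. 1 \<le> n \<and> real n \<le> x \<and> coprime n q}. f n * F n = 0"
        by (auto simp: F_def)
    qed (auto simp: F_def)
    \<comment> \<open>The five terms contribute 1 + 1 + 2 + 1 + 1 = 6 multiples of
      \<open>x / L powr \<gamma>\<close>.\<close>
    then have "norm (\<Sum>n\<in>{n::nat. 1 \<le> n \<and> real n \<le> x \<and> coprime n q}. f n * e_q (int q) (a * modular_inverse (int q) (int n) + b * int n))
      \<le> 6 * (x / L powr \<gamma>)"
      using bound t1 t2 t3 t4 t5 by (simp add: distrib_left)
    also have "\<dots> \<le> 562 * (x / L powr \<gamma>)" using x0 by (intro mult_right_mono) auto
    also have "\<dots> = 562 * x / L powr \<gamma>" by simp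
    finally show "norm (\<Sum>n\<in>{n::nat. 1 \<le> n \<and> real n \<le> x \<and> coprime n q}.
            f n * e_q (int q) (a * modular_inverse (int q) (int n) + b * int n))
      \<le> 562 * x / (ln (ln (ln (real q)))) powr \<gamma>" by (simp add: L_def)
  qed
qed

end
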